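(* Let $\alpha>0$ and let $b:[0,\infty)\times\mathbb{R}^d\to\mathbb{R}^d$ be measurable with $b(t,\cdot)\in\mathcal{C}_b^\alpha(\mathbb{R}^d)$ for each $t\ge 0$ and $\sup_{t\ge0}\|b(t,\cdot)\|_{\mathcal{C}_b^\alpha}<\infty$. Let $\mu_0\in\mathcal{P}(\mathbb{R}^d)$ and let $X$ be the solution of the McKean-Vlasov SDE $$dX_t=\langle b(t,X_t-\cdot),\mu_t\rangle\,dt+dW_t,\qquad \mu_t=\operatorname{Law}(X_t),$$ with initial distribution $\mu_0$. Then for each $t>0$, $\mu_t$ has a density $p_t$ with respect to the Lebesgue measure, and $p_t\in\mathcal{C}_b^{2+\gamma}(\mathbb{R}^d)$ for each $\gamma\in(0,1)$.
   Context: $W$ is a standard $d$-dimensional Brownian motion (independent of $X_0$), $\mathcal{P}(\mathbb{R}^d)$ is the set of Borel probability measures on $\mathbb{R}^d$, and $\langle b(t,x-\cdot),\mu\rangle:=\int_{\mathbb{R}^d}b(t,x-y)\,\mu(dy)$. The equation is known to be well-posed. For $s\in(0,\infty)\setminus\mathbb{Z}$, $\mathcal{C}_b^s(\mathbb{R}^d)$ is the Hölder space of bounded functions that are $\lfloor s\rfloor$ times differentiable with bounded derivatives and whose $\lfloor s\rfloor$-th derivatives are $(s-\lfloor s\rfloor)$-Hölder continuous on $\mathbb{R}^d$, with its usual norm; for integer $s\ge1$, $\mathcal{C}_b^s$ is the space of $s$ times continuously differentiable functions bounded together with their derivatives up to order $s$, with the sup norms of these derivatives. *)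

theory Defs
  imports "HOL-Probability.Probability"
begin

(* D^k f(x)[v_1,...,v_k] for vs = [v_1,...,v_k]: the k-th Frechet derivative, evaluated on the
   directions vs.  Meaningful only where the lower order derivatives are differentiable. *)
primrec iter_deriv ::
  "('a::euclidean_space \<Rightarrow> 'b::real_normed_vector) \<Rightarrow> 'a list \<Rightarrow> 'a \<Rightarrow> 'b" where
  "iter_deriv f [] = f"
| "iter_deriv f (v # vs) = (\<lambda>x. frechet_derivative (iter_deriv f vs) (at x) v)"

definition unit_dirs :: "nat \<Rightarrow> 'a::euclidean_space list set" where
  "unit_dirs k = {vs. length vs = k \<and> (\<forall>v\<in>set vs. norm v \<le> 1)}"

(* Since the domain is finite-dimensional, D^j f is Frechet differentiable as a map into
   j-linear maps iff x |-> D^j f(x)[vs] is differentiable for every choice of directions vs. *)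
definition times_differentiable ::
  "nat \<Rightarrow> ('a::euclidean_space \<Rightarrow> 'b::real_normed_vector) \<Rightarrow> bool" where
  "times_differentiable k f \<longleftrightarrow>
     (\<forall>vs x. length vs < k \<longrightarrow> iter_deriv f vs differentiable (at x))"

(* The supremum over x of the operator norm of the multilinear map D^k f(x). *)
definition deriv_sup_norm ::
  "nat \<Rightarrow> ('a::euclidean_space \<Rightarrow> 'b::real_normed_vector) \<Rightarrow> ennreal" where
  "deriv_sup_norm k f = (SUP x. SUP vs\<in>unit_dirs k. ennreal (norm (iter_deriv f vs x)))"

(* The theta-Hoelder seminorm of D^k f, again with respect to the operator norm. *)
definition deriv_Holder_seminorm ::
  "nat \<Rightarrow> real \<Rightarrow> ('a::euclidean_space \<Rightarrow> 'b::real_normed_vector) \<Rightarrow> ennreal" where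
  "deriv_Holder_seminorm k \<theta> f =
     (SUP (x, y)\<in>{(x, y). x \<noteq> y}. SUP vs\<in>unit_dirs k.
        ennreal (norm (iter_deriv f vs x - iter_deriv f vs y) / dist x y powr \<theta>))"

(* Used for s > 0 only. *)
definition Cb_space :: "real \<Rightarrow> ('a::euclidean_space \<Rightarrow> 'b::real_normed_vector) set" where
  "Cb_space s = (let k = nat \<lfloor>s\<rfloor> in
     {f. times_differentiable k f \<and>
         (\<forall>j\<le>k. deriv_sup_norm j f < \<infinity>) \<and>
         (if s \<in> \<int> then (\<forall>vs. length vs = k \<longrightarrow> continuous_on UNIV (iter_deriv f vs))
          else deriv_Holder_seminorm k (s - real k) f < \<infinity>)})"

definition Cb_norm :: "real \<Rightarrow> ('a::euclidean_space \<Rightarrow> 'b::real_normed_vector) \<Rightarrow> ennreal" where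
  "Cb_norm s f = (let k = nat \<lfloor>s\<rfloor> in
     (\<Sum>j\<le>k. deriv_sup_norm j f) +
     (if s \<in> \<int> then 0 else deriv_Holder_seminorm k (s - real k) f))"

(* A filtration indexed by [0,\<infinity>); the values of F at negative times are irrelevant. *)
definition time_filtration :: "'w measure \<Rightarrow> (real \<Rightarrow> 'w measure) \<Rightarrow> bool" where
  "time_filtration M F \<longleftrightarrow>
     (\<forall>t\<ge>0. subalgebra M (F t)) \<and>
     (\<forall>s t. 0 \<le> s \<and> s \<le> t \<longrightarrow> subalgebra (F t) (F s))"

(* Standard Brownian motion relative to the filtration F: the increment over [s,t] is
   independent of F s and has law N(0, (t-s) I). *)
definition brownian_motion ::
  "'w measure \<Rightarrow> (real \<Rightarrow> 'w measure) \<Rightarrow> (real \<Rightarrow> 'w \<Rightarrow> 'a::euclidean_space) \<Rightarrow> bool" where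
  "brownian_motion M F W \<longleftrightarrow>
     (\<forall>t\<ge>0. W t \<in> borel_measurable (F t)) \<and>
     (AE \<omega> in M. W 0 \<omega> = 0) \<and>
     (AE \<omega> in M. continuous_on {0..} (\<lambda>t. W t \<omega>)) \<and>
     (\<forall>s t. 0 \<le> s \<and> s < t \<longrightarrow>
        prob_space.indep_set M (sets (F s))
          (sets (vimage_algebra (space M) (\<lambda>\<omega>. W t \<omega> - W s \<omega>) borel)) \<and>
        distributed M lborel (\<lambda>\<omega>. W t \<omega> - W s \<omega>)
          (\<lambda>x. ennreal (\<Prod>i\<in>Basis. normal_density 0 (sqrt (t - s)) (x \<bullet> i))))"

(* <b(t, x - .), m>; the Bochner integral exists for bounded Borel b t and finite Borel m. *)
definition conv_drift ::
  "(real \<Rightarrow> 'a \<Rightarrow> 'a) \<Rightarrow> real \<Rightarrow> 'a \<Rightarrow> 'a measure \<Rightarrow> 'a::euclidean_space" where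
  "conv_drift b t x m = (\<integral>y. b t (x - y) \<partial>m)"

(* X is a (weak) solution, on the filtered probability space (M, F) with F-Brownian motion W, of
     dX_t = <b(t, X_t - .), Law(X_t)> dt + dW_t,  Law(X_0) = \<mu>0.
   As X 0 is measurable with respect to F 0, it is independent of W.  Strong solutions are the
   case where F is the completed filtration generated by X 0 and W. *)
definition mckean_vlasov_solution ::
  "'w measure \<Rightarrow> (real \<Rightarrow> 'w measure) \<Rightarrow> (real \<Rightarrow> 'w \<Rightarrow> 'a::euclidean_space) \<Rightarrow>
   (real \<Rightarrow> 'a \<Rightarrow> 'a) \<Rightarrow> 'a measure \<Rightarrow> (real \<Rightarrow> 'w \<Rightarrow> 'a) \<Rightarrow> bool" where
  "mckean_vlasov_solution M F W b \<mu>0 X \<longleftrightarrow>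
     prob_space M \<and> time_filtration M F \<and> brownian_motion M F W \<and>
     (\<forall>t\<ge>0. X t \<in> borel_measurable (F t)) \<and>
     (AE \<omega> in M. continuous_on {0..} (\<lambda>t. X t \<omega>)) \<and>
     distr M borel (X 0) = \<mu>0 \<and>
     (AE \<omega> in M. \<forall>t\<ge>0.
        set_integrable lborel {0..t} (\<lambda>s. conv_drift b s (X s \<omega>) (distr M borel (X s))) \<and>
        X t \<omega> = X 0 \<omega>
          + (LBINT s:{0..t}. conv_drift b s (X s \<omega>) (distr M borel (X s))) + W t \<omega>)"

end

(* The interaction b(t, x - y) is invariant under translating x and y jointly.  Fix t and a small T <= t,
   let s = t - T and consider the laws of X_{s+q} - j q v for j = 0, 1, 2, ... and 0 <= q <= T.  By
   the Duhamel formula for the heat semigroup P,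
     E f(X_{s+q}) = E P_q f(X_s) + int_0^q E[B_{s+r}(X_{s+r}) . grad P_{q-r} f(X_{s+r})] dr,
   where B is the drift, these laws solve equations with the same b, and only the heat kernel depends
   on j, through a translation by j (q - r) v: the singularity of an m-th derivative of
   grad P_{q-r} is compensated by the factor (q - r)^m.  So the m-th differences in j are bounded by
   C |v|^m uniformly over test functions |f| <= 1, by induction on m; the terms of top order are
   absorbed because T is small.  Testing with characters, with v chosen so that a shift changes their
   sign, shows that the characteristic function of X_t decays faster than any power, and Fourier
   inversion yields a smooth density with bounded derivatives. *)
theory Submission
  imports Defs
begin

section \<open>Gaussian measures and the heat semigroup\<close>

text \<open>The law at time s is arbitrary, so nothing is known about its derivatives. This dictates
  the shift j q v: it vanishes at q = 0, and the initial term depends on j through the kernel alone.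
  Differences are used instead of derivatives because they have the a priori bound 2^m: the supremum
  S that is to be absorbed is finite before anything is proved. Absorption also needs an inequality
  that is linear in S, although the equation is quadratic in the law (once for X, once for the copy
  inside the drift). A discrete product rule distributes the m differences over law, copy and
  kernel; when one law receives all m, the other receives none and is bounded by 1. In the kernel
  every difference is given its own slice of the time lag, so that only the integrable singularity
  of a single gradient survives, whatever m is. Duhamel's formula is derived without stochastic
  calculus: over a time step h its defect is of order h sqrt h, and a function with such increments
  is constant.\<close>

definition gauss_density :: "real \<Rightarrow> 'a::euclidean_space \<Rightarrow> real" where
  "gauss_density \<tau> x = (\<Prod>i\<in>Basis. normal_density 0 (sqrt \<tau>) (x \<bullet> i))"

text \<open>\<open>\<tau>\<close> is the variance per coordinate. The product form agrees literally
  with the increment law in \<open>brownian_motion\<close>. At \<open>\<tau> = 0\<close> this is the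
  null measure, not a point mass.\<close>

definition gauss :: "real \<Rightarrow> 'a::euclidean_space measure" where
  "gauss \<tau> = density lborel (\<lambda>x. ennreal (gauss_density \<tau> x))"

lemma gauss_density_nonneg [simp]: "0 \<le> gauss_density \<tau> x"
  by (simp add: gauss_density_def prod_nonneg)

lemma gauss_density_measurable [measurable]: "gauss_density \<tau> \<in> borel_measurable borel"
  unfolding gauss_density_def by measurable

lemma sets_gauss [simp, measurable_cong]: "sets (gauss \<tau>) = sets borel"
  and space_gauss [simp]: "space (gauss \<tau>) = UNIV"
  by (simp_all add: gauss_def)

lemma gauss_density_eq:
  fixes x :: "'a::euclidean_space"
  assumes "\<tau> > 0"
  shows "gauss_density \<tau> x = (1 / sqrt (2 * pi * \<tau>)) ^ DIM('a) * exp (- (x \<bullet> x) / (2 * \<tau>))"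
proof -
  have "gauss_density \<tau> x
      = (\<Prod>i\<in>(Basis::'a set). 1 / sqrt (2 * pi * \<tau>)) * (\<Prod>i\<in>Basis. exp (- (x \<bullet> i)\<^sup>2 / (2 * \<tau>)))"
    using assms by (simp add: gauss_density_def normal_density_def prod.distrib prod_dividef power_divide)
  also have "(\<Prod>i\<in>Basis. exp (- (x \<bullet> i)\<^sup>2 / (2 * \<tau>))) = exp (\<Sum>i\<in>Basis. - (x \<bullet> i)\<^sup>2 / (2 * \<tau>))"
    by (simp add: exp_sum)
  also have "(\<Sum>i\<in>Basis. - (x \<bullet> i)\<^sup>2 / (2 * \<tau>)) = - (x \<bullet> x) / (2 * \<tau>)"
    by (subst euclidean_inner) (simp add: sum_negf sum_divide_distrib power2_eq_square)
  finally show ?thesis by (simp add: power_divide)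
qed

lemma prob_space_gauss:
  assumes "\<tau> > 0"
  shows "prob_space (gauss \<tau> :: 'a::euclidean_space measure)"
proof
  have one: "(\<integral>\<^sup>+u. ennreal (normal_density 0 (sqrt \<tau>) u) \<partial>lborel) = 1"
    using prob_space.emeasure_space_1[OF prob_space_normal_density[of "sqrt \<tau>" 0]] assms
    by (simp add: emeasure_density)
  have "emeasure (gauss \<tau>) (space (gauss \<tau> :: 'a measure))
      = (\<integral>\<^sup>+x. (\<Prod>i\<in>Basis. ennreal (normal_density 0 (sqrt \<tau>) ((x::'a) \<bullet> i))) \<partial>lborel)"
    by (simp add: gauss_def emeasure_density gauss_density_def prod_ennreal)
  also have "\<dots> = (\<Prod>i\<in>(Basis::'a set). \<integral>\<^sup>+u. ennreal (normal_density 0 (sqrt \<tau>) u) \<partial>lborel)"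
    by (rule nn_integral_lborel_prod) auto
  finally show "emeasure (gauss \<tau>) (space (gauss \<tau> :: 'a measure)) = 1"
    by (simp add: one)
qed

lemma gauss_density_conv:
  fixes y :: "'a::euclidean_space"
  assumes "s > 0" "t > 0"
  shows "(\<integral>\<^sup>+w. ennreal (gauss_density t (y - w)) * ennreal (gauss_density s w) \<partial>lborel)
       = ennreal (gauss_density (s + t) y)"
proof -
  let ?f = "\<lambda>b u. ennreal (normal_density 0 (sqrt t) (y \<bullet> b - u) * normal_density 0 (sqrt s) u)"
  have "(\<integral>\<^sup>+w. ennreal (gauss_density t (y - w)) * ennreal (gauss_density s w) \<partial>lborel)
      = (\<integral>\<^sup>+w. (\<Prod>b\<in>Basis. ?f b (w \<bullet> b)) \<partial>lborel)"
    by (simp add: gauss_density_def prod_ennreal[symmetric] prod.distrib[symmetric] inner_diff_left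
        ennreal_mult)
  also have "\<dots> = (\<Prod>b\<in>Basis. \<integral>\<^sup>+u. ?f b u \<partial>lborel)"
    by (rule nn_integral_lborel_prod) auto
  also have "\<dots> = (\<Prod>b\<in>Basis. ennreal (normal_density 0 (sqrt (s + t)) (y \<bullet> b)))"
    using conv_normal_density_zero_mean[of "sqrt t" "sqrt s"] assms
    by (intro prod.cong) (auto simp: fun_eq_iff add.commute)
  finally show ?thesis by (simp add: gauss_density_def prod_ennreal)
qed

lemma gauss_conv:
  assumes "s > 0" "t > 0"
  shows "distr (gauss s \<Otimes>\<^sub>M gauss t) borel (\<lambda>(w, z). w + z) = (gauss (s + t) :: 'a::euclidean_space measure)"
proof (rule measure_eqI)
  fix A :: "'a set" assume "A \<in> sets (distr (gauss s \<Otimes>\<^sub>M gauss t) borel (\<lambda>(w, z). w + z))"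
  then have A [measurable]: "A \<in> sets borel" by simp
  interpret t: prob_space "gauss t :: 'a measure" using assms(2) by (rule prob_space_gauss)
  let ?g = "\<lambda>t x. ennreal (gauss_density t (x::'a))"
  have "emeasure (distr (gauss s \<Otimes>\<^sub>M gauss t) borel (\<lambda>(w, z). w + z)) A
      = (\<integral>\<^sup>+p. indicator A (fst p + snd p) \<partial>(gauss s \<Otimes>\<^sub>M gauss t))"
    by (subst nn_integral_indicator[symmetric], simp, subst nn_integral_distr)
       (auto simp: case_prod_beta)
  also have "\<dots> = (\<integral>\<^sup>+w. \<integral>\<^sup>+z. indicator A (w + z) \<partial>gauss t \<partial>gauss s)"
    by (subst t.nn_integral_fst[symmetric]) auto
  also have "\<dots> = (\<integral>\<^sup>+w. \<integral>\<^sup>+z. ?g s w * (?g t z * indicator A (w + z)) \<partial>lborel \<partial>lborel)"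
    by (simp add: gauss_def nn_integral_density nn_integral_cmult)
  also have "\<dots> = (\<integral>\<^sup>+w. \<integral>\<^sup>+y. ?g s w * (?g t (y - w) * indicator A y) \<partial>lborel \<partial>lborel)"
  proof (rule nn_integral_cong)
    fix w :: 'a
    have "(\<integral>\<^sup>+y. ?g s w * (?g t (y - w) * indicator A y) \<partial>lborel)
        = (\<integral>\<^sup>+y. ?g s w * (?g t (y - w) * indicator A y) \<partial>distr lborel borel ((+) w))"
      by (subst lborel_distr_plus) simp
    also have "\<dots> = (\<integral>\<^sup>+z. ?g s w * (?g t z * indicator A (w + z)) \<partial>lborel)"
      by (subst nn_integral_distr) auto
    finally show "(\<integral>\<^sup>+z. ?g s w * (?g t z * indicator A (w + z)) \<partial>lborel)
        = (\<integral>\<^sup>+y. ?g s w * (?g t (y - w) * indicator A y) \<partial>lborel)" ..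
  qed
  also have "\<dots> = (\<integral>\<^sup>+y. \<integral>\<^sup>+w. ?g s w * (?g t (y - w) * indicator A y) \<partial>lborel \<partial>lborel)"
    by (subst lborel_pair.Fubini') auto
  also have "\<dots> = (\<integral>\<^sup>+y. indicator A y * (\<integral>\<^sup>+w. ?g t (y - w) * ?g s w \<partial>lborel) \<partial>lborel)"
    by (intro nn_integral_cong, subst nn_integral_cmult[symmetric]) (auto simp: ac_simps)
  also have "\<dots> = emeasure (gauss (s + t)) A"
    unfolding gauss_density_conv[OF assms] gauss_def by (simp add: emeasure_density mult.commute)
  finally show "emeasure (distr (gauss s \<Otimes>\<^sub>M gauss t) borel (\<lambda>(w, z). w + z)) A
    = emeasure (gauss (s + t)) A" .
qed simp

text \<open>Completing the square: the Cameron-Martin weight. It moves a translation of the argument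
  of \<open>f\<close> to the smooth Gaussian weight, which is how derivative bounds are obtained for
  merely measurable \<open>f\<close>.\<close>

lemma gauss_density_shift:
  fixes w D :: "'a::euclidean_space"
  assumes "\<tau> > 0"
  shows "gauss_density \<tau> (w - D) = exp ((D \<bullet> w - D \<bullet> D / 2) / \<tau>) * gauss_density \<tau> w"
proof -
  have "- ((w - D) \<bullet> (w - D)) / (2 * \<tau>) = (D \<bullet> w - D \<bullet> D / 2) / \<tau> + - (w \<bullet> w) / (2 * \<tau>)"
    using assms by (simp add: field_simps inner_diff_left inner_diff_right inner_commute)
  then show ?thesis
    unfolding gauss_density_eq[OF assms] by (simp only: exp_add ac_simps)
qed

lemma nn_integral_gauss_shift:
  fixes D :: "'a::euclidean_space"
  assumes "\<tau> > 0" and [measurable]: "f \<in> borel_measurable borel"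
  shows "(\<integral>\<^sup>+w. f (D + w) \<partial>gauss \<tau>) = (\<integral>\<^sup>+w. ennreal (exp ((D \<bullet> w - D \<bullet> D / 2) / \<tau>)) * f w \<partial>gauss \<tau>)"
proof -
  have "(\<integral>\<^sup>+w. ennreal (exp ((D \<bullet> w - D \<bullet> D / 2) / \<tau>)) * f w \<partial>gauss \<tau>)
      = (\<integral>\<^sup>+w. ennreal (gauss_density \<tau> (w - D)) * f w \<partial>lborel)"
    using assms(1)
    by (simp add: gauss_def nn_integral_density gauss_density_shift ennreal_mult ac_simps)
  also have "\<dots> = (\<integral>\<^sup>+w. ennreal (gauss_density \<tau> (w - D)) * f w \<partial>distr lborel borel ((+) D))"
    by (subst lborel_distr_plus) simp
  also have "\<dots> = (\<integral>\<^sup>+w. f (D + w) \<partial>gauss \<tau>)"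
    by (subst nn_integral_distr) (auto simp: gauss_def nn_integral_density)
  finally show ?thesis ..
qed

text \<open>For the shift D = \<tau> a the integrand is a constant times the Cameron-Martin weight,
  whose total mass is 1.\<close>

lemma gauss_exp_moment:
  fixes a :: "'a::euclidean_space"
  assumes "\<tau> > 0"
  shows "has_bochner_integral (gauss \<tau>) (\<lambda>w. exp (a \<bullet> w)) (exp (\<tau> * (a \<bullet> a) / 2))"
proof -
  interpret prob_space "gauss \<tau> :: 'a measure" using assms by (rule prob_space_gauss)
  have "(\<integral>\<^sup>+w. ennreal (exp (a \<bullet> w)) \<partial>gauss \<tau>)
     = (\<integral>\<^sup>+w. ennreal (exp (\<tau> * (a \<bullet> a) / 2)) *
          (ennreal (exp (((\<tau> *\<^sub>R a) \<bullet> w - (\<tau> *\<^sub>R a) \<bullet> (\<tau> *\<^sub>R a) / 2) / \<tau>)) * 1) \<partial>gauss \<tau>)"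
  proof (intro nn_integral_cong)
    fix w
    have "a \<bullet> w = \<tau> * (a \<bullet> a) / 2 + ((\<tau> *\<^sub>R a) \<bullet> w - (\<tau> *\<^sub>R a) \<bullet> (\<tau> *\<^sub>R a) / 2) / \<tau>"
      using assms by (simp add: field_simps)
    then show "ennreal (exp (a \<bullet> w)) = ennreal (exp (\<tau> * (a \<bullet> a) / 2)) *
          (ennreal (exp (((\<tau> *\<^sub>R a) \<bullet> w - (\<tau> *\<^sub>R a) \<bullet> (\<tau> *\<^sub>R a) / 2) / \<tau>)) * 1)"
      by (metis ennreal_mult exp_add exp_ge_zero mult.right_neutral)
  qed
  also have "\<dots> = ennreal (exp (\<tau> * (a \<bullet> a) / 2)) *
      (\<integral>\<^sup>+w. ennreal (exp (((\<tau> *\<^sub>R a) \<bullet> w - (\<tau> *\<^sub>R a) \<bullet> (\<tau> *\<^sub>R a) / 2) / \<tau>)) * 1 \<partial>gauss \<tau>)"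
    by (rule nn_integral_cmult) auto
  also have "\<dots> = ennreal (exp (\<tau> * (a \<bullet> a) / 2))"
    using assms emeasure_space_1 by (subst nn_integral_gauss_shift[symmetric]) auto
  finally show ?thesis
    by (intro has_bochner_integral_nn_integral) auto
qed

lemma integral_gauss_shift:
  fixes f :: "'a::euclidean_space \<Rightarrow> real"
  assumes "\<tau> > 0" and [measurable]: "f \<in> borel_measurable borel" 
  shows "(\<integral>w. f (D + w) \<partial>gauss \<tau>) = (\<integral>w. exp ((D \<bullet> w - D \<bullet> D / 2) / \<tau>) * f w \<partial>gauss \<tau>)"
proof -
  have "(\<integral>w. exp ((D \<bullet> w - D \<bullet> D / 2) / \<tau>) * f w \<partial>gauss \<tau>) = (\<integral>w. gauss_density \<tau> (w - D) * f w \<partial>lborel)"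
    using assms(1)
    by (simp add: gauss_def integral_density gauss_density_shift ac_simps)
  also have "\<dots> = (\<integral>w. gauss_density \<tau> (w - D) * f w \<partial>distr lborel borel ((+) D))"
    by (subst lborel_distr_plus) simp
  also have "\<dots> = (\<integral>w. f (D + w) \<partial>gauss \<tau>)"
    by (subst integral_distr) (auto simp: gauss_def integral_density)
  finally show ?thesis ..
qed

section \<open>Heat semigroup and its gradient on bounded measurable functions\<close>

definition bounded_borel :: "real \<Rightarrow> ('a::euclidean_space \<Rightarrow> real) \<Rightarrow> bool" where
  "bounded_borel B f \<longleftrightarrow> f \<in> borel_measurable borel \<and> (\<forall>x. \<bar>f x\<bar> \<le> B)"

lemma bounded_borelD:
  assumes "bounded_borel B f"
  shows "f \<in> borel_measurable borel" "\<bar>f x\<bar> \<le> B" "0 \<le> B"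
  using assms order_trans[OF abs_ge_zero, of "f x" B] by (auto simp: bounded_borel_def)

lemma bounded_borel_shift:
  "bounded_borel B f \<Longrightarrow> bounded_borel B (\<lambda>x. f (x + a))"
  by (auto simp: bounded_borel_def)

definition heat :: "real \<Rightarrow> ('a::euclidean_space \<Rightarrow> real) \<Rightarrow> 'a \<Rightarrow> real" where
  "heat \<tau> f x = (\<integral>w. f (x + w) \<partial>gauss \<tau>)"

text \<open>The gradient of \<open>heat \<tau> f\<close> after Gaussian integration by parts, so
  that no derivative of \<open>f\<close> occurs. \<open>heat_taylor\<close> shows that it deserves
  the name.\<close>

definition heat_grad :: "real \<Rightarrow> ('a::euclidean_space \<Rightarrow> real) \<Rightarrow> 'a \<Rightarrow> 'a" where
  "heat_grad \<tau> f x = (\<integral>w. (f (x + w) / \<tau>) *\<^sub>R w \<partial>gauss \<tau>)"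

text \<open>The sum of 14 exp 2, the Taylor constant of \<open>heat_taylor_near\<close>, and 2 exp
  2, the gradient constant of \<open>heat_grad_inner_bound\<close>; \<open>heat_lipschitz\<close>
  uses both at once.\<close>

definition heat_const :: real where
  "heat_const = 16 * exp 2"

lemma heat_const_pos [simp]: "0 < heat_const" "0 \<le> heat_const"
  by (simp_all add: heat_const_def)

lemma gauss_integrable_bounded:
  fixes h :: "'a::euclidean_space \<Rightarrow> real"
  assumes "\<tau> > 0" "bounded_borel B f" "integrable (gauss \<tau>) h"
  shows "integrable (gauss \<tau>) (\<lambda>w. f (x + w) * h w)"
proof (rule Bochner_Integration.integrable_bound)
  note [measurable] = bounded_borelD(1)[OF assms(2)] borel_measurable_integrable[OF assms(3)]
  show "integrable (gauss \<tau>) (\<lambda>w. B * h w)" using assms(3) by simp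
  show "(\<lambda>w. f (x + w) * h w) \<in> borel_measurable (gauss \<tau>)" by measurable
  show "AE w in gauss \<tau>. norm (f (x + w) * h w) \<le> norm (B * h w)"
    using bounded_borelD(2,3)[OF assms(2)] by (auto simp: abs_mult intro!: mult_right_mono)
qed

lemma heat_integrable:
  assumes "\<tau> > 0" "bounded_borel B f"
  shows "integrable (gauss \<tau>) (\<lambda>w. f (x + w))"
proof -
  interpret prob_space "gauss \<tau> :: 'a measure" using assms(1) by (rule prob_space_gauss)
  show ?thesis using gauss_integrable_bounded[OF assms, of "\<lambda>_. 1" x] by simp
qed

lemma abs_le_exp_sum: "\<bar>s\<bar> \<le> exp (2 * s) + exp (- (2 * s))" for s :: real
proof (cases "s \<ge> 0")
  case True
  then show ?thesis using exp_ge_add_one_self[of "2 * s"] exp_gt_zero[of "- (2 * s)"] by linarith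
next
  case False
  then show ?thesis using exp_ge_add_one_self[of "- (2 * s)"] exp_gt_zero[of "2 * s"] by linarith
qed

lemma exp_remainder_bounds:
  fixes x :: real
  shows "0 \<le> exp x - 1 - x" "exp x - 1 - x \<le> x\<^sup>2 * exp \<bar>x\<bar>"
proof -
  show "0 \<le> exp x - 1 - x" using exp_ge_add_one_self[of x] by linarith
  have "(1 - x) * exp x \<le> exp (- x) * exp x"
    using exp_ge_add_one_self[of "-x"] by (intro mult_right_mono) auto
  then have 1: "exp x - 1 \<le> x * exp x" by (simp add: exp_minus algebra_simps)
  show "exp x - 1 - x \<le> x\<^sup>2 * exp \<bar>x\<bar>"
  proof (cases "x \<ge> 0")
    case True
    have "exp x - 1 - x \<le> x * (exp x - 1)" using 1 by (simp add: algebra_simps)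
    also have "\<dots> \<le> x * (x * exp x)" using 1 True by (intro mult_left_mono) auto
    finally show ?thesis using True by (simp add: power2_eq_square)
  next
    case False
    have "exp x - 1 - x \<le> (-x) * (1 - exp x)" using 1 by (simp add: algebra_simps)
    also have "\<dots> \<le> (-x) * (-x)"
      using exp_ge_add_one_self[of x] False by (intro mult_left_mono) linarith+
    also have "\<dots> \<le> x\<^sup>2 * exp \<bar>x\<bar>"
      using mult_left_mono[of 1 "exp \<bar>x\<bar>" "x\<^sup>2"] by (simp add: power2_eq_square)
    finally show ?thesis .
  qed
qed

text \<open>First-order remainder of the Cameron-Martin weight, where n will be |D| / sqrt \<tau>
  and s a standard normal variable. The bound is quadratic in n and has a finite Gaussian mean. In
  the constant, 6 bounds 2 exp 1 and 1 pays for the term n^2 / 2.\<close>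

lemma exp_taylor_bound:
  fixes n s :: real
  assumes "0 \<le> n" "n \<le> 1"
  shows "\<bar>exp (n * s - n\<^sup>2 / 2) - 1 - n * s\<bar> \<le> 7 * n\<^sup>2 * (exp (2 * s) + exp (- (2 * s)))"
proof -
  define x where "x = n * s - n\<^sup>2 / 2"
  \<comment> \<open>Since n^2 \<le> n, the exponent satisfies |x| \<le> n y, and n \<le> 1 gives |x|
    \<le> y as well.\<close>
  define y where "y = \<bar>s\<bar> + 1/2"
  have y: "y \<ge> 0" by (simp add: y_def)
  have "n * n \<le> n * 1" using assms by (intro mult_left_mono) auto
  moreover have "\<bar>x\<bar> \<le> \<bar>n * s\<bar> + \<bar>n\<^sup>2 / 2\<bar>" unfolding x_def by linarith
  ultimately have "\<bar>x\<bar> \<le> n * y"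
    using assms by (simp add: y_def abs_mult algebra_simps power2_eq_square)
  moreover have "n * y \<le> 1 * y" using assms y by (intro mult_right_mono) auto
  ultimately have xb: "\<bar>x\<bar> \<le> n * y" "\<bar>x\<bar> \<le> y" by auto
  have y2: "y\<^sup>2 \<le> 2 * exp y"
    using exp_lower_Taylor_quadratic[OF y] y by simp
  have "x\<^sup>2 * exp \<bar>x\<bar> \<le> (n * y)\<^sup>2 * exp y"
    using xb power_mono[OF xb(1), of 2] by (intro mult_mono) auto
  also have "\<dots> \<le> n\<^sup>2 * (2 * exp y) * exp y"
    using y2 by (auto simp: power_mult_distrib intro!: mult_mono)
  also have "\<dots> = n\<^sup>2 * (2 * exp 1 * exp (2 * \<bar>s\<bar>))"
    by (simp add: y_def exp_add[symmetric] mult.assoc)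
  also have "\<dots> \<le> n\<^sup>2 * (6 * exp (2 * \<bar>s\<bar>))"
    using exp_le by (intro mult_left_mono mult_right_mono) auto
  finally have 1: "x\<^sup>2 * exp \<bar>x\<bar> \<le> n\<^sup>2 * (6 * exp (2 * \<bar>s\<bar>))" .
  have "\<bar>exp x - 1 - n * s\<bar> \<le> \<bar>exp x - 1 - x\<bar> + \<bar>x - n * s\<bar>" by linarith
  also have "\<dots> \<le> x\<^sup>2 * exp \<bar>x\<bar> + n\<^sup>2 * 1"
  proof -
    have "\<bar>x - n * s\<bar> \<le> n\<^sup>2 * 1" by (simp add: x_def)
    then show ?thesis using exp_remainder_bounds[of x] by linarith
  qed
  also have "\<dots> \<le> n\<^sup>2 * (6 * exp (2 * \<bar>s\<bar>)) + n\<^sup>2 * exp (2 * \<bar>s\<bar>)"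
    using 1 by (intro add_mono mult_left_mono) auto
  also have "\<dots> = 7 * n\<^sup>2 * exp (2 * \<bar>s\<bar>)" by simp
  also have "\<dots> \<le> 7 * n\<^sup>2 * (exp (2 * s) + exp (- (2 * s)))"
    by (intro mult_left_mono) (auto simp: abs_if)
  finally show ?thesis by (simp add: x_def)
qed

text \<open>The normalisation makes e \<bullet> w a standard normal variable, for which both
  exponential moments of order 2 equal exp 2.\<close>

lemma gauss_two_sided_moment:
  fixes e :: "'a::euclidean_space"
  assumes "\<tau> > 0" and e: "\<tau> * (e \<bullet> e) = 1"
  shows "has_bochner_integral (gauss \<tau>) (\<lambda>w. exp (2 * (e \<bullet> w)) + exp (- (2 * (e \<bullet> w)))) (2 * exp 2)"
  using has_bochner_integral_add[OF gauss_exp_moment[OF assms(1), of "2 *\<^sub>R e"]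
      gauss_exp_moment[OF assms(1), of "(-2) *\<^sub>R e"]] e
  by simp

lemma gauss_linear_integrable:
  fixes v :: "'a::euclidean_space"
  assumes "\<tau> > 0"
  shows "integrable (gauss \<tau>) (\<lambda>w. v \<bullet> w)"
    and "(\<integral>w. \<bar>v \<bullet> w\<bar> \<partial>gauss \<tau>) \<le> 2 * exp 2 * sqrt \<tau> * norm v"
proof -
  have "integrable (gauss \<tau>) (\<lambda>w. v \<bullet> w)
      \<and> (\<integral>w. \<bar>v \<bullet> w\<bar> \<partial>gauss \<tau>) \<le> 2 * exp 2 * sqrt \<tau> * norm v"
  proof (cases "v = 0")
    case False
    define c where "c = norm v * sqrt \<tau>"
    have c: "c > 0" using False assms by (simp add: c_def)
    \<comment> \<open>c is the standard deviation of v \<bullet> w, so e \<bullet> w is standard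
      normal.\<close>
    define e where "e = v /\<^sub>R c"
    have ee: "\<tau> * (e \<bullet> e) = 1"
      using False assms
      by (simp add: e_def c_def inner_commute dot_square_norm field_simps power2_eq_square)
    have v: "v = c *\<^sub>R e" using c by (simp add: e_def)
    note * = gauss_two_sided_moment[OF assms ee]
    have b: "\<bar>v \<bullet> w\<bar> \<le> c * (exp (2 * (e \<bullet> w)) + exp (- (2 * (e \<bullet> w))))" for w
      using abs_le_exp_sum[of "e \<bullet> w"] c by (simp add: v abs_mult)
    have i: "integrable (gauss \<tau>) (\<lambda>w. v \<bullet> w)"
      by (rule Bochner_Integration.integrable_bound[of _ "\<lambda>w. c * (exp (2 * (e \<bullet> w)) + exp (- (2 * (e \<bullet> w))))"])
         (use * c b in \<open>auto simp: has_bochner_integral_iff abs_mult intro!: integrable_mult_right\<close>)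
    have "(\<integral>w. \<bar>v \<bullet> w\<bar> \<partial>gauss \<tau>) \<le> (\<integral>w. c * (exp (2 * (e \<bullet> w)) + exp (- (2 * (e \<bullet> w)))) \<partial>gauss \<tau>)"
      using * i b by (intro integral_mono) (auto simp: has_bochner_integral_iff)
    also have "\<dots> = c * (2 * exp 2)"
      using * by (simp add: has_bochner_integral_iff del: Bochner_Integration.integral_add)
    finally show ?thesis using i by (simp add: c_def algebra_simps)
  qed simp
  then show "integrable (gauss \<tau>) (\<lambda>w. v \<bullet> w)" "(\<integral>w. \<bar>v \<bullet> w\<bar> \<partial>gauss \<tau>) \<le> 2 * exp 2 * sqrt \<tau> * norm v"
    by auto
qed

lemma gauss_norm_bound:
  assumes "\<tau> > 0"
  shows "integrable (gauss \<tau>) (\<lambda>w::'a::euclidean_space. norm w)"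
    and "(\<integral>w. norm (w::'a) \<partial>gauss \<tau>) \<le> real DIM('a) * (2 * exp 2) * sqrt \<tau>"
proof -
  let ?S = "\<lambda>w::'a. \<Sum>i\<in>Basis. \<bar>i \<bullet> w\<bar>"
  have le: "norm w \<le> ?S w" for w :: 'a using norm_le_l1[of w] by (simp add: inner_commute)
  have iS: "integrable (gauss \<tau>) ?S"
    using gauss_linear_integrable(1)[OF assms] by (intro Bochner_Integration.integrable_sum integrable_abs)
  show i: "integrable (gauss \<tau>) (\<lambda>w::'a. norm w)"
    by (rule Bochner_Integration.integrable_bound[OF iS])
       (use le in \<open>auto intro: order_trans[OF _ abs_ge_self]\<close>)
  have "(\<integral>w. norm (w::'a) \<partial>gauss \<tau>) \<le> (\<integral>w. ?S w \<partial>gauss \<tau>)"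
    using i iS le by (rule integral_mono)
  also have "\<dots> = (\<Sum>i\<in>Basis. \<integral>w. \<bar>i \<bullet> (w::'a)\<bar> \<partial>gauss \<tau>)"
    using gauss_linear_integrable(1)[OF assms] by (intro Bochner_Integration.integral_sum integrable_abs)
  also have "\<dots> \<le> (\<Sum>i\<in>(Basis::'a set). 2 * exp 2 * sqrt \<tau>)"
  proof (rule sum_mono)
    fix i :: 'a assume "i \<in> Basis"
    then show "(\<integral>w. \<bar>i \<bullet> w\<bar> \<partial>gauss \<tau>) \<le> 2 * exp 2 * sqrt \<tau>"
      using gauss_linear_integrable(2)[OF assms, of i] by simp
  qed
  finally show "(\<integral>w. norm (w::'a) \<partial>gauss \<tau>) \<le> real DIM('a) * (2 * exp 2) * sqrt \<tau>" by simp
qed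

lemma heat_grad_integrable:
  fixes f :: "'a::euclidean_space \<Rightarrow> real"
  assumes "\<tau> > 0" "bounded_borel B f"
  shows "integrable (gauss \<tau>) (\<lambda>w. (f (x + w) / \<tau>) *\<^sub>R w)"
proof -
  note [measurable] = bounded_borelD(1)[OF assms(2)]
  have "integrable (gauss \<tau>) (\<lambda>w::'a. f (x + w) * (norm w / \<tau>))"
    using gauss_norm_bound(1)[OF assms(1)] assms by (intro gauss_integrable_bounded) auto
  then show ?thesis
    by (rule Bochner_Integration.integrable_bound) (auto simp: abs_mult)
qed

lemma heat_grad_inner:
  assumes "\<tau> > 0" "bounded_borel B f"
  shows "heat_grad \<tau> f x \<bullet> v = (\<integral>w. f (x + w) * ((v \<bullet> w) / \<tau>) \<partial>gauss \<tau>)"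
proof -
  have "heat_grad \<tau> f x \<bullet> v = (\<integral>w. ((f (x + w) / \<tau>) *\<^sub>R w) \<bullet> v \<partial>gauss \<tau>)"
    unfolding heat_grad_def by (rule integral_inner_left[symmetric]) (rule heat_grad_integrable[OF assms])
  moreover have "((f (x + w) / \<tau>) *\<^sub>R w) \<bullet> v = f (x + w) * ((v \<bullet> w) / \<tau>)" for w
    by (simp add: inner_commute)
  ultimately show ?thesis by (simp only:)
qed

lemma heat_grad_inner_bound:
  assumes "\<tau> > 0" "bounded_borel B f"
  shows "\<bar>heat_grad \<tau> f x \<bullet> v\<bar> \<le> 2 * exp 2 * B * norm v / sqrt \<tau>"
proof -
  have i: "integrable (gauss \<tau>) (\<lambda>w. (v \<bullet> w) / \<tau>)"
    by (intro integrable_divide gauss_linear_integrable(1) assms(1))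
  have "\<bar>heat_grad \<tau> f x \<bullet> v\<bar> \<le> (\<integral>w. \<bar>f (x + w) * ((v \<bullet> w) / \<tau>)\<bar> \<partial>gauss \<tau>)"
    unfolding heat_grad_inner[OF assms] by (rule integral_abs_bound)
  also have "\<dots> \<le> (\<integral>w. B * (\<bar>v \<bullet> w\<bar> / \<tau>) \<partial>gauss \<tau>)"
    using gauss_integrable_bounded[OF assms i, of x] i bounded_borelD(2)[OF assms(2)] assms(1)
      gauss_linear_integrable(1)[OF assms(1)]
    by (intro integral_mono integrable_abs integrable_mult_right integrable_divide)
       (auto simp: abs_mult intro!: mult_right_mono divide_right_mono)
  also have "\<dots> = B / \<tau> * (\<integral>w. \<bar>v \<bullet> w\<bar> \<partial>gauss \<tau>)" by simp
  also have "\<dots> \<le> B / \<tau> * (2 * exp 2 * sqrt \<tau> * norm v)"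
    using gauss_linear_integrable(2)[OF assms(1)] bounded_borelD(3)[OF assms(2)] assms(1)
    by (intro mult_left_mono) auto
  also have "\<dots> = 2 * exp 2 * B * norm v * (sqrt \<tau> / \<tau>)" by simp
  also have "\<dots> = 2 * exp 2 * B * norm v / sqrt \<tau>"
    using assms(1) by (subst sqrt_divide_self_eq) (simp_all add: divide_inverse)
  finally show ?thesis .
qed

text \<open>Duality: test \<open>heat_grad_inner_bound\<close> with v equal to the gradient itself
  and cancel one factor norm v.\<close>

lemma heat_grad_bound:
  assumes "\<tau> > 0" "bounded_borel B f"
  shows "norm (heat_grad \<tau> f x) \<le> heat_const * B / sqrt \<tau>"
proof (cases "heat_grad \<tau> f x = 0")
  case False
  define v where "v = heat_grad \<tau> f x"
  have "norm v * norm v \<le> (2 * exp 2 * B / sqrt \<tau>) * norm v"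
    using heat_grad_inner_bound[OF assms, of x v]
    by (simp add: v_def dot_square_norm power2_eq_square abs_mult)
  then have "norm v \<le> 2 * exp 2 * B / sqrt \<tau>"
    using False mult_right_le_imp_le[of "norm v" "norm v" "2 * exp 2 * B / sqrt \<tau>"] by (simp add: v_def)
  also have "\<dots> \<le> heat_const * B / sqrt \<tau>"
    using assms bounded_borelD(3)[OF assms(2)] unfolding heat_const_def
    by (intro divide_right_mono mult_right_mono) auto
  finally show ?thesis by (simp add: v_def)
qed (use assms bounded_borelD(3)[OF assms(2)] in auto)

lemma heat_bounded:
  fixes f :: "'a::euclidean_space \<Rightarrow> real"
  assumes "\<tau> > 0" "bounded_borel B f"
  shows "bounded_borel B (heat \<tau> f)"
  unfolding bounded_borel_def
proof safe
  interpret prob_space "gauss \<tau> :: 'a measure" using assms(1) by (rule prob_space_gauss)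
  note [measurable] = bounded_borelD(1)[OF assms(2)]
  show "heat \<tau> f \<in> borel_measurable borel" unfolding heat_def by measurable
  fix x
  have "\<bar>heat \<tau> f x\<bar> \<le> (\<integral>w. \<bar>f (x + w)\<bar> \<partial>gauss \<tau>)"
    unfolding heat_def by (rule integral_abs_bound)
  also have "\<dots> \<le> (\<integral>w. B \<partial>(gauss \<tau> :: 'a measure))"
    using heat_integrable[OF assms, of x] bounded_borelD(2)[OF assms(2)]
    by (intro integral_mono) auto
  finally show "\<bar>heat \<tau> f x\<bar> \<le> B" using prob_space by simp
qed

text \<open>Cameron-Martin turns the left side into the integral of f(x + w) against the weight
  minus its first-order expansion, which \<open>exp_taylor_bound\<close> dominates pointwise. The
  restriction on norm D is the range n \<le> 1 of that lemma.\<close>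

lemma heat_taylor_near:
  fixes D :: "'a::euclidean_space"
  assumes "\<tau> > 0" "bounded_borel B f" "norm D \<le> sqrt \<tau>"
  shows "\<bar>heat \<tau> f (x + D) - heat \<tau> f x - heat_grad \<tau> f x \<bullet> D\<bar> \<le> 14 * exp 2 * B * (norm D)\<^sup>2 / \<tau>"
proof (cases "D = 0")
  case False
  interpret prob_space "gauss \<tau> :: 'a measure" using assms(1) by (rule prob_space_gauss)
  note [measurable] = bounded_borelD(1)[OF assms(2)]
  define n where "n = norm D / sqrt \<tau>"
  have n: "0 < n" "n \<le> 1" using assms(1,3) False by (auto simp: n_def)
  have n2: "n\<^sup>2 = (norm D)\<^sup>2 / \<tau>" using assms(1) by (simp add: n_def power_divide)
  \<comment> \<open>Scaled so that e \<bullet> w is standard normal and (D \<bullet> w) / \<tau> = n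
    (e \<bullet> w).\<close>
  define e where "e = D /\<^sub>R (n * \<tau>)"
  have D: "D = (n * \<tau>) *\<^sub>R e" using n assms(1) by (simp add: e_def del: inverse_mult_distrib)
  have "n * \<tau> * (n * \<tau>) = \<tau> * (D \<bullet> D)"
    using n2 assms(1) by (simp add: dot_square_norm power2_eq_square field_simps)
  then have ee: "\<tau> * (e \<bullet> e) = 1" using n assms(1) False by (simp add: e_def field_simps)
  let ?E = "\<lambda>w. exp (2 * (e \<bullet> w)) + exp (- (2 * (e \<bullet> w)))"
  note E = gauss_two_sided_moment[OF assms(1) ee]
  let ?x = "\<lambda>w. exp ((D \<bullet> w - D \<bullet> D / 2) / \<tau>)"
  have DD: "D \<bullet> D = n\<^sup>2 * \<tau>" using n2 assms(1) by (simp add: dot_square_norm)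
  have xe: "?x w = exp (n * (e \<bullet> w) - n\<^sup>2 / 2)" for w
  proof -
    have "(D \<bullet> w - D \<bullet> D / 2) / \<tau> = n * (e \<bullet> w) - n\<^sup>2 / 2"
    proof -
      have "D \<bullet> w = n * \<tau> * (e \<bullet> w)" by (subst D) simp
      then show ?thesis unfolding DD using assms(1) by (simp add: diff_divide_distrib)
    qed
    then show ?thesis by simp
  qed
  have b: "\<bar>?x w - 1 - (D \<bullet> w) / \<tau>\<bar> \<le> 7 * n\<^sup>2 * ?E w" for w
  proof -
    have "(D \<bullet> w) / \<tau> = n * (e \<bullet> w)" using assms(1) by (subst D) simp
    then show ?thesis using exp_taylor_bound[of n "e \<bullet> w"] n by (simp add: xe)
  qed
  have "?x w = exp (- (D \<bullet> D) / 2 / \<tau>) * exp ((D /\<^sub>R \<tau>) \<bullet> w)" for w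
  proof -
    have "(D \<bullet> w - D \<bullet> D / 2) / \<tau> = - (D \<bullet> D) / 2 / \<tau> + (D /\<^sub>R \<tau>) \<bullet> w"
      using assms(1) by (simp add: field_simps)
    then show ?thesis by (simp only: exp_add)
  qed
  moreover have "integrable (gauss \<tau>) (\<lambda>w. exp ((D /\<^sub>R \<tau>) \<bullet> w))"
    using gauss_exp_moment[OF assms(1), of "D /\<^sub>R \<tau>"] unfolding has_bochner_integral_iff by (rule conjunct1)
  ultimately have ix: "integrable (gauss \<tau>) ?x"
    by (simp only: integrable_mult_right)
  have il: "integrable (gauss \<tau>) (\<lambda>w. (D \<bullet> w) / \<tau>)"
    by (intro integrable_divide gauss_linear_integrable(1) assms(1))
  let ?r = "\<lambda>w. ?x w - 1 - (D \<bullet> w) / \<tau>"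
  have ir: "integrable (gauss \<tau>) ?r"
    by (intro Bochner_Integration.integrable_diff ix il) simp
  have "heat \<tau> f (x + D) = (\<integral>w. f (x + w) * ?x w \<partial>gauss \<tau>)"
    using integral_gauss_shift[OF assms(1), of "\<lambda>w. f (x + w)" D]
    by (simp add: heat_def ac_simps)
  then have "heat \<tau> f (x + D) - heat \<tau> f x - heat_grad \<tau> f x \<bullet> D = (\<integral>w. f (x + w) * ?r w \<partial>gauss \<tau>)"
    unfolding heat_grad_inner[OF assms(1,2)] heat_def
    using gauss_integrable_bounded[OF assms(1,2) ix, of x] gauss_integrable_bounded[OF assms(1,2) il, of x]
      heat_integrable[OF assms(1,2), of x]
    by (simp add: right_diff_distrib)
  also have "\<bar>\<dots>\<bar> \<le> (\<integral>w. \<bar>f (x + w) * ?r w\<bar> \<partial>gauss \<tau>)" by (rule integral_abs_bound)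
  also have "\<dots> \<le> (\<integral>w. B * (7 * n\<^sup>2 * ?E w) \<partial>gauss \<tau>)"
  proof (rule integral_mono)
    show "integrable (gauss \<tau>) (\<lambda>w. \<bar>f (x + w) * ?r w\<bar>)"
      using gauss_integrable_bounded[OF assms(1,2) ir, of x] by (rule integrable_abs)
    show "integrable (gauss \<tau>) (\<lambda>w. B * (7 * n\<^sup>2 * ?E w))"
      using E by (intro integrable_mult_right) (auto simp: has_bochner_integral_iff)
    show "\<bar>f (x + w) * ?r w\<bar> \<le> B * (7 * n\<^sup>2 * ?E w)" for w
      unfolding abs_mult using b[of w] bounded_borelD(2,3)[OF assms(2)] by (intro mult_mono) auto
  qed
  also have "\<dots> = B * (7 * n\<^sup>2 * (2 * exp 2))"
    using E by (simp add: has_bochner_integral_iff del: Bochner_Integration.integral_add)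
  finally show ?thesis by (simp add: n2 ac_simps)
qed simp

text \<open>Removes the restriction to short D: beyond sqrt \<tau> the three terms are bounded
  separately by multiples of B and B n, and there 1 \<le> n \<le> n^2.\<close>

lemma heat_taylor:
  fixes D :: "'a::euclidean_space"
  assumes "\<tau> > 0" "bounded_borel B f"
  shows "\<bar>heat \<tau> f (x + D) - heat \<tau> f x - heat_grad \<tau> f x \<bullet> D\<bar> \<le> heat_const * B * (norm D)\<^sup>2 / \<tau>"
proof -
  define n where "n = norm D / sqrt \<tau>"
  have n2: "n\<^sup>2 = (norm D)\<^sup>2 / \<tau>" using assms(1) by (simp add: n_def power_divide)
  note B = bounded_borelD(3)[OF assms(2)]
  have e2: "exp 2 \<ge> (1::real)" using exp_ge_add_one_self[of 2] by linarith
  show ?thesis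
  proof (cases "norm D \<le> sqrt \<tau>")
    case True
    have "14 * exp 2 * B * (norm D)\<^sup>2 / \<tau> \<le> heat_const * B * (norm D)\<^sup>2 / \<tau>"
      unfolding heat_const_def using B assms(1) by (intro divide_right_mono mult_right_mono) auto
    then show ?thesis using heat_taylor_near[OF assms True, of x] by linarith
  next
    case False
    then have n: "n \<ge> 1" using assms(1) by (simp add: n_def)
    then have nn: "n \<le> n\<^sup>2" "1 \<le> n\<^sup>2" by (simp_all add: self_le_power)
    have "\<bar>heat \<tau> f (x + D) - heat \<tau> f x - heat_grad \<tau> f x \<bullet> D\<bar> \<le> B + B + 2 * exp 2 * B * n"
      using bounded_borelD(2)[OF heat_bounded[OF assms], of x]
        bounded_borelD(2)[OF heat_bounded[OF assms], of "x + D"]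
        heat_grad_inner_bound[OF assms, of x D] unfolding n_def by (simp add: mult.assoc)
    also have "\<dots> \<le> (2 * B) * n\<^sup>2 + 2 * exp 2 * B * n\<^sup>2"
      using B nn mult_left_mono[of 1 "n\<^sup>2" "2 * B"] by (intro add_mono mult_left_mono) auto
    also have "\<dots> = (2 + 2 * exp 2) * (B * n\<^sup>2)" by (simp add: algebra_simps)
    also have "\<dots> \<le> heat_const * (B * n\<^sup>2)"
      using B e2 unfolding heat_const_def by (intro mult_right_mono mult_nonneg_nonneg zero_le_power2) linarith+
    finally show ?thesis by (simp add: n2)
  qed
qed

text \<open>Near x this is Taylor plus the gradient bound, with n^2 \<le> n; far from x it is twice
  the sup bound, with 1 \<le> n.\<close>

lemma heat_lipschitz:
  fixes D :: "'a::euclidean_space"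
  assumes "\<tau> > 0" "bounded_borel B f"
  shows "\<bar>heat \<tau> f (x + D) - heat \<tau> f x\<bar> \<le> heat_const * B * norm D / sqrt \<tau>"
proof -
  define n where "n = norm D / sqrt \<tau>"
  have n2: "n\<^sup>2 = (norm D)\<^sup>2 / \<tau>" using assms(1) by (simp add: n_def power_divide)
  have n0: "n \<ge> 0" using assms(1) by (simp add: n_def)
  note B = bounded_borelD(3)[OF assms(2)]
  have e2: "exp 2 \<ge> (1::real)" using exp_ge_add_one_self[of 2] by linarith
  have "\<bar>heat \<tau> f (x + D) - heat \<tau> f x\<bar> \<le> heat_const * (B * n)"
  proof (cases "norm D \<le> sqrt \<tau>")
    case True
    then have n: "n \<le> 1" using assms(1) by (simp add: n_def)
    have "n\<^sup>2 \<le> n" using n n0 by (simp add: power2_eq_square mult_left_le)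
    then have "B * n\<^sup>2 \<le> B * n" using B by (intro mult_left_mono)
    then have "14 * exp 2 * (B * n\<^sup>2) \<le> 14 * exp 2 * (B * n)" by (rule mult_left_mono) simp
    moreover have "\<bar>heat \<tau> f (x + D) - heat \<tau> f x - heat_grad \<tau> f x \<bullet> D\<bar> \<le> 14 * exp 2 * (B * n\<^sup>2)"
      using heat_taylor_near[OF assms True, of x] by (simp add: n2 ac_simps)
    moreover have "\<bar>heat_grad \<tau> f x \<bullet> D\<bar> \<le> 2 * exp 2 * (B * n)"
      using heat_grad_inner_bound[OF assms, of x D] by (simp add: n_def)
    ultimately show ?thesis unfolding heat_const_def by linarith
  next
    case False
    then have n: "n \<ge> 1" using assms(1) by (simp add: n_def)
    have "\<bar>heat \<tau> f (x + D) - heat \<tau> f x\<bar> \<le> 2 * (B * 1)"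
      using bounded_borelD(2)[OF heat_bounded[OF assms], of x]
        bounded_borelD(2)[OF heat_bounded[OF assms], of "x + D"] by linarith
    also have "\<dots> \<le> 2 * (B * n)" using n B by (intro mult_left_mono) auto
    also have "\<dots> \<le> heat_const * (B * n)"
      using B n e2 unfolding heat_const_def by (intro mult_right_mono mult_nonneg_nonneg zero_le_power2) linarith+
    finally show ?thesis .
  qed
  then show ?thesis by (simp add: n_def mult.assoc)
qed

lemma heat_semigroup:
  fixes f :: "'a::euclidean_space \<Rightarrow> real"
  assumes "s > 0" "t > 0" "bounded_borel B f"
  shows "heat s (heat t f) = heat (s + t) f"
proof
  fix x
  interpret s: prob_space "gauss s :: 'a measure" using assms(1) by (rule prob_space_gauss)
  interpret t: prob_space "gauss t :: 'a measure" using assms(2) by (rule prob_space_gauss)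
  interpret st: pair_prob_space "gauss s :: 'a measure" "gauss t :: 'a measure" ..
  note [measurable] = bounded_borelD(1)[OF assms(3)]
  have i: "integrable (gauss s \<Otimes>\<^sub>M gauss t) (\<lambda>p. f (x + (fst p + snd p)))"
    using bounded_borelD(2)[OF assms(3)]
    by (intro st.P.integrable_const_bound[of _ B] AE_I2) (simp, measurable)
  have "heat (s + t) f x = (\<integral>p. f (x + (fst p + snd p)) \<partial>(gauss s \<Otimes>\<^sub>M gauss t))"
    unfolding heat_def gauss_conv[OF assms(1,2), symmetric]
    by (subst integral_distr) (auto simp: case_prod_beta)
  also have "\<dots> = (\<integral>w. \<integral>z. f (x + (w + z)) \<partial>gauss t \<partial>gauss s)"
    using st.integral_fst'[OF i] by simp
  finally show "heat s (heat t f) x = heat (s + t) f x"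
    by (simp add: heat_def add.assoc)
qed

text \<open>Both sides are first-order approximations, with quadratic error, of the same function
  \<open>heat (s + t) f\<close> at x, hence equal. No derivative has to be interchanged with an
  integral.\<close>

lemma heat_grad_semigroup:
  fixes f :: "'a::euclidean_space \<Rightarrow> real"
  assumes "s > 0" "t > 0" "bounded_borel B f"
  shows "heat_grad s (heat t f) = heat_grad (s + t) f"
proof
  fix x
  define G where "G = heat_grad s (heat t f) x - heat_grad (s + t) f x"
  define C where "C = heat_const * B / s + heat_const * B / (s + t)"
  have b: "bounded_borel B (heat t f)" using assms by (intro heat_bounded)
  have C: "C \<ge> 0" unfolding C_def using assms(1,2) bounded_borelD(3)[OF assms(3)] by (intro add_nonneg_nonneg divide_nonneg_pos mult_nonneg_nonneg) auto
  have "\<bar>G \<bullet> D\<bar> \<le> C * (norm D)\<^sup>2" for D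
  proof -
    have "\<bar>G \<bullet> D\<bar> \<le> heat_const * B * (norm D)\<^sup>2 / s + heat_const * B * (norm D)\<^sup>2 / (s + t)"
      using heat_taylor[OF assms(1) b, of x D] heat_taylor[OF _ assms(3), of "s + t" x D] assms(1,2)
      unfolding heat_semigroup[OF assms] by (simp add: G_def inner_diff_left)
    then show ?thesis by (simp add: C_def algebra_simps)
  qed
  then have e: "\<epsilon> * (G \<bullet> G) \<le> C * (\<epsilon>\<^sup>2 * (G \<bullet> G))" if "\<epsilon> > 0" for \<epsilon>
  proof -
    have "\<epsilon> * (G \<bullet> G) \<le> \<bar>G \<bullet> (\<epsilon> *\<^sub>R G)\<bar>" by simp
    also have "\<dots> \<le> C * (norm (\<epsilon> *\<^sub>R G))\<^sup>2" by fact
    finally show ?thesis by (simp add: dot_square_norm power_mult_distrib)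
  qed
  have "G \<bullet> G \<le> 0"
  proof (rule ccontr)
    assume "\<not> G \<bullet> G \<le> 0"
    then have G: "G \<bullet> G > 0" by linarith
    \<comment> \<open>So small that in the direction G the linear term would exceed the quadratic
      error.\<close>
    define \<epsilon> where "\<epsilon> = 1 / (C + 1)"
    have \<epsilon>: "\<epsilon> > 0" "C * \<epsilon> < 1" using C by (simp_all add: \<epsilon>_def)
    have "\<epsilon> * (G \<bullet> G) \<le> \<epsilon> * (C * \<epsilon> * (G \<bullet> G))"
      using e[OF \<epsilon>(1)] by (simp add: power2_eq_square ac_simps)
    then have "G \<bullet> G \<le> C * \<epsilon> * (G \<bullet> G)" using \<epsilon>(1) by (rule mult_left_le_imp_le)
    moreover have "C * \<epsilon> * (G \<bullet> G) < 1 * (G \<bullet> G)" using \<epsilon>(2) G by (rule mult_strict_right_mono)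
    ultimately show False by linarith
  qed
  then have "G = 0" by (metis inner_gt_zero_iff not_le)
  then show "heat_grad s (heat t f) x = heat_grad (s + t) f x" by (simp add: G_def)
qed

lemma heat_shift: "heat \<tau> (\<lambda>x. f (x + a)) x = heat \<tau> f (x + a)"
  by (simp add: heat_def algebra_simps)

lemma heat_grad_shift: "heat_grad \<tau> (\<lambda>x. f (x + a)) x = heat_grad \<tau> f (x + a)"
  by (simp add: heat_grad_def algebra_simps)

lemma heat_grad_diff_bound:
  fixes f :: "'a::euclidean_space \<Rightarrow> real"
  assumes "\<tau> > 0" "bounded_borel B f" "bounded_borel B' g" "\<And>x. \<bar>f x - g x\<bar> \<le> C"
  shows "norm (heat_grad \<tau> f x - heat_grad \<tau> g x) \<le> heat_const * C / sqrt \<tau>"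
proof -
  have "heat_grad \<tau> f x - heat_grad \<tau> g x = heat_grad \<tau> (\<lambda>x. f x - g x) x"
    unfolding heat_grad_def diff_divide_distrib scaleR_diff_left
    by (rule Bochner_Integration.integral_diff[symmetric])
      (rule heat_grad_integrable[OF assms(1,2)] heat_grad_integrable[OF assms(1,3)])+
  moreover have "bounded_borel C (\<lambda>x. f x - g x)"
    using assms(2-4) by (auto simp: bounded_borel_def)
  ultimately show ?thesis using heat_grad_bound[OF assms(1)] by metis
qed

text \<open>Half of the time makes \<open>f\<close> Lipschitz and the other half takes the gradient;
  each costs a factor 1 / sqrt (\<tau> / 2).\<close>

lemma heat_grad_lipschitz:
  fixes f :: "'a::euclidean_space \<Rightarrow> real"
  assumes "\<tau> > 0" "bounded_borel B f"
  shows "norm (heat_grad \<tau> f y - heat_grad \<tau> f x) \<le> 2 * heat_const\<^sup>2 * B / \<tau> * norm (y - x)"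
proof -
  let ?F = "heat (\<tau> / 2) f" let ?s = "sqrt (\<tau> / 2)"
  have F: "bounded_borel B ?F" using assms by (intro heat_bounded) auto
  have F': "bounded_borel B (\<lambda>z. ?F (z + (y - x)))" by (rule bounded_borel_shift[OF F])
  have "heat_grad \<tau> f y - heat_grad \<tau> f x
      = heat_grad (\<tau> / 2) (\<lambda>z. ?F (z + (y - x))) x - heat_grad (\<tau> / 2) ?F x"
    using heat_grad_semigroup[of "\<tau> / 2" "\<tau> / 2", OF _ _ assms(2)] assms(1) by (simp add: heat_grad_shift)
  also have "norm \<dots> \<le> heat_const * (heat_const * B * norm (y - x) / ?s) / ?s"
    using assms(1) heat_lipschitz[OF _ assms(2), of "\<tau> / 2" _ "y - x"]
    by (intro heat_grad_diff_bound[OF _ F' F]) auto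
  also have "\<dots> = heat_const * heat_const * B * norm (y - x) / (?s * ?s)" by simp
  also have "?s * ?s = \<tau> / 2" using assms(1) by simp
  finally show ?thesis by (simp add: power2_eq_square ac_simps)
qed

text \<open>A Lipschitz function is averaged over Gaussian displacements whose mean size is of order
  sqrt h.\<close>

lemma heat_time_modulus:
  fixes f :: "'a::euclidean_space \<Rightarrow> real"
  assumes "\<tau> > 0" "h > 0" "bounded_borel B f"
  shows "\<bar>heat h (heat \<tau> f) x - heat \<tau> f x\<bar>
    \<le> heat_const * B / sqrt \<tau> * (real DIM('a) * (2 * exp 2) * sqrt h)"
proof -
  interpret prob_space "gauss h :: 'a measure" using assms(2) by (rule prob_space_gauss)
  let ?F = "heat \<tau> f" let ?c = "heat_const * B / sqrt \<tau>"
  have F: "bounded_borel B ?F" using assms by (intro heat_bounded) auto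
  note iF = heat_integrable[OF assms(2) F]
  have "heat h ?F x - ?F x = (\<integral>w. ?F (x + w) - ?F x \<partial>gauss h)"
    unfolding heat_def[of h] using iF[of x] prob_space by simp
  also have "\<bar>\<dots>\<bar> \<le> (\<integral>w. \<bar>?F (x + w) - ?F x\<bar> \<partial>gauss h)" by (rule integral_abs_bound)
  also have "\<dots> \<le> (\<integral>w. ?c * norm (w::'a) \<partial>gauss h)"
    using iF[of x] gauss_norm_bound(1)[OF assms(2)] heat_lipschitz[OF assms(1,3), of x]
    by (intro integral_mono) auto
  also have "\<dots> = ?c * (\<integral>w. norm (w::'a) \<partial>gauss h)" by simp
  also have "\<dots> \<le> ?c * (real DIM('a) * (2 * exp 2) * sqrt h)"
    using gauss_norm_bound(2)[OF assms(2)] assms(1) bounded_borelD(3)[OF assms(3)]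
    by (intro mult_left_mono) auto
  finally show ?thesis .
qed

lemma heat_grad_time_modulus:
  fixes f :: "'a::euclidean_space \<Rightarrow> real"
  assumes "\<tau> > 0" "h > 0" "bounded_borel B f"
  shows "norm (heat_grad (\<tau> + h) f x - heat_grad \<tau> f x)
    \<le> 2 * heat_const\<^sup>2 * B / \<tau> * (real DIM('a) * (2 * exp 2) * sqrt h)"
proof -
  let ?F = "heat (\<tau> / 2) f" let ?s = "sqrt (\<tau> / 2)" let ?m = "real DIM('a) * (2 * exp 2) * sqrt h"
  have F: "bounded_borel B ?F" using assms by (intro heat_bounded) auto
  have F': "bounded_borel B (heat h ?F)" by (intro heat_bounded F assms(2))
  have "heat_grad (\<tau> + h) f = heat_grad (\<tau> / 2) (heat h ?F)"
    using heat_semigroup[of h "\<tau> / 2", OF _ _ assms(3)]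
      heat_grad_semigroup[of "\<tau> / 2" "h + \<tau> / 2", OF _ _ assms(3)] assms(1,2) by (simp add: add.commute)
  then have "heat_grad (\<tau> + h) f x - heat_grad \<tau> f x
      = heat_grad (\<tau> / 2) (heat h ?F) x - heat_grad (\<tau> / 2) ?F x"
    using heat_grad_semigroup[of "\<tau> / 2" "\<tau> / 2", OF _ _ assms(3)] assms(1) by simp
  also have "norm \<dots> \<le> heat_const * (heat_const * B / ?s * ?m) / ?s"
    using assms heat_time_modulus[of "\<tau> / 2" h B f]
    by (intro heat_grad_diff_bound[OF _ F' F]) auto
  also have "\<dots> = heat_const * heat_const * B * ?m / (?s * ?s)" by simp
  also have "?s * ?s = \<tau> / 2" using assms(1) by simp
  finally show ?thesis by (simp add: power2_eq_square ac_simps)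
qed

text \<open>The explicit density exposes the dependence on \<tau>, so joint measurability becomes
  that of a parameter integral over \<open>lborel\<close>.\<close>

lemma heat_grad_measurable:
  assumes [measurable]: "f \<in> borel_measurable borel"
  shows "(\<lambda>(\<tau>, x). heat_grad \<tau> f x) \<in> borel_measurable (borel \<Otimes>\<^sub>M borel)"
proof -
  have "heat_grad \<tau> f x = (\<integral>w. gauss_density \<tau> w *\<^sub>R ((f (x + w) / \<tau>) *\<^sub>R w) \<partial>lborel)" for \<tau> x
    unfolding heat_grad_def gauss_def by (rule integral_density) auto
  moreover have "(\<lambda>(\<tau>, x). \<integral>w. gauss_density \<tau> w *\<^sub>R ((f (x + w) / \<tau>) *\<^sub>R w) \<partial>lborel)
      \<in> borel_measurable (borel \<Otimes>\<^sub>M borel)"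
    unfolding gauss_density_def normal_density_def by measurable
  ultimately show ?thesis by simp
qed

section \<open>The Duhamel formula\<close>

text \<open>Increments of order h sqrt h force the derivative to vanish. In \<open>duhamel\<close>
  this takes the place of Ito's formula.\<close>

lemma holder_three_halves_constant:
  fixes \<Phi> :: "real \<Rightarrow> real"
  assumes "a \<le> c"
    and est: "\<And>s s'. a \<le> s \<Longrightarrow> s < s' \<Longrightarrow> s' \<le> c \<Longrightarrow> s' - s \<le> 1 \<Longrightarrow> \<bar>\<Phi> s' - \<Phi> s\<bar> \<le> C * (s' - s) * sqrt (s' - s)"
  shows "\<Phi> c = \<Phi> a"
proof -
  have "(\<Phi> has_field_derivative 0) (at x within {a..c})" if x: "x \<in> {a..c}" for x
  proof -
    have "((\<lambda>y. C * sqrt \<bar>y - x\<bar>) \<longlongrightarrow> C * sqrt \<bar>x - x\<bar>) (at x within {a..c})"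
      by (intro tendsto_intros)
    then have lim: "((\<lambda>y. C * sqrt \<bar>y - x\<bar>) \<longlongrightarrow> 0) (at x within {a..c})" by simp
    have "((\<lambda>y. (\<Phi> y - \<Phi> x) / (y - x)) \<longlongrightarrow> 0) (at x within {a..c})"
    proof (rule Lim_null_comparison[OF _ lim])
      have "\<forall>\<^sub>F y in at x within {a..c}. dist y x < 1 \<and> y \<noteq> x \<and> y \<in> {a..c}"
        by (auto simp: eventually_at intro!: exI[of _ 1])
      then show "\<forall>\<^sub>F y in at x within {a..c}. norm ((\<Phi> y - \<Phi> x) / (y - x)) \<le> C * sqrt \<bar>y - x\<bar>"
      proof eventually_elim
        case (elim y)
        have "\<bar>\<Phi> y - \<Phi> x\<bar> \<le> C * \<bar>y - x\<bar> * sqrt \<bar>y - x\<bar>"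
        proof (cases "x < y")
          case True
          then show ?thesis using est[of x y] elim x by (auto simp: dist_real_def)
        next
          case False
          then show ?thesis using est[of y x] elim x by (auto simp: dist_real_def abs_minus_commute)
        qed
        then show ?case using elim by (simp add: abs_divide divide_le_eq ac_simps)
      qed
    qed
    then show ?thesis by (simp add: has_field_derivative_iff)
  qed
  then obtain k where "\<And>x. x \<in> {a..c} \<Longrightarrow> \<Phi> x = k"
    using has_field_derivative_zero_constant[of "{a..c}" \<Phi>] by auto
  then show ?thesis using assms(1) by simp
qed

lemma set_integral_Ioc_bound:
  fixes h :: "real \<Rightarrow> 'b::euclidean_space"
  assumes [measurable]: "h \<in> borel_measurable borel"
    and "\<And>r. r \<in> {s<..t} \<Longrightarrow> norm (h r) \<le> c" "s \<le> t"
  shows "set_integrable lborel {s<..t} h" "norm (LINT r:{s<..t}|lborel. h r) \<le> c * (t - s)"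
proof -
  have i: "integrable lborel (\<lambda>r. c * indicat_real {s<..t} r)"
    by (intro integrable_mult_right) (simp_all add: assms(3))
  have b: "norm (indicat_real {s<..t} r *\<^sub>R h r) \<le> c * indicat_real {s<..t} r" for r
    using assms(2)[of r] by (auto simp: indicator_def)
  show I: "set_integrable lborel {s<..t} h"
    unfolding set_integrable_def
    by (rule Bochner_Integration.integrable_bound[OF i])
       (use b in \<open>auto intro: order_trans[OF _ abs_ge_self]\<close>)
  have "norm (LINT r:{s<..t}|lborel. h r) \<le> (\<integral>r. c * indicat_real {s<..t} r \<partial>lborel)"
    unfolding set_lebesgue_integral_def
    by (rule Bochner_Integration.integral_norm_bound_integral) (use I i b in \<open>auto simp: set_integrable_def\<close>)
  also have "\<dots> = c * (t - s)" using assms(3) by simp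
  finally show "norm (LINT r:{s<..t}|lborel. h r) \<le> c * (t - s)" .
qed

text \<open>What is kept of the equation once the filtration is forgotten: independence of
  increments survives as the integral identity \<open>incr_indep\<close>. The bound on the drift
  holds everywhere and time runs over all reals, so that joint measurability lives on a plain
  product space.\<close>

locale drifted_process = prob_space M
  for M :: "'w measure" +
  fixes X W \<beta> :: "real \<Rightarrow> 'w \<Rightarrow> 'a::euclidean_space" and K :: real
  assumes X_meas: "(\<lambda>(s, \<omega>). X s \<omega>) \<in> borel_measurable (borel \<Otimes>\<^sub>M M)"
    and W_meas [measurable]: "\<And>s. 0 \<le> s \<Longrightarrow> W s \<in> borel_measurable M"
    and drift_meas: "(\<lambda>(s, \<omega>). \<beta> s \<omega>) \<in> borel_measurable (borel \<Otimes>\<^sub>M M)"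
    and drift_bound: "\<And>s \<omega>. norm (\<beta> s \<omega>) \<le> K"
    and incr_law: "\<And>s t. 0 \<le> s \<Longrightarrow> s < t \<Longrightarrow> distr M borel (\<lambda>\<omega>. W t \<omega> - W s \<omega>) = gauss (t - s)"
    and incr_indep: "\<And>s t B f. 0 \<le> s \<Longrightarrow> s < t \<Longrightarrow> bounded_borel B f \<Longrightarrow>
      (\<integral>\<omega>. f (X s \<omega> + (W t \<omega> - W s \<omega>)) \<partial>M) = (\<integral>\<omega>. heat (t - s) f (X s \<omega>) \<partial>M)"
    and eqn: "\<And>s t. 0 \<le> s \<Longrightarrow> s < t \<Longrightarrow>
      AE \<omega> in M. X t \<omega> = X s \<omega> + (LINT r:{s<..t}|lborel. \<beta> r \<omega>) + (W t \<omega> - W s \<omega>)"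
begin

lemma X_measurable [measurable]: "X s \<in> borel_measurable M"
  and drift_measurable [measurable]: "\<beta> s \<in> borel_measurable M"
  using measurable_compose[OF _ X_meas, of "\<lambda>\<omega>. (s, \<omega>)" M]
    measurable_compose[OF _ drift_meas, of "\<lambda>\<omega>. (s, \<omega>)" M] by simp_all

lemma drift_path_measurable:
  "\<omega> \<in> space M \<Longrightarrow> (\<lambda>r. \<beta> r \<omega>) \<in> borel_measurable borel"
  using measurable_compose[OF _ drift_meas, of "\<lambda>r. (r, \<omega>)" borel] by simp

lemma K_nonneg: "0 \<le> K"
  using drift_bound norm_ge_zero order_trans by blast

lemma integrable_bounded_borel:
  "bounded_borel B f \<Longrightarrow> Y \<in> borel_measurable M \<Longrightarrow> integrable M (\<lambda>\<omega>. f (Y \<omega>))"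
  by (rule integrable_const_bound[of _ B]) (auto simp: bounded_borel_def)

lemma incr_norm:
  assumes "0 \<le> s" "s < t"
  shows "integrable M (\<lambda>\<omega>. norm (W t \<omega> - W s \<omega>))"
    and "(\<integral>\<omega>. norm (W t \<omega> - W s \<omega>) \<partial>M) \<le> real DIM('a) * (2 * exp 2) * sqrt (t - s)"
proof -
  have [measurable]: "W t \<in> borel_measurable M" "W s \<in> borel_measurable M"
    using assms by auto
  show "integrable M (\<lambda>\<omega>. norm (W t \<omega> - W s \<omega>))"
  proof -
    have "integrable (distr M borel (\<lambda>\<omega>. W t \<omega> - W s \<omega>)) norm"
      using gauss_norm_bound(1)[where 'a='a, of "t - s"] assms unfolding incr_law[OF assms] by simp
    then show ?thesis by (subst (asm) integrable_distr_eq) auto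
  qed
  show "(\<integral>\<omega>. norm (W t \<omega> - W s \<omega>) \<partial>M) \<le> real DIM('a) * (2 * exp 2) * sqrt (t - s)"
  proof -
    have "(\<integral>w. norm w \<partial>distr M borel (\<lambda>\<omega>. W t \<omega> - W s \<omega>)) \<le> real DIM('a) * (2 * exp 2) * sqrt (t - s)"
      using gauss_norm_bound(2)[where 'a='a, of "t - s"] assms unfolding incr_law[OF assms] by simp
    then show ?thesis by (subst (asm) integral_distr) auto
  qed
qed

lemma Fubini_Ioc:
  fixes H :: "real \<Rightarrow> 'w \<Rightarrow> real"
  assumes H: "(\<lambda>(s, \<omega>). H s \<omega>) \<in> borel_measurable (borel \<Otimes>\<^sub>M M)"
    and b: "\<And>s \<omega>. s \<in> {a<..c} \<Longrightarrow> \<bar>H s \<omega>\<bar> \<le> k" and "a \<le> c"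
  shows "(\<integral>\<omega>. (LINT s:{a<..c}|lborel. H s \<omega>) \<partial>M) = (LINT s:{a<..c}|lborel. (\<integral>\<omega>. H s \<omega> \<partial>M))"
    and "set_integrable lborel {a<..c} (\<lambda>s. \<integral>\<omega>. H s \<omega> \<partial>M)"
    and "integrable M (\<lambda>\<omega>. LINT s:{a<..c}|lborel. H s \<omega>)"
proof -
  interpret L: pair_sigma_finite lborel M ..
  note [measurable] = H
  let ?I = "indicat_real {a<..c}"
  have ki: "integrable (lborel \<Otimes>\<^sub>M M) (\<lambda>p. k * indicat_real ({a<..c} \<times> space M) p)"
    by (intro integrable_mult_right integrable_real_indicator)
       (auto simp: emeasure_pair_measure_Times emeasure_space_1 assms(3))
  have int: "integrable (lborel \<Otimes>\<^sub>M M) (\<lambda>(s, \<omega>). ?I s *\<^sub>R H s \<omega>)"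
  proof (rule Bochner_Integration.integrable_bound[OF ki])
    show "AE p in lborel \<Otimes>\<^sub>M M. norm (case p of (s, \<omega>) \<Rightarrow> ?I s *\<^sub>R H s \<omega>)
        \<le> norm (k * indicat_real ({a<..c} \<times> space M) p)"
    proof (rule AE_I2)
      fix p :: "real \<times> 'w" assume "p \<in> space (lborel \<Otimes>\<^sub>M M)"
      then obtain s \<omega> where p: "p = (s, \<omega>)" "\<omega> \<in> space M" by (auto simp: space_pair_measure)
      show "norm (case p of (s, \<omega>) \<Rightarrow> ?I s *\<^sub>R H s \<omega>) \<le> norm (k * indicat_real ({a<..c} \<times> space M) p)"
        using b[of s \<omega>] p by (auto simp: indicator_def)
    qed
  qed measurable
  show "(\<integral>\<omega>. (LINT s:{a<..c}|lborel. H s \<omega>) \<partial>M) = (LINT s:{a<..c}|lborel. (\<integral>\<omega>. H s \<omega> \<partial>M))"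
    using L.Fubini_integral[OF int] by (simp add: set_lebesgue_integral_def)
  show "set_integrable lborel {a<..c} (\<lambda>s. \<integral>\<omega>. H s \<omega> \<partial>M)"
    using L.integrable_fst'[OF int] by (simp add: set_integrable_def)
  show "integrable M (\<lambda>\<omega>. LINT s:{a<..c}|lborel. H s \<omega>)"
    using L.integrable_snd[OF int] by (simp add: set_lebesgue_integral_def)
qed

lemma drift_integral_bound:
  assumes "s \<le> t" "\<omega> \<in> space M"
  shows "set_integrable lborel {s<..t} (\<lambda>r. \<beta> r \<omega>)"
    and "norm (LINT r:{s<..t}|lborel. \<beta> r \<omega>) \<le> K * (t - s)"
  using set_integral_Ioc_bound[OF drift_path_measurable[OF assms(2)] drift_bound assms(1)] by auto

lemma drift_integral_measurable [measurable]:
  "(\<lambda>\<omega>. LINT r:{s<..t}|lborel. \<beta> r \<omega>) \<in> borel_measurable M"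
proof -
  note [measurable] = drift_meas
  show ?thesis unfolding set_lebesgue_integral_def by measurable
qed

text \<open>The integrand of Duhamel's formula; as s approaches t it grows at most like 1 / sqrt (t
  - s).\<close>

definition gen_term :: "real \<Rightarrow> ('a \<Rightarrow> real) \<Rightarrow> real \<Rightarrow> real" where
  "gen_term t f s = (\<integral>\<omega>. \<beta> s \<omega> \<bullet> heat_grad (t - s) f (X s \<omega>) \<partial>M)"

lemma gen_integrand_measurable:
  assumes [measurable]: "f \<in> borel_measurable borel"
  shows "(\<lambda>(s, \<omega>). \<beta> s \<omega> \<bullet> heat_grad (t - s) f (X s \<omega>)) \<in> borel_measurable (borel \<Otimes>\<^sub>M M)"
proof -
  note [measurable] = heat_grad_measurable[OF assms] X_meas drift_meas
  have "(\<lambda>p. heat_grad (t - fst p) f (X (fst p) (snd p)))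
      = (\<lambda>p. (\<lambda>(\<tau>, x). heat_grad \<tau> f x) (t - fst p, (\<lambda>(s, \<omega>). X s \<omega>) p))"
    by (auto simp: case_prod_beta)
  moreover have "\<dots> \<in> borel_measurable (borel \<Otimes>\<^sub>M M)" by measurable
  ultimately have [measurable]: "(\<lambda>p. heat_grad (t - fst p) f (X (fst p) (snd p))) \<in> borel_measurable (borel \<Otimes>\<^sub>M M)"
    by simp
  have "(\<lambda>p. (\<lambda>(s, \<omega>). \<beta> s \<omega>) p \<bullet> heat_grad (t - fst p) f (X (fst p) (snd p))) \<in> borel_measurable (borel \<Otimes>\<^sub>M M)"
    by measurable
  then show ?thesis by (simp add: case_prod_beta')
qed

lemma gen_integrand_bound:
  assumes "bounded_borel B f" "0 < \<delta>" "\<delta> \<le> t - s"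
  shows "\<bar>\<beta> s \<omega> \<bullet> heat_grad (t - s) f y\<bar> \<le> K * (heat_const * B / sqrt \<delta>)"
proof -
  have "norm (heat_grad (t - s) f y) \<le> heat_const * B / sqrt (t - s)"
    using assms by (intro heat_grad_bound) auto
  also have "\<dots> \<le> heat_const * B / sqrt \<delta>"
    using assms bounded_borelD(3)[OF assms(1)] by (intro divide_left_mono) auto
  finally have "norm (heat_grad (t - s) f y) \<le> heat_const * B / sqrt \<delta>" .
  then have "norm (\<beta> s \<omega>) * norm (heat_grad (t - s) f y) \<le> K * (heat_const * B / sqrt \<delta>)"
    using drift_bound K_nonneg by (intro mult_mono) auto
  then show ?thesis using Cauchy_Schwarz_ineq2[of "\<beta> s \<omega>"] order_trans by blast
qed

lemma generator_step:
  assumes f: "bounded_borel B f" and q: "0 \<le> q" and h: "0 < h" "h \<le> 1" and \<delta>: "0 < \<delta>" "q + h + \<delta> \<le> t"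
  defines "L \<equiv> 2 * heat_const\<^sup>2 * B / \<delta>" and "m \<equiv> real DIM('a) * (2 * exp 2)"
  shows "\<bar>(\<integral>\<omega>. heat (t - (q + h)) f (X (q + h) \<omega>) \<partial>M) - (\<integral>\<omega>. heat (t - q) f (X q \<omega>) \<partial>M)
      - (LINT s:{q<..q + h}|lborel. gen_term t f s)\<bar>
    \<le> (heat_const * B * K\<^sup>2 / \<delta> + K * (L * (m + K) + L * m)) * h * sqrt h"
proof -
  note [measurable] = bounded_borelD(1)[OF f]
  note B = bounded_borelD(3)[OF f]
  note K = K_nonneg
  have L: "L \<ge> 0" unfolding L_def using B \<delta>(1) by simp
  have m: "m \<ge> 0" unfolding m_def by simp
  \<comment> \<open>With h \<le> 1 an error of order h counts as one of order sqrt h.\<close>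
  have sh: "h \<le> sqrt h" using h by (simp add: real_le_rsqrt power2_eq_square mult_left_le)
  define \<tau> where "\<tau> = t - (q + h)"
  have \<tau>: "\<delta> \<le> \<tau>" "0 < \<tau>" using \<delta> by (auto simp: \<tau>_def)
  define Z where "Z \<omega> = X q \<omega> + (W (q + h) \<omega> - W q \<omega>)" for \<omega>
  define D where "D \<omega> = (LINT r:{q<..q + h}|lborel. \<beta> r \<omega>)" for \<omega>
  have [measurable]: "W (q + h) \<in> borel_measurable M" "W q \<in> borel_measurable M"
    using q h by auto
  have [measurable]: "Z \<in> borel_measurable M" unfolding Z_def by measurable
  have [measurable]: "D \<in> borel_measurable M" unfolding D_def by measurable
  let ?u = "heat \<tau> f" and ?G = "heat_grad \<tau> f"
  have u: "bounded_borel B ?u" using \<tau>(2) f by (rule heat_bounded)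
  note [measurable] = bounded_borelD(1)[OF u]
  have [measurable]: "?G \<in> borel_measurable borel"
    using measurable_compose[OF _ heat_grad_measurable[OF bounded_borelD(1)[OF f]], of "\<lambda>x. (\<tau>, x)" borel] by simp
  have Dn: "norm (D \<omega>) \<le> K * h" if "\<omega> \<in> space M" for \<omega>
    using drift_integral_bound(2)[of q "q + h" \<omega>] that h by (simp add: D_def)
  have lip: "norm (heat_grad \<tau>' f y - heat_grad \<tau>' f x) \<le> L * norm (y - x)" if "\<delta> \<le> \<tau>'" for \<tau>' x y
  proof -
    have "2 * heat_const\<^sup>2 * B / \<tau>' \<le> L" unfolding L_def using that \<delta>(1) B by (intro divide_left_mono) auto
    then have "2 * heat_const\<^sup>2 * B / \<tau>' * norm (y - x) \<le> L * norm (y - x)" by (intro mult_right_mono) auto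
    then show ?thesis using heat_grad_lipschitz[OF _ f, of \<tau>' y x] that \<delta>(1) by linarith
  qed
  have tim: "norm (?G x - heat_grad (\<tau> + \<eta>) f x) \<le> L * (m * sqrt h)" if "0 \<le> \<eta>" "\<eta> \<le> h" for \<eta> x
  proof (cases "\<eta> = 0")
    case False
    have "2 * heat_const\<^sup>2 * B / \<tau> \<le> L" unfolding L_def using \<tau> \<delta>(1) B by (intro divide_left_mono) auto
    then have "2 * heat_const\<^sup>2 * B / \<tau> * (m * sqrt \<eta>) \<le> L * (m * sqrt h)"
      using m that L by (intro mult_mono) auto
    then show ?thesis using heat_grad_time_modulus[OF \<tau>(2) _ f, of \<eta> x] that False
      unfolding m_def by (simp add: norm_minus_commute)
  qed (use L m h in auto)
  have 1: "(\<integral>\<omega>. ?u (X (q + h) \<omega>) \<partial>M) = (\<integral>\<omega>. ?u (Z \<omega> + D \<omega>) \<partial>M)"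
  proof (rule integral_cong_AE)
    show "AE \<omega> in M. ?u (X (q + h) \<omega>) = ?u (Z \<omega> + D \<omega>)"
      using eqn[of q "q + h"] q h by (auto simp: Z_def D_def ac_simps)
  qed measurable
  \<comment> \<open>Averaging over the Brownian increment is \<open>heat h\<close>, and the two heat
    times add up to h + \<tau> = t - q.\<close>
  have 2: "(\<integral>\<omega>. ?u (Z \<omega>) \<partial>M) = (\<integral>\<omega>. heat (t - q) f (X q \<omega>) \<partial>M)"
    using incr_indep[OF q _ u, of "q + h"] h heat_semigroup[OF h(1) \<tau>(2) f] by (simp add: Z_def \<tau>_def)
  define R1 where "R1 = (\<lambda>\<omega>. ?u (Z \<omega> + D \<omega>) - ?u (Z \<omega>) - ?G (Z \<omega>) \<bullet> D \<omega>)"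
  have R1: "\<bar>R1 \<omega>\<bar> \<le> heat_const * B * (K * h)\<^sup>2 / \<delta>" if "\<omega> \<in> space M" for \<omega>
  proof -
    have "\<bar>R1 \<omega>\<bar> \<le> heat_const * B * (norm (D \<omega>))\<^sup>2 / \<tau>"
      unfolding R1_def by (rule heat_taylor[OF \<tau>(2) f])
    also have "\<dots> \<le> heat_const * B * (K * h)\<^sup>2 / \<delta>"
      using Dn[OF that] B \<tau> \<delta>(1) by (intro frac_le mult_left_mono power_mono mult_nonneg_nonneg) auto
    finally show ?thesis .
  qed
  have gb: "\<bar>\<beta> s \<omega> \<bullet> ?G y\<bar> \<le> K * (heat_const * B / sqrt \<delta>)" for s \<omega> y
    using gen_integrand_bound[OF f \<delta>(1), of "s + \<tau>" s \<omega> y] \<tau> by simp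
  have mH: "(\<lambda>(s, \<omega>). \<beta> s \<omega> \<bullet> ?G (Z \<omega>)) \<in> borel_measurable (borel \<Otimes>\<^sub>M M)"
  proof -
    note [measurable] = drift_meas
    have "(\<lambda>p. (\<lambda>(s, \<omega>). \<beta> s \<omega>) p \<bullet> ?G (Z (snd p))) \<in> borel_measurable (borel \<Otimes>\<^sub>M M)" by measurable
    then show ?thesis by (simp add: case_prod_beta')
  qed
  note F1 = Fubini_Ioc[OF mH, of q "q + h" "K * (heat_const * B / sqrt \<delta>)", OF gb]
  have gb2: "\<bar>\<beta> s \<omega> \<bullet> heat_grad (t - s) f (X s \<omega>)\<bar> \<le> K * (heat_const * B / sqrt \<delta>)" if "s \<in> {q<..q + h}" for s \<omega>
    using gen_integrand_bound[OF f \<delta>(1), of t s \<omega>] that \<delta> by simp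
  note F2 = Fubini_Ioc[OF gen_integrand_measurable[OF bounded_borelD(1)[OF f], where t=t], OF gb2]
  \<comment> \<open>The inner product moves inside the time integral, so that after Fubini it can be
    compared with \<open>gen_term\<close> at each single s.\<close>
  have GD: "?G (Z \<omega>) \<bullet> D \<omega> = (LINT s:{q<..q + h}|lborel. \<beta> s \<omega> \<bullet> ?G (Z \<omega>))" if "\<omega> \<in> space M" for \<omega>
  proof -
    have "integrable lborel (\<lambda>s. indicat_real {q<..q + h} s *\<^sub>R \<beta> s \<omega>)"
      using drift_integral_bound(1)[of q "q + h" \<omega>] that h by (simp add: set_integrable_def)
    then have "(\<integral>s. (indicat_real {q<..q + h} s *\<^sub>R \<beta> s \<omega>) \<bullet> ?G (Z \<omega>) \<partial>lborel) = D \<omega> \<bullet> ?G (Z \<omega>)"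
      unfolding D_def set_lebesgue_integral_def by (intro integral_inner_left)
    then show ?thesis
      unfolding set_lebesgue_integral_def by (simp add: inner_commute)
  qed
  have iGD: "integrable M (\<lambda>\<omega>. ?G (Z \<omega>) \<bullet> D \<omega>)"
  proof -
    have "integrable M (\<lambda>\<omega>. LINT s:{q<..q + h}|lborel. \<beta> s \<omega> \<bullet> ?G (Z \<omega>))" using F1(3) h by simp
    moreover have "integrable M (\<lambda>\<omega>. ?G (Z \<omega>) \<bullet> D \<omega>)
        \<longleftrightarrow> integrable M (\<lambda>\<omega>. LINT s:{q<..q + h}|lborel. \<beta> s \<omega> \<bullet> ?G (Z \<omega>))"
      by (rule Bochner_Integration.integrable_cong[OF refl GD])
    ultimately show ?thesis by blast
  qed
  have iu: "integrable M (\<lambda>\<omega>. ?u (Z \<omega> + D \<omega>))" "integrable M (\<lambda>\<omega>. ?u (Z \<omega>))"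
    by (rule integrable_bounded_borel[OF u], measurable)
       (rule integrable_bounded_borel[OF u], measurable)
  have iR1: "integrable M R1"
    unfolding R1_def by (intro Bochner_Integration.integrable_diff iGD iu)
  have eR1: "\<bar>\<integral>\<omega>. R1 \<omega> \<partial>M\<bar> \<le> heat_const * B * (K * h)\<^sup>2 / \<delta>"
  proof -
    have "\<bar>\<integral>\<omega>. R1 \<omega> \<partial>M\<bar> \<le> (\<integral>\<omega>. \<bar>R1 \<omega>\<bar> \<partial>M)" by (rule integral_abs_bound)
    also have "\<dots> \<le> (\<integral>\<omega>. heat_const * B * (K * h)\<^sup>2 / \<delta> \<partial>M)"
      using iR1 R1 by (intro integral_mono) auto
    finally show ?thesis using prob_space by simp
  qed
  have dif: "\<bar>(\<integral>\<omega>. \<beta> s \<omega> \<bullet> ?G (Z \<omega>) \<partial>M) - gen_term t f s\<bar> \<le> K * (L * (m + K) + L * m) * sqrt h"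
    if s: "s \<in> {q<..q + h}" for s
  proof -
    define V where "V = (\<lambda>\<omega>. norm (W (q + h) \<omega> - W s \<omega>))"
    have V: "integrable M V" "(\<integral>\<omega>. V \<omega> \<partial>M) \<le> m * sqrt h"
    proof -
      have "integrable M V \<and> (\<integral>\<omega>. V \<omega> \<partial>M) \<le> m * sqrt h"
      \<comment> \<open>At the right endpoint V is 0; \<open>incr_norm\<close> asks for a proper
        interval.\<close>
      proof (cases "s = q + h")
        case False
        have "m * sqrt (q + h - s) \<le> m * sqrt h" using s m by (intro mult_left_mono) auto
        moreover have "integrable M V" "(\<integral>\<omega>. V \<omega> \<partial>M) \<le> m * sqrt (q + h - s)"
          using incr_norm[of s "q + h"] s q False unfolding V_def m_def by auto
        ultimately show ?thesis by linarith
      qed (use m h in \<open>simp add: V_def\<close>)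
      then show "integrable M V" "(\<integral>\<omega>. V \<omega> \<partial>M) \<le> m * sqrt h" by auto
    qed
    let ?H = "\<lambda>\<omega>. \<beta> s \<omega> \<bullet> ?G (Z \<omega>) - \<beta> s \<omega> \<bullet> heat_grad (t - s) f (X s \<omega>)"
    let ?R = "\<lambda>\<omega>. K * (L * (V \<omega> + K * h) + L * (m * sqrt h))"
    have [measurable]: "heat_grad (t - s) f \<in> borel_measurable borel"
      using measurable_compose[OF _ heat_grad_measurable[OF bounded_borelD(1)[OF f]], of "\<lambda>x. (t - s, x)" borel] by simp
    have ts: "\<delta> \<le> t - s" and sq: "q < s" using s \<delta> by auto
    have i1: "integrable M (\<lambda>\<omega>. \<beta> s \<omega> \<bullet> ?G (Z \<omega>))"
      by (rule integrable_const_bound[of _ "K * (heat_const * B / sqrt \<delta>)"], rule AE_I2, simp only: real_norm_def gb, measurable)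
    have i2: "integrable M (\<lambda>\<omega>. \<beta> s \<omega> \<bullet> heat_grad (t - s) f (X s \<omega>))"
      by (rule integrable_const_bound[of _ "K * (heat_const * B / sqrt \<delta>)"], rule AE_I2,
          simp only: real_norm_def gen_integrand_bound[OF f \<delta>(1) ts], measurable)
    have ae: "AE \<omega> in M. \<bar>?H \<omega>\<bar> \<le> ?R \<omega>"
      using eqn[OF q sq] AE_space
    proof eventually_elim
      case (elim \<omega>)
      have e: "Z \<omega> - X s \<omega> = (W (q + h) \<omega> - W s \<omega>) - (LINT r:{q<..s}|lborel. \<beta> r \<omega>)"
        using elim s unfolding Z_def by simp
      have "norm (LINT r:{q<..s}|lborel. \<beta> r \<omega>) \<le> K * (s - q)"
        using drift_integral_bound(2)[of q s \<omega>] elim s by simp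
      also have "\<dots> \<le> K * h" using s K by (intro mult_left_mono) auto
      finally have n: "norm (Z \<omega> - X s \<omega>) \<le> V \<omega> + K * h"
        unfolding e V_def using norm_triangle_ineq4[of "W (q + h) \<omega> - W s \<omega>" "LINT r:{q<..s}|lborel. \<beta> r \<omega>"] by linarith
      have eq: "\<tau> + (q + h - s) = t - s" by (simp add: \<tau>_def)
      have "0 \<le> q + h - s" "q + h - s \<le> h" using s by auto
      from tim[OF this, of "Z \<omega>"] have "norm (?G (Z \<omega>) - heat_grad (t - s) f (Z \<omega>)) \<le> L * (m * sqrt h)"
        unfolding eq .
      then have "norm (?G (Z \<omega>) - heat_grad (t - s) f (X s \<omega>))
        \<le> norm (heat_grad (t - s) f (Z \<omega>) - heat_grad (t - s) f (X s \<omega>)) + L * (m * sqrt h)"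
        using dist_triangle[of "?G (Z \<omega>)" "heat_grad (t - s) f (X s \<omega>)" "heat_grad (t - s) f (Z \<omega>)"]
        unfolding dist_norm by linarith
      also have "\<dots> \<le> L * (V \<omega> + K * h) + L * (m * sqrt h)"
        using lip[OF ts, of "Z \<omega>" "X s \<omega>"] mult_left_mono[OF n L] by linarith
      finally have "norm (?G (Z \<omega>) - heat_grad (t - s) f (X s \<omega>)) \<le> L * (V \<omega> + K * h) + L * (m * sqrt h)" .
      then have "norm (\<beta> s \<omega>) * norm (?G (Z \<omega>) - heat_grad (t - s) f (X s \<omega>)) \<le> ?R \<omega>"
        using drift_bound K by (intro mult_mono) auto
      then show ?case
        using Cauchy_Schwarz_ineq2[of "\<beta> s \<omega>" "?G (Z \<omega>) - heat_grad (t - s) f (X s \<omega>)"]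
        by (simp add: inner_diff_right)
    qed
    have "(\<integral>\<omega>. \<beta> s \<omega> \<bullet> ?G (Z \<omega>) \<partial>M) - gen_term t f s = (\<integral>\<omega>. ?H \<omega> \<partial>M)"
      unfolding gen_term_def by (rule Bochner_Integration.integral_diff[OF i1 i2, symmetric])
    also have "\<bar>\<dots>\<bar> \<le> (\<integral>\<omega>. \<bar>?H \<omega>\<bar> \<partial>M)" by (rule integral_abs_bound)
    also have "\<dots> \<le> (\<integral>\<omega>. ?R \<omega> \<partial>M)"
      by (intro integral_mono_AE integrable_abs Bochner_Integration.integrable_diff i1 i2 ae
          integrable_mult_right Bochner_Integration.integrable_add V(1)) simp_all
    also have "\<dots> = K * (L * ((\<integral>\<omega>. V \<omega> \<partial>M) + K * h) + L * (m * sqrt h))"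
      using V(1) prob_space by simp
    also have "\<dots> \<le> K * (L * (m * sqrt h + K * sqrt h) + L * (m * sqrt h))"
      using V(2) sh K L m by (intro mult_left_mono add_mono) auto
    finally show ?thesis by (simp add: algebra_simps)
  qed
  have S1: "set_integrable lborel {q<..q + h} (\<lambda>s. \<integral>\<omega>. \<beta> s \<omega> \<bullet> ?G (Z \<omega>) \<partial>M)" by (rule F1(2)) (use h in simp)
  have S2: "set_integrable lborel {q<..q + h} (gen_term t f)"
    unfolding gen_term_def by (rule F2(2)) (use h in simp_all)
  have "(\<integral>\<omega>. ?u (X (q + h) \<omega>) \<partial>M) - (\<integral>\<omega>. heat (t - q) f (X q \<omega>) \<partial>M)
      = (\<integral>\<omega>. R1 \<omega> \<partial>M) + (\<integral>\<omega>. ?G (Z \<omega>) \<bullet> D \<omega> \<partial>M)"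
  proof -
    have "(\<integral>\<omega>. R1 \<omega> \<partial>M) = (\<integral>\<omega>. ?u (Z \<omega> + D \<omega>) \<partial>M) - (\<integral>\<omega>. ?u (Z \<omega>) \<partial>M) - (\<integral>\<omega>. ?G (Z \<omega>) \<bullet> D \<omega> \<partial>M)"
      unfolding R1_def Bochner_Integration.integral_diff[OF Bochner_Integration.integrable_diff[OF iu] iGD]
        Bochner_Integration.integral_diff[OF iu] by (rule refl)
    then show ?thesis using 1 2 by linarith
  qed
  also have "(\<integral>\<omega>. ?G (Z \<omega>) \<bullet> D \<omega> \<partial>M) = (LINT s:{q<..q + h}|lborel. \<integral>\<omega>. \<beta> s \<omega> \<bullet> ?G (Z \<omega>) \<partial>M)"
  proof -
    have "(\<integral>\<omega>. ?G (Z \<omega>) \<bullet> D \<omega> \<partial>M) = (\<integral>\<omega>. (LINT s:{q<..q + h}|lborel. \<beta> s \<omega> \<bullet> ?G (Z \<omega>)) \<partial>M)"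
      by (rule Bochner_Integration.integral_cong[OF refl GD])
    also have "\<dots> = (LINT s:{q<..q + h}|lborel. \<integral>\<omega>. \<beta> s \<omega> \<bullet> ?G (Z \<omega>) \<partial>M)"
      using F1(1) h by simp
    finally show ?thesis .
  qed
  finally have "(\<integral>\<omega>. ?u (X (q + h) \<omega>) \<partial>M) - (\<integral>\<omega>. heat (t - q) f (X q \<omega>) \<partial>M)
      - (LINT s:{q<..q + h}|lborel. gen_term t f s)
    = (\<integral>\<omega>. R1 \<omega> \<partial>M) + (LINT s:{q<..q + h}|lborel. ((\<integral>\<omega>. \<beta> s \<omega> \<bullet> ?G (Z \<omega>) \<partial>M) - gen_term t f s))"
    unfolding set_integral_diff(2)[OF S1 S2] by linarith
  moreover have "\<bar>LINT s:{q<..q + h}|lborel. ((\<integral>\<omega>. \<beta> s \<omega> \<bullet> ?G (Z \<omega>) \<partial>M) - gen_term t f s)\<bar>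
      \<le> K * (L * (m + K) + L * m) * sqrt h * h"
  proof -
    have [measurable]: "(\<lambda>s. \<integral>\<omega>. \<beta> s \<omega> \<bullet> ?G (Z \<omega>) \<partial>M) \<in> borel_measurable borel"
      using borel_measurable_lebesgue_integral[OF mH] by simp
    have [measurable]: "gen_term t f \<in> borel_measurable borel"
      using borel_measurable_lebesgue_integral[OF gen_integrand_measurable[OF bounded_borelD(1)[OF f]]]
      unfolding gen_term_def by simp
    have mm: "(\<lambda>s. (\<integral>\<omega>. \<beta> s \<omega> \<bullet> ?G (Z \<omega>) \<partial>M) - gen_term t f s) \<in> borel_measurable borel"
      by measurable
    have "norm (LINT s:{q<..q + h}|lborel. ((\<integral>\<omega>. \<beta> s \<omega> \<bullet> ?G (Z \<omega>) \<partial>M) - gen_term t f s))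
      \<le> K * (L * (m + K) + L * m) * sqrt h * (q + h - q)"
    proof (rule set_integral_Ioc_bound(2)[OF mm])
      show "norm ((\<integral>\<omega>. \<beta> s \<omega> \<bullet> ?G (Z \<omega>) \<partial>M) - gen_term t f s) \<le> K * (L * (m + K) + L * m) * sqrt h"
        if "s \<in> {q<..q + h}" for s using dif[OF that] unfolding real_norm_def .
    qed (use h in linarith)
    then show ?thesis unfolding real_norm_def add_diff_cancel_left' .
  qed
  moreover have "heat_const * B * (K * h)\<^sup>2 / \<delta> \<le> heat_const * B * K\<^sup>2 / \<delta> * (h * sqrt h)"
  proof -
    have "h * h \<le> h * sqrt h" using sh h by (intro mult_left_mono) auto
    then have "heat_const * B * K\<^sup>2 / \<delta> * (h * h) \<le> heat_const * B * K\<^sup>2 / \<delta> * (h * sqrt h)"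
      by (rule mult_left_mono) (use B \<delta>(1) in simp)
    then show ?thesis by (simp add: power2_eq_square ac_simps)
  qed
  moreover have "(A + E) * h * sqrt h = A * (h * sqrt h) + E * sqrt h * h" for A E :: real
    by (simp add: algebra_simps)
  note this[of "heat_const * B * K\<^sup>2 / \<delta>" "K * (L * (m + K) + L * m)"]
  ultimately show ?thesis using eR1 unfolding \<tau>_def by linarith
qed

lemma gen_term_integrable:
  assumes "bounded_borel B f" "0 \<le> a" "a \<le> c" "c < t"
  shows "set_integrable lborel {a<..c} (gen_term t f)"
proof -
  have "\<bar>\<beta> s \<omega> \<bullet> heat_grad (t - s) f (X s \<omega>)\<bar> \<le> K * (heat_const * B / sqrt (t - c))" if "s \<in> {a<..c}" for s \<omega>
    using gen_integrand_bound[OF assms(1), of "t - c" t s \<omega>] that assms by simp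
  from Fubini_Ioc(2)[OF gen_integrand_measurable[OF bounded_borelD(1)[OF assms(1)], where t=t] this assms(3)]
  show ?thesis unfolding gen_term_def .
qed

text \<open>Let \<Phi> be the left side minus the time integral, as a function of the upper limit.
  Its increments are of order h sqrt h by \<open>generator_step\<close>, so it is constant. On
  [a, c] all heat times are at least t - c, whence one constant serves for all steps.\<close>

theorem duhamel:
  assumes f: "bounded_borel B f" and "0 \<le> a" "a \<le> c" "c < t"
  shows "(\<integral>\<omega>. heat (t - c) f (X c \<omega>) \<partial>M)
    = (\<integral>\<omega>. heat (t - a) f (X a \<omega>) \<partial>M) + (LINT s:{a<..c}|lborel. gen_term t f s)"
proof -
  define \<Phi> where "\<Phi> c = (\<integral>\<omega>. heat (t - c) f (X c \<omega>) \<partial>M) - (LINT s:{a<..c}|lborel. gen_term t f s)" for c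
  define L where "L = 2 * heat_const\<^sup>2 * B / (t - c)"
  define m where "m = real DIM('a) * (2 * exp 2)"
  have "\<Phi> c = \<Phi> a"
  proof (rule holder_three_halves_constant[OF assms(3)])
    fix s s' assume s: "a \<le> s" "s < s'" "s' \<le> c" "s' - s \<le> 1"
    have "{a<..s'} = {a<..s} \<union> {s<..s'}" using s by auto
    then have split: "(LINT r:{a<..s'}|lborel. gen_term t f r)
        = (LINT r:{a<..s}|lborel. gen_term t f r) + (LINT r:{s<..s'}|lborel. gen_term t f r)"
      using s assms gen_term_integrable[OF f, of a s t] gen_term_integrable[OF f, of s s' t]
      by (simp add: set_integral_Un disjoint_iff)
    have e: "s + (s' - s) = s'" by simp
    have "\<Phi> s' - \<Phi> s = (\<integral>\<omega>. heat (t - s') f (X s' \<omega>) \<partial>M) - (\<integral>\<omega>. heat (t - s) f (X s \<omega>) \<partial>M)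
      - (LINT r:{s<..s'}|lborel. gen_term t f r)"
      unfolding \<Phi>_def split by linarith
    then show "\<bar>\<Phi> s' - \<Phi> s\<bar> \<le> (heat_const * B * K\<^sup>2 / (t - c) + K * (L * (m + K) + L * m)) * (s' - s) * sqrt (s' - s)"
      using generator_step[OF f, of s "s' - s" "t - c" t, unfolded e] s assms unfolding L_def m_def by simp
  qed
  then show ?thesis by (simp add: \<Phi>_def set_lebesgue_integral_def)
qed

text \<open>\<open>duhamel\<close> has to stop before t, where the gradient is singular. The mean of
  \<open>heat (\<delta> n) f\<close> at time t - \<delta> n is the mean of f at a point Z that
  already contains the remaining Brownian increment; so Z differs from X_t only by a drift integral
  of size K \<delta> n.\<close>

lemma terminal_limit:
  assumes f: "bounded_borel B f" "continuous_on UNIV f" and t: "t > 0"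
    and \<delta>: "\<And>n. 0 < \<delta> n" "\<And>n. \<delta> n \<le> t" "\<delta> \<longlonglongrightarrow> 0"
  shows "(\<lambda>n. \<integral>\<omega>. heat (\<delta> n) f (X (t - \<delta> n) \<omega>) \<partial>M) \<longlonglongrightarrow> (\<integral>\<omega>. f (X t \<omega>) \<partial>M)"
proof -
  note [measurable] = bounded_borelD(1)[OF f(1)]
  let ?s = "\<lambda>n. t - \<delta> n"
  define Z where "Z n \<omega> = X (?s n) \<omega> + (W t \<omega> - W (?s n) \<omega>)" for n \<omega>
  have [measurable]: "W t \<in> borel_measurable M" "\<And>n. W (?s n) \<in> borel_measurable M" using t \<delta> by auto
  have [measurable]: "Z n \<in> borel_measurable M" for n unfolding Z_def by measurable
  have e: "(\<integral>\<omega>. heat (\<delta> n) f (X (?s n) \<omega>) \<partial>M) = (\<integral>\<omega>. f (Z n \<omega>) \<partial>M)" for n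
    using incr_indep[OF _ _ f(1), of "?s n" t] \<delta>(1)[of n] \<delta>(2)[of n] by (simp add: Z_def)
  have all: "AE \<omega> in M. \<forall>n. X t \<omega> = X (?s n) \<omega> + (LINT r:{?s n<..t}|lborel. \<beta> r \<omega>) + (W t \<omega> - W (?s n) \<omega>)"
    unfolding AE_all_countable using eqn \<delta> by auto
  have "AE \<omega> in M. (\<lambda>n. f (Z n \<omega>)) \<longlonglongrightarrow> f (X t \<omega>)"
    using all AE_space
  proof eventually_elim
    case (elim \<omega>)
    have b: "norm (Z n \<omega> - X t \<omega>) \<le> K * \<delta> n" for n
    proof -
      have "Z n \<omega> - X t \<omega> = - (LINT r:{?s n<..t}|lborel. \<beta> r \<omega>)"
        using elim(1)[rule_format, of n] unfolding Z_def by (simp add: algebra_simps)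
      then show ?thesis using drift_integral_bound(2)[of "?s n" t \<omega>] elim(2) \<delta>(1)[of n] by simp
    qed
    have "(\<lambda>n. Z n \<omega> - X t \<omega>) \<longlonglongrightarrow> 0"
      by (rule Lim_null_comparison[OF _ tendsto_mult_right_zero[OF \<delta>(3), of K]])
         (intro always_eventually allI b)
    then have "(\<lambda>n. Z n \<omega>) \<longlonglongrightarrow> X t \<omega>" by (rule LIM_zero_cancel)
    then show ?case by (rule continuous_on_tendsto_compose[OF f(2)]) auto
  qed
  moreover have "(\<lambda>\<omega>. f (X t \<omega>)) \<in> borel_measurable M" "\<And>n. (\<lambda>\<omega>. f (Z n \<omega>)) \<in> borel_measurable M"
    by measurable
  ultimately have "(\<lambda>n. \<integral>\<omega>. f (Z n \<omega>) \<partial>M) \<longlonglongrightarrow> (\<integral>\<omega>. f (X t \<omega>) \<partial>M)"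
    by (intro integral_dominated_convergence[where w="\<lambda>_. B"])
       (simp_all add: bounded_borelD(2)[OF f(1)])
  then show ?thesis by (simp add: e)
qed

end

section \<open>Finite differences\<close>

definition dif :: "(nat \<Rightarrow> 'b::ab_group_add) \<Rightarrow> nat \<Rightarrow> 'b" where
  "dif a n = a (Suc n) - a n"

lemma dif_pow_Suc: "(dif ^^ Suc m) a n = (dif ^^ m) a (Suc n) - (dif ^^ m) a n"
  by (simp add: dif_def)

lemma dif_pow_Suc': "(dif ^^ Suc m) a n = (dif ^^ m) (\<lambda>j. a (Suc j) - a j) n"
  unfolding funpow_Suc_right comp_def dif_def[abs_def] ..

lemma dif_pow_shift: "(dif ^^ m) (\<lambda>j. a (Suc j)) n = (dif ^^ m) a (Suc n)"
  by (induction m arbitrary: n) (simp_all add: dif_def)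

lemma dif_pow_diff: "(dif ^^ m) (\<lambda>j. a j - c j) n = (dif ^^ m) a n - (dif ^^ m) c n"
  by (induction m arbitrary: n) (simp_all add: dif_def)

lemma dif_pow_add: "(dif ^^ m) (\<lambda>j. a j + c j) n = (dif ^^ m) a n + (dif ^^ m) c n"
  by (induction m arbitrary: n) (simp_all add: dif_def)

lemma dif_pow_sum: "(dif ^^ m) (\<lambda>j. \<Sum>i\<in>I. a i j) n = (\<Sum>i\<in>I. (dif ^^ m) (a i) n)"
  by (induction m arbitrary: n) (simp_all add: dif_def sum_subtractf)

lemma dif_pow_mult: "(dif ^^ m) (\<lambda>j. c * a j) n = c * (dif ^^ m) a n" for c :: "'a::ring"
  by (induction m arbitrary: n) (simp_all add: dif_def right_diff_distrib)

text \<open>With z = -1 this gives the factor (-2)^m on which \<open>char_function_decay\<close>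
  rests.\<close>

lemma dif_pow_power: "(dif ^^ m) (\<lambda>j. z ^ j) n = z ^ n * (z - 1) ^ m" for z :: "'a::comm_ring_1"
  by (induction m arbitrary: n) (simp_all add: dif_def algebra_simps)

lemma dif_pow_Re: "(dif ^^ m) (\<lambda>j. Re (a j)) n = Re ((dif ^^ m) a n)"
  and dif_pow_Im: "(dif ^^ m) (\<lambda>j. Im (a j)) n = Im ((dif ^^ m) a n)"
  by (induction m arbitrary: n) (simp_all add: dif_def)

lemma dif_pow_bound:
  fixes a :: "nat \<Rightarrow> real"
  assumes "\<And>j. \<bar>a j\<bar> \<le> C"
  shows "\<bar>(dif ^^ m) a n\<bar> \<le> 2 ^ m * C"
proof (induction m arbitrary: n)
  case (Suc m)
  show ?case using Suc[of n] Suc[of "Suc n"] unfolding dif_pow_Suc by simp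
qed (use assms in simp)

lemma dif_pow_measurable:
  fixes F :: "nat \<Rightarrow> 'b \<Rightarrow> real"
  assumes "\<And>j. F j \<in> borel_measurable N"
  shows "(\<lambda>y. (dif ^^ m) (\<lambda>j. F j y) n) \<in> borel_measurable N"
  by (induction m arbitrary: n) (use assms in \<open>auto simp: dif_def\<close>)

lemma dif_pow_continuous:
  fixes F :: "nat \<Rightarrow> 'b::topological_space \<Rightarrow> real"
  assumes "\<And>j. continuous_on S (F j)"
  shows "continuous_on S (\<lambda>y. (dif ^^ m) (\<lambda>j. F j y) n)"
  by (induction m arbitrary: n) (use assms in \<open>auto simp: dif_def intro!: continuous_on_diff\<close>)

lemma dif_pow_integral:
  fixes F :: "nat \<Rightarrow> 'b \<Rightarrow> real"
  assumes "\<And>j. integrable N (F j)"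
  shows "integrable N (\<lambda>y. (dif ^^ m) (\<lambda>j. F j y) n)"
    and "(dif ^^ m) (\<lambda>j. \<integral>y. F j y \<partial>N) n = (\<integral>y. (dif ^^ m) (\<lambda>j. F j y) n \<partial>N)"
proof -
  have "integrable N (\<lambda>y. (dif ^^ m) (\<lambda>j. F j y) n)
    \<and> (dif ^^ m) (\<lambda>j. \<integral>y. F j y \<partial>N) n = (\<integral>y. (dif ^^ m) (\<lambda>j. F j y) n \<partial>N)"
    by (induction m arbitrary: n) (use assms in \<open>auto simp: dif_def\<close>)
  then show "integrable N (\<lambda>y. (dif ^^ m) (\<lambda>j. F j y) n)"
    "(dif ^^ m) (\<lambda>j. \<integral>y. F j y \<partial>N) n = (\<integral>y. (dif ^^ m) (\<lambda>j. F j y) n \<partial>N)" by auto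
qed

lemma dif_pow_set_integral:
  fixes F :: "nat \<Rightarrow> 'b \<Rightarrow> real"
  assumes "\<And>j. set_integrable N S (F j)"
  shows "set_integrable N S (\<lambda>y. (dif ^^ m) (\<lambda>j. F j y) n)"
    and "(dif ^^ m) (\<lambda>j. LINT y:S|N. F j y) n = (LINT y:S|N. (dif ^^ m) (\<lambda>j. F j y) n)"
  using dif_pow_integral[of N "\<lambda>j y. indicator S y * F j y" m n] assms
  by (simp_all add: set_integrable_def set_lebesgue_integral_def dif_pow_mult)

text \<open>Writing \<open>S\<^sub>i\<close> for the shift in the \<open>i\<close>-th index and \<open>\<Delta>\<^sub>i = S\<^sub>i - 1\<close>, the diagonal shift satisfies
  \<open>S\<^sub>1 S\<^sub>2 S\<^sub>3 - 1 = \<Delta>\<^sub>1 S\<^sub>2 S\<^sub>3 + \<Delta>\<^sub>2 S\<^sub>3 + \<Delta>\<^sub>3\<close>.\<close>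

lemma dif_pow_diagonal_bound:
  fixes T :: "nat \<Rightarrow> nat \<Rightarrow> nat \<Rightarrow> real"
  assumes "\<And>a b c i j k. a + b + c = m \<Longrightarrow>
    \<bar>(dif ^^ a) (\<lambda>i. (dif ^^ b) (\<lambda>j. (dif ^^ c) (\<lambda>k. T i j k) k) j) i\<bar> \<le> C"
  shows "\<bar>(dif ^^ m) (\<lambda>j. T j j j) n\<bar> \<le> 3 ^ m * C"
  using assms
proof (induction m arbitrary: T n)
  case 0
  then show ?case by simp
next
  case (Suc m)
  define U1 where "U1 = (\<lambda>i j k. T (Suc i) (Suc j) (Suc k) - T i (Suc j) (Suc k))"
  define U2 where "U2 = (\<lambda>i j k. T i (Suc j) (Suc k) - T i j (Suc k))"
  define U3 where "U3 = (\<lambda>i j k. T i j (Suc k) - T i j k)"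
  have 1: "\<bar>(dif ^^ m) (\<lambda>j. U1 j j j) n\<bar> \<le> 3 ^ m * C"
  proof (rule Suc.IH[where T=U1])
    fix a b c i j k assume "a + b + c = m"
    then have abc: "Suc a + b + c = Suc m" by simp
    \<comment> \<open>The unit shifts in the other two slots only move base points, over which the
      hypothesis quantifies.\<close>
    have "(dif ^^ a) (\<lambda>i. (dif ^^ b) (\<lambda>j. (dif ^^ c) (\<lambda>k. U1 i j k) k) j) i
        = (dif ^^ Suc a) (\<lambda>i. (dif ^^ b) (\<lambda>j. (dif ^^ c) (\<lambda>k. T i j k) (Suc k)) (Suc j)) i"
      unfolding U1_def dif_pow_Suc' dif_pow_diff dif_pow_shift[of c "T _ _"]
        dif_pow_shift[of b "\<lambda>j. (dif ^^ c) (T _ j) (Suc k)"] ..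
    then show "\<bar>(dif ^^ a) (\<lambda>i. (dif ^^ b) (\<lambda>j. (dif ^^ c) (\<lambda>k. U1 i j k) k) j) i\<bar> \<le> C"
      using Suc.prems[OF abc] by simp
  qed
  have 2: "\<bar>(dif ^^ m) (\<lambda>j. U2 j j j) n\<bar> \<le> 3 ^ m * C"
  proof (rule Suc.IH[where T=U2])
    fix a b c i j k assume "a + b + c = m"
    then have abc: "a + Suc b + c = Suc m" by simp
    have "(dif ^^ a) (\<lambda>i. (dif ^^ b) (\<lambda>j. (dif ^^ c) (\<lambda>k. U2 i j k) k) j) i
        = (dif ^^ a) (\<lambda>i. (dif ^^ Suc b) (\<lambda>j. (dif ^^ c) (\<lambda>k. T i j k) (Suc k)) j) i"
      unfolding U2_def dif_pow_Suc' dif_pow_diff dif_pow_shift[of c "T _ _"] ..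
    then show "\<bar>(dif ^^ a) (\<lambda>i. (dif ^^ b) (\<lambda>j. (dif ^^ c) (\<lambda>k. U2 i j k) k) j) i\<bar> \<le> C"
      using Suc.prems[OF abc] by simp
  qed
  have 3: "\<bar>(dif ^^ m) (\<lambda>j. U3 j j j) n\<bar> \<le> 3 ^ m * C"
  proof (rule Suc.IH[where T=U3])
    fix a b c i j k assume "a + b + c = m"
    then have abc: "a + b + Suc c = Suc m" by simp
    have "(dif ^^ a) (\<lambda>i. (dif ^^ b) (\<lambda>j. (dif ^^ c) (\<lambda>k. U3 i j k) k) j) i
        = (dif ^^ a) (\<lambda>i. (dif ^^ b) (\<lambda>j. (dif ^^ Suc c) (\<lambda>k. T i j k) k) j) i"
      unfolding U3_def dif_pow_Suc' ..
    then show "\<bar>(dif ^^ a) (\<lambda>i. (dif ^^ b) (\<lambda>j. (dif ^^ c) (\<lambda>k. U3 i j k) k) j) i\<bar> \<le> C"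
      using Suc.prems[OF abc] by simp
  qed
  have "(dif ^^ Suc m) (\<lambda>j. T j j j) n = (dif ^^ m) (\<lambda>j. U1 j j j + U2 j j j + U3 j j j) n"
    unfolding dif_pow_Suc' by (simp add: U1_def U2_def U3_def)
  also have "\<dots> = (dif ^^ m) (\<lambda>j. U1 j j j) n + (dif ^^ m) (\<lambda>j. U2 j j j) n + (dif ^^ m) (\<lambda>j. U3 j j j) n"
    by (simp add: dif_pow_add)
  finally show ?case using 1 2 3 by simp
qed

section \<open>Differences of the heat kernel under translations\<close>

lemma heat_pow_bounded:
  fixes f :: "'a::euclidean_space \<Rightarrow> real"
  assumes "\<sigma> > 0" "bounded_borel B f"
  shows "bounded_borel B ((heat \<sigma> ^^ a) f)"
  by (induction a) (use assms heat_bounded in auto)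

text \<open>One factor stays outside the power so that a = 0 is covered: \<open>heat 0\<close> is
  the zero operator, not the identity.\<close>

lemma heat_grad_pow:
  fixes f :: "'a::euclidean_space \<Rightarrow> real"
  assumes "\<sigma> > 0" "bounded_borel B f"
  shows "heat \<sigma> ((heat \<sigma> ^^ a) f) = heat (real (Suc a) * \<sigma>) f"
    and "heat_grad \<sigma> ((heat \<sigma> ^^ a) f) = heat_grad (real (Suc a) * \<sigma>) f"
proof -
  show 1: "heat \<sigma> ((heat \<sigma> ^^ a) f) = heat (real (Suc a) * \<sigma>) f" for a
  proof (induction a)
    case (Suc a)
    have "heat \<sigma> ((heat \<sigma> ^^ Suc a) f) = heat \<sigma> (heat (real (Suc a) * \<sigma>) f)" using Suc by simp
    also have "\<dots> = heat (\<sigma> + real (Suc a) * \<sigma>) f" using assms by (intro heat_semigroup) auto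
    finally show ?case by (simp add: algebra_simps)
  qed simp
  show "heat_grad \<sigma> ((heat \<sigma> ^^ a) f) = heat_grad (real (Suc a) * \<sigma>) f"
  proof (cases a)
    case (Suc n)
    have "heat_grad \<sigma> ((heat \<sigma> ^^ a) f) = heat_grad \<sigma> (heat (real (Suc n) * \<sigma>) f)" using 1[of n] Suc by simp
    also have "\<dots> = heat_grad (\<sigma> + real (Suc n) * \<sigma>) f" using assms by (intro heat_grad_semigroup) auto
    finally show ?thesis by (simp add: algebra_simps Suc)
  qed simp
qed

abbreviation sdif :: "nat \<Rightarrow> 'a::euclidean_space \<Rightarrow> ('a \<Rightarrow> real) \<Rightarrow> nat \<Rightarrow> 'a \<Rightarrow> real" where
  "sdif a h f n x \<equiv> (dif ^^ a) (\<lambda>j. f (x - real j *\<^sub>R h)) n"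

lemma sdif_measurable:
  assumes [measurable]: "f \<in> borel_measurable borel"
  shows "sdif a h f n \<in> borel_measurable borel"
  by (rule dif_pow_measurable) measurable

lemma sdif_Suc_index: "sdif a h f (Suc n) x = sdif a h f n (x - h)"
proof -
  have "(\<lambda>j. f (x - real (Suc j) *\<^sub>R h)) = (\<lambda>j. f (x - h - real j *\<^sub>R h))"
    by (simp add: algebra_simps)
  then show ?thesis using dif_pow_shift[of a "\<lambda>j. f (x - real j *\<^sub>R h)" n] by simp
qed

lemma sdif_bounded_borel:
  assumes "bounded_borel B f"
  shows "bounded_borel (2 ^ a * B) (sdif a h f n)"
  unfolding bounded_borel_def
  by (intro conjI allI sdif_measurable bounded_borelD(1)[OF assms] dif_pow_bound bounded_borelD(2)[OF assms])

text \<open>\<open>heat\<close> and its gradient are integrals of translates of f, so differences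
  along translations pass under the integral.\<close>

lemma sdif_heat:
  fixes f :: "'a::euclidean_space \<Rightarrow> real"
  assumes "\<sigma> > 0" "bounded_borel B f"
  shows "sdif a h (heat \<sigma> f) n x = heat \<sigma> (sdif a h f n) x"
    and "(dif ^^ a) (\<lambda>j. heat_grad \<sigma> f (x - real j *\<^sub>R h) \<bullet> i) n = heat_grad \<sigma> (sdif a h f n) x \<bullet> i"
proof -
  have e: "x - real j *\<^sub>R h + w = x + w - real j *\<^sub>R h" for j w by simp
  show "sdif a h (heat \<sigma> f) n x = heat \<sigma> (sdif a h f n) x"
    unfolding heat_def by (subst dif_pow_integral(2), rule heat_integrable[OF assms], simp only: e)
  have "(dif ^^ a) (\<lambda>j. heat_grad \<sigma> f (x - real j *\<^sub>R h) \<bullet> i) n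
      = (\<integral>w. (dif ^^ a) (\<lambda>j. f (x - real j *\<^sub>R h + w) * ((i \<bullet> w) / \<sigma>)) n \<partial>gauss \<sigma>)"
    unfolding heat_grad_inner[OF assms]
    by (intro dif_pow_integral(2) gauss_integrable_bounded[OF assms] integrable_divide gauss_linear_integrable(1) assms(1))
  also have "\<dots> = (\<integral>w. sdif a h f n (x + w) * ((i \<bullet> w) / \<sigma>) \<partial>gauss \<sigma>)"
  proof (rule Bochner_Integration.integral_cong[OF refl])
    fix w
    show "(dif ^^ a) (\<lambda>j. f (x - real j *\<^sub>R h + w) * ((i \<bullet> w) / \<sigma>)) n = sdif a h f n (x + w) * ((i \<bullet> w) / \<sigma>)"
      unfolding e using dif_pow_mult[of a "(i \<bullet> w) / \<sigma>" "\<lambda>j. f (x + w - real j *\<^sub>R h)" n]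
      by (simp only: mult.commute)
  qed
  also have "\<dots> = heat_grad \<sigma> (sdif a h f n) x \<bullet> i"
    using heat_grad_inner[OF assms(1) sdif_bounded_borel[OF assms(2)]] by simp
  finally show "(dif ^^ a) (\<lambda>j. heat_grad \<sigma> f (x - real j *\<^sub>R h) \<bullet> i) n = heat_grad \<sigma> (sdif a h f n) x \<bullet> i" .
qed

text \<open>Each of the \<open>a\<close> heat semigroup factors absorbs one difference.\<close>

lemma sdif_heat_pow_bound:
  fixes f :: "'a::euclidean_space \<Rightarrow> real"
  assumes "\<sigma> > 0" "bounded_borel B f"
  shows "bounded_borel ((heat_const * norm h / sqrt \<sigma>) ^ a * B) (sdif a h ((heat \<sigma> ^^ a) f) n)"
proof (induction a arbitrary: n)
  case 0
  have "bounded_borel B (\<lambda>x. f (x + (- (real n *\<^sub>R h))))" by (rule bounded_borel_shift[OF assms(2)])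
  then show ?case by simp
next
  case (Suc a)
  let ?F = "(heat \<sigma> ^^ a) f" let ?k = "heat_const * norm h / sqrt \<sigma>"
  have F: "bounded_borel B ?F" by (rule heat_pow_bounded[OF assms])
  have "\<bar>sdif (Suc a) h (heat \<sigma> ?F) n x\<bar> \<le> ?k ^ Suc a * B" for x
  proof -
    have "sdif (Suc a) h (heat \<sigma> ?F) n x = heat \<sigma> (sdif a h ?F n) (x + (- h)) - heat \<sigma> (sdif a h ?F n) x"
      unfolding dif_pow_Suc unfolding sdif_Suc_index unfolding sdif_heat(1)[OF assms(1) F] by simp
    also have "\<bar>\<dots>\<bar> \<le> heat_const * (?k ^ a * B) * norm (- h) / sqrt \<sigma>"
      by (rule heat_lipschitz[OF assms(1) Suc])
    finally show ?thesis by (simp add: ac_simps)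
  qed
  moreover have "sdif (Suc a) h (heat \<sigma> ?F) n \<in> borel_measurable borel"
    by (rule sdif_measurable[OF bounded_borelD(1)[OF heat_bounded[OF assms(1) F]]])
  ultimately show ?case by (simp add: bounded_borel_def del: funpow.simps(2)) (simp add: comp_def)
qed

lemma heat_const_ge_1: "1 \<le> heat_const"
  unfolding heat_const_def using exp_ge_add_one_self[of 2] by linarith

text \<open>The time r is cut into a + 1 equal pieces \<sigma>. In the scale sqrt \<sigma> of a
  piece the translation r v has size of order sqrt r norm v, which stays bounded as r tends to 0;
  this is why the shift is proportional to the time lag. A gradient over one piece still costs a
  multiple of 1 / sqrt r.\<close>

lemma kernel_scale:
  assumes "0 < r" "r \<le> 1" and s: "\<sigma> = r / real (Suc a)"
  shows "heat_const * norm (r *\<^sub>R v) / sqrt \<sigma> \<le> heat_const * real (Suc a) * norm v"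
    and "1 / sqrt \<sigma> \<le> real (Suc a) / sqrt r"
proof -
  have "sqrt (real (Suc a)) \<le> real (Suc a)" by (intro real_le_lsqrt) (auto simp: power2_eq_square)
  then have "sqrt (real (Suc a)) / sqrt r \<le> real (Suc a) / sqrt r" using assms by (intro divide_right_mono) auto
  then show 1: "1 / sqrt \<sigma> \<le> real (Suc a) / sqrt r" by (simp add: s real_sqrt_divide del: of_nat_Suc)
  have "heat_const * norm (r *\<^sub>R v) / sqrt \<sigma> = heat_const * norm v * (r * (1 / sqrt \<sigma>))"
    using assms by simp
  also have "\<dots> \<le> heat_const * norm v * (r * (real (Suc a) / sqrt r))"
    using 1 assms(1) by (intro mult_left_mono) auto
  also have "r * (real (Suc a) / sqrt r) = real (Suc a) * sqrt r"
    using assms(1) real_div_sqrt[of r] by (simp add: field_simps)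
  also have "heat_const * norm v * (real (Suc a) * sqrt r) \<le> heat_const * norm v * (real (Suc a) * 1)"
    using assms(2) by (intro mult_left_mono) auto
  finally show "heat_const * norm (r *\<^sub>R v) / sqrt \<sigma> \<le> heat_const * real (Suc a) * norm v"
    by (simp add: ac_simps)
qed

lemma sdif_heat_bound:
  fixes f :: "'a::euclidean_space \<Rightarrow> real"
  assumes "0 < r" "r \<le> 1" "bounded_borel B f"
  shows "\<bar>sdif a (r *\<^sub>R v) (heat r f) n x\<bar> \<le> (heat_const * real (Suc a) * norm v) ^ a * B"
proof -
  define \<sigma> where "\<sigma> = r / real (Suc a)"
  have \<sigma>: "\<sigma> > 0" "real (Suc a) * \<sigma> = r" using assms(1) by (auto simp: \<sigma>_def simp del: of_nat_Suc)
  let ?F = "(heat \<sigma> ^^ a) f"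
  have "sdif a (r *\<^sub>R v) (heat r f) n x = heat \<sigma> (sdif a (r *\<^sub>R v) ?F n) x"
    unfolding \<sigma>(2)[symmetric] heat_grad_pow(1)[OF \<sigma>(1) assms(3), symmetric]
    by (rule sdif_heat(1)[OF \<sigma>(1) heat_pow_bounded[OF \<sigma>(1) assms(3)]])
  also have "\<bar>\<dots>\<bar> \<le> (heat_const * norm (r *\<^sub>R v) / sqrt \<sigma>) ^ a * B"
    by (rule bounded_borelD(2)[OF heat_bounded[OF \<sigma>(1) sdif_heat_pow_bound[OF \<sigma>(1) assms(3)]]])
  also have "\<dots> \<le> (heat_const * real (Suc a) * norm v) ^ a * B"
    using kernel_scale(1)[OF assms(1,2) \<sigma>_def] \<sigma>(1) assms(1) bounded_borelD(3)[OF assms(3)]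
    by (intro mult_right_mono power_mono) (auto simp del: of_nat_Suc)
  finally show ?thesis .
qed

text \<open>Of the a + 1 pieces of r, a absorb one difference each and the last takes the gradient.
  Hence the singularity is 1 / sqrt r for every a.\<close>

lemma sdif_heat_grad_bound:
  fixes f :: "'a::euclidean_space \<Rightarrow> real"
  assumes "0 < r" "r \<le> 1" "bounded_borel B f" "norm i = 1"
  shows "\<bar>(dif ^^ a) (\<lambda>j. heat_grad r f (x - real j *\<^sub>R r *\<^sub>R v) \<bullet> i) n\<bar>
    \<le> (heat_const * real (Suc a)) ^ Suc a * norm v ^ a * B / sqrt r"
proof -
  define \<sigma> where "\<sigma> = r / real (Suc a)"
  have \<sigma>: "\<sigma> > 0" "real (Suc a) * \<sigma> = r" using assms(1) by (auto simp: \<sigma>_def simp del: of_nat_Suc)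
  note B = bounded_borelD(3)[OF assms(3)]
  let ?F = "(heat \<sigma> ^^ a) f"
  let ?c = "heat_const * norm (r *\<^sub>R v) / sqrt \<sigma>" and ?d = "heat_const * real (Suc a) * norm v"
  have c0: "0 \<le> ?c" using \<sigma>(1) assms(1) by auto
  have "(dif ^^ a) (\<lambda>j. heat_grad r f (x - real j *\<^sub>R r *\<^sub>R v) \<bullet> i) n = heat_grad \<sigma> (sdif a (r *\<^sub>R v) ?F n) x \<bullet> i"
    unfolding \<sigma>(2)[symmetric] heat_grad_pow(2)[OF \<sigma>(1) assms(3), symmetric]
    by (rule sdif_heat(2)[OF \<sigma>(1) heat_pow_bounded[OF \<sigma>(1) assms(3)]])
  also have "\<bar>\<dots>\<bar> \<le> norm (heat_grad \<sigma> (sdif a (r *\<^sub>R v) ?F n) x)"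
    using Cauchy_Schwarz_ineq2[of _ i] assms(4) by (metis mult.right_neutral)
  also have "\<dots> \<le> heat_const * (?c ^ a * B) / sqrt \<sigma>"
    by (rule heat_grad_bound[OF \<sigma>(1) sdif_heat_pow_bound[OF \<sigma>(1) assms(3)]])
  also have "\<dots> = heat_const * (?c ^ a * B) * (1 / sqrt \<sigma>)" by simp
  also have "\<dots> \<le> heat_const * (?d ^ a * B) * (real (Suc a) / sqrt r)"
    using kernel_scale[OF assms(1,2) \<sigma>_def] \<sigma>(1) assms(1) B c0
    by (intro mult_mono mult_left_mono mult_right_mono power_mono) (auto simp del: of_nat_Suc)
  also have "\<dots> = (heat_const * real (Suc a)) ^ Suc a * norm v ^ a * B / sqrt r"
    by (simp add: power_mult_distrib ac_simps del: of_nat_Suc)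
  finally show ?thesis .
qed

text \<open>The majorant has the primitive -2 k sqrt (t - s). The bound does not depend on c, which
  is later sent to t.\<close>

lemma set_integral_sqrt_bound:
  fixes h :: "real \<Rightarrow> real"
  assumes "a \<le> c" "c < t" "0 \<le> k" "set_integrable lborel {a<..c} h"
    and "\<And>s. s \<in> {a<..c} \<Longrightarrow> \<bar>h s\<bar> \<le> k / sqrt (t - s)"
  shows "\<bar>LINT s:{a<..c}|lborel. h s\<bar> \<le> 2 * k * sqrt (t - a)"
proof -
  have der: "((\<lambda>s. - 2 * k * sqrt (t - s)) has_real_derivative k / sqrt (t - x)) (at x)" if "a \<le> x" "x \<le> c" for x
    using that assms(2) by (auto intro!: derivative_eq_intros simp: field_simps)
  have cont: "isCont (\<lambda>s. k / sqrt (t - s)) x" if "a \<le> x" "x \<le> c" for x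
    using that assms(2) by (intro continuous_intros) auto
  let ?g = "\<lambda>s. k / sqrt (t - s) * indicat_real {a..c} s"
  have g: "integrable lborel ?g" "(\<integral>s. ?g s \<partial>lborel) = - 2 * k * sqrt (t - c) - (- 2 * k * sqrt (t - a))"
    using has_bochner_integral_FTC_Icc_real[OF assms(1) der cont] by (auto simp: has_bochner_integral_iff)
  have "\<bar>LINT s:{a<..c}|lborel. h s\<bar> \<le> (\<integral>s. \<bar>indicat_real {a<..c} s *\<^sub>R h s\<bar> \<partial>lborel)"
    unfolding set_lebesgue_integral_def by (rule integral_abs_bound)
  also have "\<dots> \<le> (\<integral>s. ?g s \<partial>lborel)"
    using assms(4) g(1) assms(5,3,2)
    by (intro integral_mono) (auto simp: set_integrable_def indicator_def)
  also have "\<dots> \<le> 2 * k * sqrt (t - a)"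
    using g(2) assms(2,3) by simp
  finally show ?thesis .
qed

section \<open>Difference bounds for McKean--Vlasov processes\<close>

lemma dif_pow_tendsto:
  fixes a :: "'c \<Rightarrow> nat \<Rightarrow> real"
  assumes "\<And>j. ((\<lambda>k. a k j) \<longlongrightarrow> l j) F"
  shows "((\<lambda>k. (dif ^^ m) (a k) n) \<longlongrightarrow> (dif ^^ m) l n) F"
  by (induction m arbitrary: n) (use assms in \<open>auto simp: dif_def intro!: tendsto_diff\<close>)

lemma (in prob_space) abs_expectation_bound:
  fixes f :: "'a \<Rightarrow> real"
  assumes "\<And>\<omega>. \<bar>f \<omega>\<bar> \<le> C"
  shows "\<bar>\<integral>\<omega>. f \<omega> \<partial>M\<bar> \<le> C"
proof (cases "integrable M f")
  case True
  have "\<bar>\<integral>\<omega>. f \<omega> \<partial>M\<bar> \<le> (\<integral>\<omega>. \<bar>f \<omega>\<bar> \<partial>M)" by (rule integral_abs_bound)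
  also have "\<dots> \<le> (\<integral>\<omega>. C \<partial>M)" using True assms by (intro integral_mono) auto
  finally show ?thesis using prob_space by simp
next
  case False
  \<comment> \<open>The Bochner integral of a non-integrable function is 0, and C \<ge> 0 because it
    bounds an absolute value.\<close>
  then show ?thesis using assms[of undefined] by (simp add: not_integrable_integral_eq)
qed

lemma heat_grad_continuous:
  fixes f :: "'a::euclidean_space \<Rightarrow> real"
  assumes "\<tau> > 0" "bounded_borel B f"
  shows "continuous_on UNIV (heat_grad \<tau> f)"
proof -
  have "(2 * heat_const\<^sup>2 * B / \<tau>)-lipschitz_on UNIV (heat_grad \<tau> f)"
    using heat_grad_lipschitz[OF assms] assms bounded_borelD(3)[OF assms(2)]
    by (intro lipschitz_onI) (auto simp: dist_norm)
  then show ?thesis by (rule lipschitz_on_continuous_on)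
qed

lemma heat_shift_minus: "heat \<tau> (\<lambda>x. f (x - a)) x = heat \<tau> f (x - a)"
  and heat_grad_shift_minus: "heat_grad \<tau> (\<lambda>x. f (x - a)) x = heat_grad \<tau> f (x - a)"
  using heat_shift[of \<tau> f "- a" x] heat_grad_shift[of \<tau> f "- a" x] by simp_all

text \<open>In \<open>drift_eq\<close> the law of X_s is represented by an independent copy:
  \<omega>' runs over the same probability space.\<close>

locale mv_process = drifted_process M X W \<beta> K
  for M :: "'w measure" and X W \<beta> :: "real \<Rightarrow> 'w \<Rightarrow> 'a::euclidean_space" and K :: real +
  fixes b :: "real \<Rightarrow> 'a \<Rightarrow> 'a"
  assumes b_cont: "\<And>s. continuous_on UNIV (b s)"
    and b_bound: "\<And>s x. norm (b s x) \<le> K"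
    and drift_eq: "\<And>s \<omega>. \<beta> s \<omega> = (\<integral>\<omega>'. b s (X s \<omega> - X s \<omega>') \<partial>M)"
begin

text \<open>The law of X_{s+q} - j q v in weak form. The shift is proportional to the age q, hence
  absent at q = 0, where the law of X_s may be arbitrarily rough.\<close>

definition shift_mean :: "'a \<Rightarrow> real \<Rightarrow> real \<Rightarrow> ('a \<Rightarrow> real) \<Rightarrow> nat \<Rightarrow> real" where
  "shift_mean v s q f j = (\<integral>\<omega>. f (X (s + q) \<omega> - (real j * q) *\<^sub>R v) \<partial>M)"

lemma b_measurable [measurable]: "b s \<in> borel_measurable borel"
  by (rule borel_measurable_continuous_onI[OF b_cont])

lemma shift_mean_bound:
  "bounded_borel C f \<Longrightarrow> \<bar>shift_mean v s q f j\<bar> \<le> C"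
  unfolding shift_mean_def by (rule abs_expectation_bound) (rule bounded_borelD(2))

text \<open>Homogeneity in the test function, which reduces all bounds to the unit ball over which a
  supremum can be taken.\<close>

lemma shift_mean_scale:
  assumes D: "0 \<le> D" "\<And>f. bounded_borel 1 f \<Longrightarrow> continuous_on UNIV f \<Longrightarrow> \<bar>(dif ^^ k) (shift_mean v s q f) n\<bar> \<le> D"
    and g: "bounded_borel C g" "continuous_on UNIV g"
  shows "\<bar>(dif ^^ k) (shift_mean v s q g) n\<bar> \<le> C * D"
proof (cases "C = 0")
  case True
  then show ?thesis using dif_pow_bound[of "shift_mean v s q g" 0 k n] shift_mean_bound[OF g(1)] by simp
next
  case False
  then have C: "C > 0" using bounded_borelD(3)[OF g(1)] by simp
  let ?f = "\<lambda>x. 1 / C * g x"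
  have [measurable]: "g \<in> borel_measurable borel" by (rule bounded_borelD(1)[OF g(1)])
  have "bounded_borel 1 ?f"
    using g C bounded_borelD(2)[OF g(1)] unfolding bounded_borel_def
    by (auto simp: abs_mult divide_le_eq)
  moreover have "continuous_on UNIV ?f" using g by (intro continuous_on_mult continuous_on_const)
  ultimately have "\<bar>(dif ^^ k) (shift_mean v s q ?f) n\<bar> \<le> D" by (rule D(2))
  moreover have "shift_mean v s q g = (\<lambda>j. C * shift_mean v s q ?f j)"
    using C by (simp add: shift_mean_def fun_eq_iff)
  then have "(dif ^^ k) (shift_mean v s q g) n = C * (dif ^^ k) (shift_mean v s q ?f) n"
    by (simp only: dif_pow_mult)
  ultimately show ?thesis using C by (simp add: abs_mult)
qed

text \<open>The three places where j enters the Duhamel integrand at time s + q, made independent: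
  the law of X, the kernel over the lag \<tau>, and the law of the copy inside the drift. For equal
  indices the shifts of X and of its copy cancel in b.\<close>

definition trilinear :: "'a \<Rightarrow> real \<Rightarrow> real \<Rightarrow> real \<Rightarrow> ('a \<Rightarrow> real) \<Rightarrow> 'a \<Rightarrow> nat \<Rightarrow> nat \<Rightarrow> nat \<Rightarrow> real" where
  "trilinear v s q \<tau> f i j\<^sub>x j\<^sub>g j\<^sub>y =
    (\<integral>\<omega>. shift_mean v s q (\<lambda>y. b (s + q) (X (s + q) \<omega> - (real j\<^sub>x * q) *\<^sub>R v - y) \<bullet> i) j\<^sub>y
       * (heat_grad \<tau> f (X (s + q) \<omega> - (real j\<^sub>x * q) *\<^sub>R v - real j\<^sub>g *\<^sub>R \<tau> *\<^sub>R v) \<bullet> i) \<partial>M)"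

lemma kernel_bounded_borel:
  "i \<in> Basis \<Longrightarrow> bounded_borel K (\<lambda>y. b s (x - y) \<bullet> i)"
  unfolding bounded_borel_def using order_trans[OF Basis_le_norm b_bound] by (auto intro!: measurable_compose[OF _ b_measurable])

lemma kernel_continuous: "continuous_on UNIV (\<lambda>y. b s (x - y) \<bullet> i)"
  by (intro continuous_on_inner continuous_on_compose2[OF b_cont] continuous_intros) auto

text \<open>Ensures that \<open>H\<close> in \<open>trilinear_dif_bound\<close> is again a
  continuous test function; K dominates.\<close>

lemma shift_mean_kernel_continuous:
  assumes "i \<in> Basis"
  shows "continuous_on UNIV (\<lambda>x. shift_mean v s q (\<lambda>y. b r (x - y) \<bullet> i) j)"
  unfolding continuous_on_sequentially comp_def
proof (intro allI ballI impI, elim conjE)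
  fix u :: "nat \<Rightarrow> 'a" and x :: 'a assume u: "u \<longlonglongrightarrow> x"
  let ?Y = "\<lambda>\<omega>. X (s + q) \<omega> - (real j * q) *\<^sub>R v"
  show "(\<lambda>n. shift_mean v s q (\<lambda>y. b r (u n - y) \<bullet> i) j) \<longlonglongrightarrow> shift_mean v s q (\<lambda>y. b r (x - y) \<bullet> i) j"
    unfolding shift_mean_def
  proof (rule integral_dominated_convergence[where w="\<lambda>_. K"])
    show "AE \<omega> in M. (\<lambda>n. b r (u n - ?Y \<omega>) \<bullet> i) \<longlonglongrightarrow> b r (x - ?Y \<omega>) \<bullet> i"
      by (intro AE_I2 tendsto_inner tendsto_const continuous_on_tendsto_compose[OF b_cont] tendsto_diff u) auto
    show "AE \<omega> in M. norm (b r (u n - ?Y \<omega>) \<bullet> i) \<le> K" for n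
      using bounded_borelD(2)[OF kernel_bounded_borel[OF assms]] by simp
  qed auto
qed

text \<open>The differences are taken from the inside out. Those of the copy turn the drift into a
  function \<open>H\<close>, those of the kernel turn the gradient into \<open>g\<close>. The
  product of \<open>H\<close> and \<open>g\<close> is again a bounded continuous test function, so
  the remaining differences fall on a shift mean, and the three bounds multiply.\<close>

lemma trilinear_dif_bound:
  assumes \<tau>: "0 < \<tau>" "\<tau> \<le> 1" and f: "bounded_borel 1 f" and i: "i \<in> Basis"
    and Dc: "0 \<le> Dc" "\<And>g C n. bounded_borel C g \<Longrightarrow> continuous_on UNIV g \<Longrightarrow> \<bar>(dif ^^ c) (shift_mean v s q g) n\<bar> \<le> C * Dc"
    and Db: "\<And>g C n. bounded_borel C g \<Longrightarrow> continuous_on UNIV g \<Longrightarrow> \<bar>(dif ^^ a) (shift_mean v s q g) n\<bar> \<le> C * Da"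
  shows "\<bar>(dif ^^ a) (\<lambda>jx. (dif ^^ b') (\<lambda>jg. (dif ^^ c) (\<lambda>jy. trilinear v s q \<tau> f i jx jg jy) ny) ng) nx\<bar>
    \<le> K * Dc * ((heat_const * real (Suc b')) ^ Suc b' * norm v ^ b' / sqrt \<tau>) * Da"
proof -
  define P where "P jy x = shift_mean v s q (\<lambda>y. b (s + q) (x - y) \<bullet> i) jy" for jy x
  define G where "G jg x = heat_grad \<tau> f (x - real jg *\<^sub>R \<tau> *\<^sub>R v) \<bullet> i" for jg x
  define H where "H x = (dif ^^ c) (\<lambda>jy. P jy x) ny" for x
  define g where "g x = (dif ^^ b') (\<lambda>jg. G jg x) ng" for x
  define Y where "Y jx \<omega> = X (s + q) \<omega> - (real jx * q) *\<^sub>R v" for jx \<omega>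
  have [measurable]: "Y jx \<in> borel_measurable M" for jx unfolding Y_def by measurable
  have tri: "trilinear v s q \<tau> f i jx jg jy = (\<integral>\<omega>. P jy (Y jx \<omega>) * G jg (Y jx \<omega>) \<partial>M)" for jx jg jy
    by (simp add: trilinear_def P_def G_def Y_def)
  have Pc: "continuous_on UNIV (P jy)" for jy
    unfolding P_def by (rule shift_mean_kernel_continuous[OF i])
  have Gc: "continuous_on UNIV (G jg)" for jg
    unfolding G_def by (intro continuous_on_inner continuous_on_compose2[OF heat_grad_continuous[OF \<tau>(1) f]] continuous_intros) auto
  have Pb: "\<bar>P jy x\<bar> \<le> K" for jy x
    unfolding P_def by (rule shift_mean_bound[OF kernel_bounded_borel[OF i]])
  have Gb: "\<bar>G jg x\<bar> \<le> heat_const / sqrt \<tau>" for jg x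
    unfolding G_def using order_trans[OF Basis_le_norm[OF i] heat_grad_bound[OF \<tau>(1) f]] by simp
  have Hc: "continuous_on UNIV H" unfolding H_def by (intro dif_pow_continuous Pc)
  have gc: "continuous_on UNIV g" unfolding g_def by (intro dif_pow_continuous Gc)
  note [measurable] = borel_measurable_continuous_onI[OF Pc] borel_measurable_continuous_onI[OF Gc]
    borel_measurable_continuous_onI[OF Hc] borel_measurable_continuous_onI[OF gc]
  let ?L = "(heat_const * real (Suc b')) ^ Suc b' * norm v ^ b' / sqrt \<tau>"
  have Hb: "\<bar>H x\<bar> \<le> K * Dc" for x
    unfolding H_def P_def by (rule Dc(2)[OF kernel_bounded_borel[OF i] kernel_continuous])
  have gb: "\<bar>g x\<bar> \<le> ?L" for x
    unfolding g_def G_def using sdif_heat_grad_bound[OF \<tau> f, of i b' x v ng] i by simp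
  have iPG: "integrable M (\<lambda>\<omega>. P jy (Y jx \<omega>) * G jg (Y jx \<omega>))" for jx jg jy
  proof (rule integrable_const_bound[OF AE_I2])
    show "norm (P jy (Y jx \<omega>) * G jg (Y jx \<omega>)) \<le> K * (heat_const / sqrt \<tau>)" for \<omega>
      unfolding real_norm_def abs_mult by (intro mult_mono Pb Gb K_nonneg abs_ge_zero)
  qed measurable
  have iHG: "integrable M (\<lambda>\<omega>. H (Y jx \<omega>) * G jg (Y jx \<omega>))" for jx jg
  proof (rule integrable_const_bound[OF AE_I2])
    show "norm (H (Y jx \<omega>) * G jg (Y jx \<omega>)) \<le> (K * Dc) * (heat_const / sqrt \<tau>)" for \<omega>
      unfolding real_norm_def abs_mult by (intro mult_mono Hb Gb mult_nonneg_nonneg K_nonneg Dc(1) abs_ge_zero)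
  qed measurable
  have 1: "(dif ^^ c) (\<lambda>jy. trilinear v s q \<tau> f i jx jg jy) ny = (\<integral>\<omega>. H (Y jx \<omega>) * G jg (Y jx \<omega>) \<partial>M)" for jx jg
  proof -
    have "(dif ^^ c) (\<lambda>jy. trilinear v s q \<tau> f i jx jg jy) ny
        = (\<integral>\<omega>. (dif ^^ c) (\<lambda>jy. P jy (Y jx \<omega>) * G jg (Y jx \<omega>)) ny \<partial>M)"
      unfolding tri by (rule dif_pow_integral(2)[OF iPG])
    then show ?thesis unfolding H_def
      using dif_pow_mult[of c "G jg (Y jx _)" "\<lambda>jy. P jy (Y jx _)" ny] by (simp only: mult.commute)
  qed
  have 2: "(dif ^^ b') (\<lambda>jg. \<integral>\<omega>. H (Y jx \<omega>) * G jg (Y jx \<omega>) \<partial>M) ng = shift_mean v s q (\<lambda>x. H x * g x) jx" for jx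
    unfolding dif_pow_integral(2)[OF iHG] unfolding dif_pow_mult shift_mean_def g_def Y_def ..
  have "bounded_borel (K * Dc * ?L) (\<lambda>x. H x * g x)"
    unfolding bounded_borel_def abs_mult
    by (intro conjI allI mult_mono Hb gb mult_nonneg_nonneg K_nonneg Dc(1) abs_ge_zero) measurable
  moreover have "continuous_on UNIV (\<lambda>x. H x * g x)" by (intro continuous_on_mult Hc gc)
  ultimately have "\<bar>(dif ^^ a) (shift_mean v s q (\<lambda>x. H x * g x)) nx\<bar> \<le> K * Dc * ?L * Da" by (rule Db)
  then show ?thesis unfolding 1 2 .
qed

text \<open>The shift j (q + \<tau>) v of the test function splits into j q v, attached to X_{s+q},
  and j \<tau> v, left to the kernel. Since b sees only the difference of X and its copy, the first
  part may be given to the copy as well.\<close>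

lemma gen_term_trilinear:
  assumes \<tau>: "0 < \<tau>" and f: "bounded_borel B f"
  shows "gen_term (s + q + \<tau>) (\<lambda>x. f (x - (real j * (q + \<tau>)) *\<^sub>R v)) (s + q)
    = (\<Sum>i\<in>Basis. trilinear v s q \<tau> f i j j j)"
proof -
  let ?r = "q + \<tau>" and ?s = "s + q"
  let ?G = "\<lambda>\<omega>. heat_grad \<tau> f (X ?s \<omega> - (real j * ?r) *\<^sub>R v)"
  have ib: "integrable M (\<lambda>\<omega>'. b ?s (X ?s \<omega> - X ?s \<omega>'))" for \<omega>
    by (rule integrable_const_bound[of _ K]) (auto simp: b_bound)
  have tri: "trilinear v s q \<tau> f i j j j = (\<integral>\<omega>. (\<beta> ?s \<omega> \<bullet> i) * (?G \<omega> \<bullet> i) \<partial>M)" for i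
    unfolding trilinear_def
  proof (rule Bochner_Integration.integral_cong[OF refl])
    fix \<omega>
    have "shift_mean v s q (\<lambda>y. b ?s (X ?s \<omega> - (real j * q) *\<^sub>R v - y) \<bullet> i) j = (\<integral>\<omega>'. b ?s (X ?s \<omega> - X ?s \<omega>') \<bullet> i \<partial>M)"
      unfolding shift_mean_def by simp
    also have "\<dots> = \<beta> ?s \<omega> \<bullet> i" unfolding drift_eq by (rule integral_inner_left) (rule ib)
    finally have 1: "shift_mean v s q (\<lambda>y. b ?s (X ?s \<omega> - (real j * q) *\<^sub>R v - y) \<bullet> i) j = \<beta> ?s \<omega> \<bullet> i" .
    have 2: "X ?s \<omega> - (real j * q) *\<^sub>R v - real j *\<^sub>R \<tau> *\<^sub>R v = X ?s \<omega> - (real j * ?r) *\<^sub>R v"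
      by (simp add: algebra_simps)
    show "shift_mean v s q (\<lambda>y. b ?s (X ?s \<omega> - (real j * q) *\<^sub>R v - y) \<bullet> i) j
        * (heat_grad \<tau> f (X ?s \<omega> - (real j * q) *\<^sub>R v - real j *\<^sub>R \<tau> *\<^sub>R v) \<bullet> i) = (\<beta> ?s \<omega> \<bullet> i) * (?G \<omega> \<bullet> i)"
      unfolding 1 2 ..
  qed
  have [measurable]: "heat_grad \<tau> f \<in> borel_measurable borel"
    by (rule borel_measurable_continuous_onI[OF heat_grad_continuous[OF \<tau> f]])
  have int: "integrable M (\<lambda>\<omega>. (\<beta> ?s \<omega> \<bullet> i) * (?G \<omega> \<bullet> i))" if "i \<in> Basis" for i
  proof (rule integrable_const_bound[OF AE_I2])
    show "norm ((\<beta> ?s \<omega> \<bullet> i) * (?G \<omega> \<bullet> i)) \<le> K * (heat_const * B / sqrt \<tau>)" for \<omega>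
      unfolding real_norm_def abs_mult
      by (intro mult_mono order_trans[OF Basis_le_norm[OF that]] drift_bound heat_grad_bound[OF \<tau> f] K_nonneg abs_ge_zero)
  qed measurable
  have "gen_term (s + q + \<tau>) (\<lambda>x. f (x - (real j * ?r) *\<^sub>R v)) ?s = (\<integral>\<omega>. \<beta> ?s \<omega> \<bullet> ?G \<omega> \<partial>M)"
    unfolding gen_term_def heat_grad_shift_minus by simp
  also have "\<dots> = (\<Sum>i\<in>Basis. \<integral>\<omega>. (\<beta> ?s \<omega> \<bullet> i) * (?G \<omega> \<bullet> i) \<partial>M)"
    using int by (subst euclidean_inner) (rule Bochner_Integration.integral_sum)
  finally show ?thesis unfolding tri .
qed

text \<open>One Duhamel step from s to s + r for the translates f(x - j r v). The initial term
  involves only translates of \<open>heat r f\<close> by j r v and has the full order |v|^m; the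
  time integral is treated by the discrete product rule. S bounds the top order itself and reappears
  with the small factor sqrt r.\<close>

lemma shift_mean_absorb:
  assumes s: "0 \<le> s" and r: "0 < r" "r \<le> T" "T \<le> 1" and m: "0 < m"
    and f: "bounded_borel 1 f" "continuous_on UNIV f"
    and E: "1 \<le> E" and S: "0 \<le> S"
    and low: "\<And>k q g C n. k < m \<Longrightarrow> 0 \<le> q \<Longrightarrow> q \<le> T \<Longrightarrow> bounded_borel C g \<Longrightarrow> continuous_on UNIV g \<Longrightarrow>
      \<bar>(dif ^^ k) (shift_mean v s q g) n\<bar> \<le> C * (E * norm v ^ k)"
    and top: "\<And>q g C n. 0 \<le> q \<Longrightarrow> q \<le> T \<Longrightarrow> bounded_borel C g \<Longrightarrow> continuous_on UNIV g \<Longrightarrow>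
      \<bar>(dif ^^ m) (shift_mean v s q g) n\<bar> \<le> C * S"
  defines "\<kappa> \<equiv> (heat_const * real (Suc m)) ^ Suc m"
  shows "\<bar>(dif ^^ m) (shift_mean v s r f) n\<bar>
    \<le> (heat_const * real (Suc m) * norm v) ^ m
      + 2 * (real DIM('a) * (3 ^ m * (K * \<kappa> * (E\<^sup>2 * norm v ^ m + S)))) * sqrt r"
proof -
  define Q where "Q = E\<^sup>2 * norm v ^ m + S"
  have Q: "Q \<ge> 0" using S by (simp add: Q_def)
  have \<kappa>: "\<kappa> \<ge> 0" unfolding \<kappa>_def by (intro zero_le_power mult_nonneg_nonneg) auto
  \<comment> \<open>Order 0 has the trivial bound 1 rather than E, so that a product with a
    top-order factor contributes exactly S.\<close>
  define D where "D k = (if k = 0 then 1 else if k = m then S else E * norm v ^ k)" for k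
  have D0: "0 \<le> D k" for k using S E by (simp add: D_def)
  have Dle: "\<bar>(dif ^^ k) (shift_mean v s q g) n\<bar> \<le> C * D k"
    if "k \<le> m" "0 \<le> q" "q \<le> T" "bounded_borel C g" "continuous_on UNIV g" for k q g C n
    using that low[of k q C g n] top[of q C g n] shift_mean_bound[OF that(4)] by (auto simp: D_def)
  \<comment> \<open>If one law takes all m differences, the other two factors have order 0; so S
    occurs linearly and never as a square.\<close>
  have prod: "norm v ^ b' * (D c * D a) \<le> Q" if abc: "a + b' + c = m" for a b' c
  proof (cases "a = m \<or> c = m")
    case True
    then show ?thesis using abc m E by (auto simp: D_def Q_def)
  next
    case False
    then have "D a \<le> E * norm v ^ a" "D c \<le> E * norm v ^ c" using E by (auto simp: D_def)
    then have "norm v ^ b' * (D c * D a) \<le> norm v ^ b' * ((E * norm v ^ c) * (E * norm v ^ a))"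
      using D0 E by (intro mult_left_mono mult_mono) auto
    also have "\<dots> = E\<^sup>2 * norm v ^ m" by (simp add: power2_eq_square power_add abc[symmetric] ac_simps)
    finally show ?thesis using S by (simp add: Q_def)
  qed
  let ?fj = "\<lambda>j x. f (x - (real j * r) *\<^sub>R v)"
  have fj: "bounded_borel 1 (?fj j)" "continuous_on UNIV (?fj j)" for j
    using bounded_borel_shift[OF f(1), of "- ((real j * r) *\<^sub>R v)"]
    by (auto intro!: continuous_on_compose2[OF f(2)] continuous_intros)
  let ?k = "real DIM('a) * (3 ^ m * (K * \<kappa> * Q))"
  \<comment> \<open>At time u the age is q = u - s and the remaining lag \<tau> = r - q; with r = q
    + \<tau> the translates are those of \<open>gen_term_trilinear\<close>.\<close>
  have gen: "\<bar>(dif ^^ m) (\<lambda>j. gen_term (s + r) (?fj j) u) n\<bar> \<le> ?k / sqrt (s + r - u)"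
    if u: "s < u" "u < s + r" for u
  proof -
    define q where "q = u - s"
    define \<tau> where "\<tau> = r - q"
    have q: "0 \<le> q" "q \<le> T" "u = s + q" and \<tau>: "0 < \<tau>" "\<tau> \<le> 1" "r = q + \<tau>" "s + r - u = \<tau>"
      using u r by (auto simp: q_def \<tau>_def)
    have sr: "s + (q + \<tau>) = s + q + \<tau>" by simp
    have "(dif ^^ m) (\<lambda>j. gen_term (s + r) (?fj j) u) n = (\<Sum>i\<in>Basis. (dif ^^ m) (\<lambda>j. trilinear v s q \<tau> f i j j j) n)"
      unfolding \<tau>(3) q(3) sr gen_term_trilinear[OF \<tau>(1) f(1)] by (rule dif_pow_sum)
    also have "\<bar>\<dots>\<bar> \<le> (\<Sum>i\<in>(Basis::'a set). 3 ^ m * (K * \<kappa> * Q / sqrt \<tau>))"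
    proof (rule order_trans[OF sum_abs sum_mono])
      fix i :: 'a assume i: "i \<in> Basis"
      show "\<bar>(dif ^^ m) (\<lambda>j. trilinear v s q \<tau> f i j j j) n\<bar> \<le> 3 ^ m * (K * \<kappa> * Q / sqrt \<tau>)"
      proof (rule dif_pow_diagonal_bound[where T="trilinear v s q \<tau> f i"])
        fix a b' c nx ng ny assume abc: "a + b' + c = m"
        let ?\<kappa> = "(heat_const * real (Suc b')) ^ Suc b'"
        have "\<bar>(dif ^^ a) (\<lambda>jx. (dif ^^ b') (\<lambda>jg. (dif ^^ c) (\<lambda>jy. trilinear v s q \<tau> f i jx jg jy) ny) ng) nx\<bar>
            \<le> K * D c * (?\<kappa> * norm v ^ b' / sqrt \<tau>) * D a"
          using abc q by (intro trilinear_dif_bound[OF \<tau>(1,2) f(1) i D0] Dle) auto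
        also have "\<dots> = K * ?\<kappa> * (norm v ^ b' * (D c * D a)) / sqrt \<tau>" by simp
        also have "\<dots> \<le> K * \<kappa> * Q / sqrt \<tau>"
        proof (intro divide_right_mono mult_mono mult_left_mono prod abc K_nonneg)
          have "?\<kappa> \<le> (heat_const * real (Suc m)) ^ Suc b'"
            using abc by (intro power_mono mult_left_mono) auto
          also have "\<dots> \<le> \<kappa>"
            unfolding \<kappa>_def using abc heat_const_ge_1 mult_mono[of 1 heat_const 1 "real (Suc m)"]
            by (intro power_increasing) auto
          finally show "?\<kappa> \<le> \<kappa>" .
        qed (use K_nonneg \<kappa> D0 \<tau> in \<open>auto intro!: mult_nonneg_nonneg\<close>)
        finally show "\<bar>(dif ^^ a) (\<lambda>jx. (dif ^^ b') (\<lambda>jg. (dif ^^ c) (\<lambda>jy. trilinear v s q \<tau> f i jx jg jy) ny) ng) nx\<bar>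
            \<le> K * \<kappa> * Q / sqrt \<tau>" .
      qed
    qed
    also have "\<dots> = ?k / sqrt (s + r - u)" unfolding \<tau>(4) by simp
    finally show ?thesis .
  qed
  \<comment> \<open>The offset 2 keeps the truncated time s + r - \<delta> k strictly between s and
    s + r.\<close>
  define \<delta> where "\<delta> k = r / real (k + 2)" for k :: nat
  have \<delta>: "0 < \<delta> k" "\<delta> k < r" for k
  proof -
    show "0 < \<delta> k" using r(1) by (simp add: \<delta>_def)
    have "r * 1 < r * real (k + 2)" by (rule mult_strict_left_mono[OF _ r(1)]) simp
    then show "\<delta> k < r" by (simp add: \<delta>_def divide_less_eq)
  qed
  have \<delta>lim: "\<delta> \<longlonglongrightarrow> 0"
    unfolding \<delta>_def using LIMSEQ_ignore_initial_segment[OF lim_const_over_n[of r], of 2] by simp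
  let ?t = "s + r"
  let ?E = "\<lambda>k j. \<integral>\<omega>. heat (\<delta> k) (?fj j) (X (?t - \<delta> k) \<omega>) \<partial>M"
  let ?bd = "(heat_const * real (Suc m) * norm v) ^ m + 2 * ?k * sqrt r"
  \<comment> \<open>Uniform in k, because the inverse square root is integrable up to the terminal
    time.\<close>
  have bd: "\<bar>(dif ^^ m) (?E k) n\<bar> \<le> ?bd" for k
  proof -
    have "?E k = (\<lambda>j. (\<integral>\<omega>. heat r f (X s \<omega> - real j *\<^sub>R r *\<^sub>R v) \<partial>M)
        + (LINT u:{s<..?t - \<delta> k}|lborel. gen_term ?t (?fj j) u))"
    proof
      fix j
      show "?E k j = (\<integral>\<omega>. heat r f (X s \<omega> - real j *\<^sub>R r *\<^sub>R v) \<partial>M)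
        + (LINT u:{s<..?t - \<delta> k}|lborel. gen_term ?t (?fj j) u)"
        using duhamel[OF fj(1)[of j] s, of "?t - \<delta> k" ?t] \<delta>[of k] by (simp add: heat_shift_minus)
    qed
    then have e: "(dif ^^ m) (?E k) n = (dif ^^ m) (\<lambda>j. \<integral>\<omega>. heat r f (X s \<omega> - real j *\<^sub>R r *\<^sub>R v) \<partial>M) n
        + (dif ^^ m) (\<lambda>j. LINT u:{s<..?t - \<delta> k}|lborel. gen_term ?t (?fj j) u) n"
      by (simp only: dif_pow_add)
    have h: "bounded_borel 1 (heat r f)" by (rule heat_bounded[OF r(1) f(1)])
    note [measurable] = bounded_borelD(1)[OF h]
    have "(dif ^^ m) (\<lambda>j. \<integral>\<omega>. heat r f (X s \<omega> - real j *\<^sub>R r *\<^sub>R v) \<partial>M) n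
        = (\<integral>\<omega>. sdif m (r *\<^sub>R v) (heat r f) n (X s \<omega>) \<partial>M)"
      by (rule dif_pow_integral(2)) (rule integrable_bounded_borel[OF h], measurable)
    also have "\<bar>\<dots>\<bar> \<le> (heat_const * real (Suc m) * norm v) ^ m * 1"
      using r by (intro abs_expectation_bound sdif_heat_bound f(1)) auto
    finally have 1: "\<bar>(dif ^^ m) (\<lambda>j. \<integral>\<omega>. heat r f (X s \<omega> - real j *\<^sub>R r *\<^sub>R v) \<partial>M) n\<bar>
        \<le> (heat_const * real (Suc m) * norm v) ^ m" by simp
    have gi: "set_integrable lborel {s<..?t - \<delta> k} (gen_term ?t (?fj j))" for j
      using \<delta>[of k] s by (intro gen_term_integrable[OF fj(1)]) auto
    have 2: "\<bar>(dif ^^ m) (\<lambda>j. LINT u:{s<..?t - \<delta> k}|lborel. gen_term ?t (?fj j) u) n\<bar> \<le> 2 * ?k * sqrt (?t - s)"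
      unfolding dif_pow_set_integral(2)[OF gi]
    proof (rule set_integral_sqrt_bound)
      show "0 \<le> ?k" using K_nonneg \<kappa> Q by simp
      show "set_integrable lborel {s<..?t - \<delta> k} (\<lambda>u. (dif ^^ m) (\<lambda>j. gen_term ?t (?fj j) u) n)"
        by (rule dif_pow_set_integral(1)[OF gi])
      show "\<bar>(dif ^^ m) (\<lambda>j. gen_term ?t (?fj j) u) n\<bar> \<le> ?k / sqrt (?t - u)" if "u \<in> {s<..?t - \<delta> k}" for u
        using that \<delta>[of k] by (intro gen) auto
    qed (use \<delta>[of k] in auto)
    show ?thesis unfolding e using 1 2 by simp
  qed
  have "(\<lambda>k. ?E k j) \<longlonglongrightarrow> shift_mean v s r f j" for j
    unfolding shift_mean_def
  proof (rule terminal_limit[OF fj _ \<delta>(1) _ \<delta>lim])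
    show "0 < s + r" using s r by simp
    show "\<delta> n \<le> s + r" for n using \<delta>(2)[of n] s by linarith
  qed
  then have "(\<lambda>k. (dif ^^ m) (?E k) n) \<longlonglongrightarrow> (dif ^^ m) (shift_mean v s r f) n"
    by (rule dif_pow_tendsto)
  then have "(\<lambda>k. \<bar>(dif ^^ m) (?E k) n\<bar>) \<longlonglongrightarrow> \<bar>(dif ^^ m) (shift_mean v s r f) n\<bar>"
    by (rule tendsto_rabs)
  then have "\<bar>(dif ^^ m) (shift_mean v s r f) n\<bar> \<le> ?bd"
    by (rule LIMSEQ_le_const2) (use bd in auto)
  then show ?thesis unfolding Q_def .
qed

text \<open>Induction on m, absorbing the top order. The window T serves all orders up to N and is
  chosen before s and v; this uniformity lets it be placed just before any given time and lets v
  depend on the frequency.\<close>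

theorem shift_mean_dif_bound:
  assumes "0 < T0"
  obtains T where "0 < T" "T \<le> T0"
    "\<And>m. m \<le> N \<Longrightarrow> \<exists>C\<ge>1. \<forall>s v q g B n. 0 \<le> s \<longrightarrow> 0 \<le> q \<longrightarrow> q \<le> T \<longrightarrow> bounded_borel B g \<longrightarrow> continuous_on UNIV g \<longrightarrow>
      \<bar>(dif ^^ m) (shift_mean v s q g) n\<bar> \<le> B * (C * norm v ^ m)"
proof -
  define \<kappa> where "\<kappa> m = (heat_const * real (Suc m)) ^ Suc m" for m
  have \<kappa>: "0 \<le> \<kappa> m" for m unfolding \<kappa>_def by (intro zero_le_power mult_nonneg_nonneg) auto
  \<comment> \<open>A m times sqrt q is the coefficient of the top-order bound S in
    \<open>shift_mean_absorb\<close>.\<close>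
  define A where "A m = 2 * (real DIM('a) * (3 ^ m * (K * \<kappa> m)))" for m
  have A: "0 \<le> A m" for m using K_nonneg \<kappa> by (simp add: A_def)
  \<comment> \<open>With sqrt T \<le> 1 / Z each coefficient A m sqrt T is at most 1/2; the summand
    1 gives Z \<ge> 1 and hence T \<le> 1.\<close>
  define Z where "Z = 2 * (\<Sum>m\<le>N. A m) + 1"
  have Z: "1 \<le> Z" using A by (simp add: Z_def sum_nonneg)
  define T where "T = min T0 (1 / Z\<^sup>2)"
  have T: "0 < T" "T \<le> T0" "T \<le> 1 / Z\<^sup>2" using assms Z by (auto simp: T_def)
  have T1: "T \<le> 1" using T(3) Z by (auto intro: order_trans[OF T(3)] simp: divide_le_eq)
  have small: "A m * sqrt T \<le> 1 / 2" if "m \<le> N" for m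
  proof -
    have "sqrt T \<le> 1 / Z" using T(3) Z real_sqrt_le_mono[OF T(3)] by (simp add: real_sqrt_divide)
    then have "A m * sqrt T \<le> A m * (1 / Z)" using A by (intro mult_left_mono) auto
    also have "A m \<le> (\<Sum>m\<le>N. A m)" using that A by (intro member_le_sum) auto
    then have "A m * (1 / Z) \<le> 1 / 2" using Z by (simp add: Z_def divide_le_eq)
    finally show ?thesis .
  qed
  have "\<exists>C\<ge>1. \<forall>s v q g B n. 0 \<le> s \<longrightarrow> 0 \<le> q \<longrightarrow> q \<le> T \<longrightarrow> bounded_borel B g \<longrightarrow> continuous_on UNIV g \<longrightarrow>
      \<bar>(dif ^^ m) (shift_mean v s q g) n\<bar> \<le> B * (C * norm v ^ m)" if "m \<le> N" for m
    using that
  proof (induction m rule: less_induct)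
    case (less m)
    show ?case
    proof (cases "m = 0")
      case True
      then show ?thesis using shift_mean_bound by (intro exI[of _ 1]) simp
    next
      case False
      then have m: "0 < m" by simp
      have "\<forall>k\<in>{..<m}. \<exists>C\<ge>1. \<forall>s v q g B n. 0 \<le> s \<longrightarrow> 0 \<le> q \<longrightarrow> q \<le> T \<longrightarrow> bounded_borel B g \<longrightarrow>
          continuous_on UNIV g \<longrightarrow> \<bar>(dif ^^ k) (shift_mean v s q g) n\<bar> \<le> B * (C * norm v ^ k)"
        using less by auto
      then obtain c where c: "\<And>k. k < m \<Longrightarrow> 1 \<le> c k"
        "\<And>k s v q g B n. k < m \<Longrightarrow> 0 \<le> s \<Longrightarrow> 0 \<le> q \<Longrightarrow> q \<le> T \<Longrightarrow> bounded_borel B g \<Longrightarrow>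
          continuous_on UNIV g \<Longrightarrow> \<bar>(dif ^^ k) (shift_mean v s q g) n\<bar> \<le> B * (c k * norm v ^ k)"
        unfolding bchoice_iff lessThan_iff by (elim exE) blast
      define E where "E = (\<Sum>k<m. c k)"
      have cE: "c k \<le> E" if "k < m" for k
        unfolding E_def using that c(1) by (intro member_le_sum) (auto intro: order_trans[of 0 1])
      have E: "1 \<le> E" using cE[OF m] c(1)[OF m] by linarith
      \<comment> \<open>Absorbing half of the supremum doubles the remaining terms. Keeping the full
        E^2, where half of it would do, makes C \<ge> 1 evident.\<close>
      define C where "C = 2 * ((heat_const * real (Suc m)) ^ m + E\<^sup>2)"
      have C1: "1 \<le> C"
      proof -
        have "0 \<le> (heat_const * real (Suc m)) ^ m" by (intro zero_le_power mult_nonneg_nonneg) auto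
        then have "E\<^sup>2 \<le> (heat_const * real (Suc m)) ^ m + E\<^sup>2" by simp
        with one_le_power[OF E, of 2] have "1 \<le> (heat_const * real (Suc m)) ^ m + E\<^sup>2" by (rule order_trans)
        then have "1 * 1 \<le> C"
          unfolding C_def by (rule mult_mono[rotated]) auto
        then show ?thesis by simp
      qed
      have main: "\<bar>(dif ^^ m) (shift_mean v s r f) n\<bar> \<le> C * norm v ^ m"
        if s: "0 \<le> s" and r: "0 \<le> r" "r \<le> T" and f: "bounded_borel 1 f" "continuous_on UNIV f" for s v r f n
      proof -
        \<comment> \<open>Here s and v are fixed, while age, unit test function and base point vary.
          All values are at most 2^m, so the supremum is finite and may be subtracted from both
          sides.\<close>
        define U where "U = {\<bar>(dif ^^ m) (shift_mean v s q g) k\<bar> | q g k.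
          0 \<le> q \<and> q \<le> T \<and> bounded_borel 1 g \<and> continuous_on UNIV g}"
        have Ub: "bdd_above U"
          unfolding U_def bdd_above_def using dif_pow_bound[OF shift_mean_bound, of 1]
          by (intro exI[of _ "2 ^ m"]) fastforce
        define S where "S = Sup U"
        have inU: "\<bar>(dif ^^ m) (shift_mean v s q g) k\<bar> \<le> S"
          if "0 \<le> q" "q \<le> T" "bounded_borel 1 g" "continuous_on UNIV g" for q g k
          unfolding S_def using that by (intro cSup_upper[OF _ Ub]) (auto simp: U_def)
        have S0: "0 \<le> S" using order_trans[OF abs_ge_zero inU[OF r f]] .
        have "u \<le> C / 2 * norm v ^ m + S / 2" if "u \<in> U" for u
        proof -
          from that obtain q g k where u: "u = \<bar>(dif ^^ m) (shift_mean v s q g) k\<bar>"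
            and q: "0 \<le> q" "q \<le> T" and g: "bounded_borel 1 g" "continuous_on UNIV g" by (auto simp: U_def)
          show ?thesis
          \<comment> \<open>At age 0 there is no shift: the sequence in j is constant and, as m
            \<ge> 1, its differences vanish. \<open>shift_mean_absorb\<close> needs a positive
            age.\<close>
          proof (cases "q = 0")
            case True
            obtain m' where m': "m = Suc m'" using m by (cases m) auto
            have "(dif ^^ m) (shift_mean v s q g) k = 0"
              using dif_pow_bound[of "\<lambda>j. shift_mean v s q g (Suc j) - shift_mean v s q g j" 0 m' k] True
              unfolding m' dif_pow_Suc' by (simp add: shift_mean_def)
            then show ?thesis using C1 S0 by (simp add: u)
          next
            case False
            have "u \<le> (heat_const * real (Suc m) * norm v) ^ m
                + 2 * (real DIM('a) * (3 ^ m * (K * \<kappa> m * (E\<^sup>2 * norm v ^ m + S)))) * sqrt q"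
              unfolding u \<kappa>_def
            proof (rule shift_mean_absorb[OF s _ q(2) T1 m g E S0])
              show "0 < q" using q False by simp
              show "\<bar>(dif ^^ k) (shift_mean v s q g) n\<bar> \<le> B * (E * norm v ^ k)"
                if "k < m" "0 \<le> q" "q \<le> T" "bounded_borel B g" "continuous_on UNIV g" for k q g B n
                using c(2)[OF that(1) s that(2-5), of v n] cE[OF that(1)] bounded_borelD(3)[OF that(4)]
                by (elim order_trans) (intro mult_left_mono mult_right_mono, auto)
              show "\<bar>(dif ^^ m) (shift_mean v s q g) n\<bar> \<le> B * S"
                if "0 \<le> q" "q \<le> T" "bounded_borel B g" "continuous_on UNIV g" for q g B n
                by (rule shift_mean_scale[OF S0 inU that(3,4)]) (use that in auto)
            qed
            also have "\<dots> = (heat_const * real (Suc m)) ^ m * norm v ^ m + A m * sqrt q * (E\<^sup>2 * norm v ^ m + S)"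
              by (simp add: A_def power_mult_distrib ac_simps)
            also have "A m * sqrt q * (E\<^sup>2 * norm v ^ m + S) \<le> 1 / 2 * (E\<^sup>2 * norm v ^ m + S)"
            proof (rule mult_right_mono)
              have "A m * sqrt q \<le> A m * sqrt T" using q A by (intro mult_left_mono) auto
              then show "A m * sqrt q \<le> 1 / 2" using small[OF less.prems] by linarith
            qed (use S0 in simp)
            finally have "u \<le> ((heat_const * real (Suc m)) ^ m + E\<^sup>2 / 2) * norm v ^ m + S / 2"
              by (simp add: algebra_simps)
            also have "((heat_const * real (Suc m)) ^ m + E\<^sup>2 / 2) * norm v ^ m \<le> C / 2 * norm v ^ m"
              unfolding C_def by (intro mult_right_mono) auto
            finally show ?thesis by simp
          qed
        qed
        moreover have "U \<noteq> {}" using r f unfolding U_def by blast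
        ultimately have "S \<le> C / 2 * norm v ^ m + S / 2" unfolding S_def by (intro cSup_least)
        then have "S \<le> C * norm v ^ m" by simp
        then show ?thesis using inU[OF r f, of n] by linarith
      qed
      show ?thesis
      proof (intro exI[of _ C] conjI allI impI C1)
        fix s q B :: real and v :: 'a and g :: "'a \<Rightarrow> real" and n assume a: "0 \<le> s" "0 \<le> q" "q \<le> T" "bounded_borel B g" "continuous_on UNIV g"
        show "\<bar>(dif ^^ m) (shift_mean v s q g) n\<bar> \<le> B * (C * norm v ^ m)"
          by (rule shift_mean_scale[OF _ main[OF a(1-3)] a(4,5)]) (use C1 in auto)
      qed
    qed
  qed
  then show thesis using that T by blast
qed

end

section \<open>Fourier inversion\<close>

lemma cis_approx: "norm (cis a - 1 - \<i> * a) \<le> a\<^sup>2"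
proof -
  have "norm (cis a - 1 - \<i> * a) \<le> \<bar>a\<bar> ^ 2 / 2"
    using iexp_approx1[of a 1] by (simp add: cis_conv_exp algebra_simps power2_eq_square numeral_2_eq_2)
  also have "\<dots> \<le> a\<^sup>2" by simp
  finally show ?thesis .
qed

lemma cis_diff_bound: "norm (cis a - cis b) \<le> \<bar>a - b\<bar>"
proof -
  have "cis a - cis b = cis b * (cis (a - b) - 1)" by (simp add: cis_mult right_diff_distrib)
  also have "norm \<dots> = norm (cis (a - b) - 1)" by (simp add: norm_mult)
  also have "\<dots> \<le> \<bar>a - b\<bar>"
    using iexp_approx1[of "a - b" 0] by (simp add: cis_conv_exp)
  finally show ?thesis .
qed

lemma cis_measurable [measurable]: "cis \<in> borel_measurable borel"
  by (rule borel_measurable_continuous_onI) (intro continuous_intros)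

lemma abs_Re_cis_mult: "\<bar>Re (cis a * z)\<bar> \<le> norm z"
  using abs_Re_le_cmod[of "cis a * z"] by (simp only: norm_mult norm_cis mult_1_left)

text \<open>The real part makes the inverse Fourier integral a real function outright; for a
  characteristic function the integral is real anyway.\<close>

definition fourier_re :: "('a::euclidean_space \<Rightarrow> complex) \<Rightarrow> 'a \<Rightarrow> real" where
  "fourier_re g x = (\<integral>\<xi>. Re (cis (- (\<xi> \<bullet> x)) * g \<xi>) \<partial>lborel)"

definition moment :: "nat \<Rightarrow> ('a::euclidean_space \<Rightarrow> complex) \<Rightarrow> bool" where
  "moment k g \<longleftrightarrow> g \<in> borel_measurable borel \<and> integrable lborel (\<lambda>\<xi>. (1 + norm \<xi>) ^ k * norm (g \<xi>))"

lemma moment_mono: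
  assumes "moment k g" "j \<le> k"
  shows "moment j g"
proof -
  note [measurable] = assms(1)[unfolded moment_def, THEN conjunct1]
  have "integrable lborel (\<lambda>\<xi>. (1 + norm \<xi>) ^ j * norm (g \<xi>))"
    by (rule Bochner_Integration.integrable_bound[OF assms(1)[unfolded moment_def, THEN conjunct2]])
       (auto simp: abs_mult intro!: mult_right_mono power_increasing assms(2))
  then show ?thesis using assms(1) by (simp add: moment_def)
qed

lemma moment_0:
  "moment k g \<Longrightarrow> integrable lborel (\<lambda>\<xi>. norm (g \<xi>))"
  using moment_mono[of k g 0] by (simp add: moment_def)

lemma fourier_re_integrable:
  assumes "moment k g"
  shows "integrable lborel (\<lambda>\<xi>. Re (cis (- (\<xi> \<bullet> x)) * g \<xi>))"
proof -
  note [measurable] = assms(1)[unfolded moment_def, THEN conjunct1]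
  show ?thesis
    by (rule Bochner_Integration.integrable_bound[OF moment_0[OF assms]], measurable)
       (simp only: real_norm_def abs_norm_cancel abs_Re_cis_mult AE_I2)
qed

lemma fourier_re_bound:
  assumes "moment k g"
  shows "\<bar>fourier_re g x\<bar> \<le> (\<integral>\<xi>. norm (g \<xi>) \<partial>lborel)"
proof -
  have "\<bar>fourier_re g x\<bar> \<le> (\<integral>\<xi>. \<bar>Re (cis (- (\<xi> \<bullet> x)) * g \<xi>)\<bar> \<partial>lborel)"
    unfolding fourier_re_def by (rule integral_abs_bound)
  also have "\<dots> \<le> (\<integral>\<xi>. norm (g \<xi>) \<partial>lborel)"
    using fourier_re_integrable[OF assms, of x] moment_0[OF assms]
    by (intro integral_mono integrable_abs abs_Re_cis_mult)
  finally show ?thesis .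
qed

text \<open>The Fourier multiplier of the directional derivative along v.\<close>

definition fourier_deriv :: "'a::euclidean_space \<Rightarrow> ('a \<Rightarrow> complex) \<Rightarrow> 'a \<Rightarrow> complex" where
  "fourier_deriv v g \<xi> = - \<i> * complex_of_real (\<xi> \<bullet> v) * g \<xi>"

lemma fourier_deriv_bound: "norm (fourier_deriv v g \<xi>) \<le> norm v * ((1 + norm \<xi>) * norm (g \<xi>))"
proof -
  have "norm (fourier_deriv v g \<xi>) = \<bar>\<xi> \<bullet> v\<bar> * norm (g \<xi>)" by (simp add: fourier_deriv_def norm_mult)
  also have "\<dots> \<le> ((1 + norm \<xi>) * norm v) * norm (g \<xi>)"
    by (intro mult_right_mono order_trans[OF Cauchy_Schwarz_ineq2]) auto
  finally show ?thesis by (simp add: ac_simps)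
qed

lemma moment_fourier_deriv:
  assumes "moment (Suc k) g"
  shows "moment k (fourier_deriv v g)"
proof -
  note [measurable] = assms(1)[unfolded moment_def, THEN conjunct1]
  have m [measurable]: "fourier_deriv v g \<in> borel_measurable borel"
    unfolding fourier_deriv_def by measurable
  have "integrable lborel (\<lambda>\<xi>. norm v * ((1 + norm \<xi>) ^ Suc k * norm (g \<xi>)))"
    using assms by (simp add: moment_def)
  then have "integrable lborel (\<lambda>\<xi>. (1 + norm \<xi>) ^ k * norm (fourier_deriv v g \<xi>))"
  proof (rule Bochner_Integration.integrable_bound)
    show "AE \<xi> in lborel. norm ((1 + norm \<xi>) ^ k * norm (fourier_deriv v g \<xi>)) \<le> norm (norm v * ((1 + norm \<xi>) ^ Suc k * norm (g \<xi>)))"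
    proof (rule AE_I2)
      fix \<xi> :: 'a
      have "(1 + norm \<xi>) ^ k * norm (fourier_deriv v g \<xi>) \<le> (1 + norm \<xi>) ^ k * (norm v * ((1 + norm \<xi>) * norm (g \<xi>)))"
        by (intro mult_left_mono fourier_deriv_bound) auto
      then show "norm ((1 + norm \<xi>) ^ k * norm (fourier_deriv v g \<xi>)) \<le> norm (norm v * ((1 + norm \<xi>) ^ Suc k * norm (g \<xi>)))"
        by (simp add: abs_mult ac_simps)
    qed
  qed measurable
  then show ?thesis using m by (simp add: moment_def)
qed

text \<open>The second-order remainder of \<open>cis\<close>, integrated. It yields the Frechet
  derivative directly, at the price of two moments for one derivative.\<close>

lemma fourier_re_taylor:
  assumes "moment 2 g"
  shows "\<bar>fourier_re g y - fourier_re g x - fourier_re (fourier_deriv (y - x) g) x\<bar>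
    \<le> (\<integral>\<xi>. (1 + norm \<xi>)\<^sup>2 * norm (g \<xi>) \<partial>lborel) * (norm (y - x))\<^sup>2"
proof -
  have m1: "moment 1 (fourier_deriv (y - x) g)"
    using assms by (intro moment_fourier_deriv) (simp add: numeral_2_eq_2)
  let ?h = "\<lambda>\<xi>. Re (cis (- (\<xi> \<bullet> y)) * g \<xi>) - Re (cis (- (\<xi> \<bullet> x)) * g \<xi>) - Re (cis (- (\<xi> \<bullet> x)) * fourier_deriv (y - x) g \<xi>)"
  have i: "integrable lborel ?h"
    by (intro Bochner_Integration.integrable_diff fourier_re_integrable[OF assms] fourier_re_integrable[OF m1])
  have eq: "fourier_re g y - fourier_re g x - fourier_re (fourier_deriv (y - x) g) x = (\<integral>\<xi>. ?h \<xi> \<partial>lborel)"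
    unfolding fourier_re_def
      Bochner_Integration.integral_diff[OF Bochner_Integration.integrable_diff[OF
        fourier_re_integrable[OF assms] fourier_re_integrable[OF assms]] fourier_re_integrable[OF m1]]
      Bochner_Integration.integral_diff[OF fourier_re_integrable[OF assms] fourier_re_integrable[OF assms]]
    by (rule refl)
  have "\<bar>\<integral>\<xi>. ?h \<xi> \<partial>lborel\<bar> \<le> (\<integral>\<xi>. \<bar>?h \<xi>\<bar> \<partial>lborel)" by (rule integral_abs_bound)
  also have "\<dots> \<le> (\<integral>\<xi>. ((1 + norm \<xi>)\<^sup>2 * norm (g \<xi>)) * (norm (y - x))\<^sup>2 \<partial>lborel)"
  proof (rule integral_mono)
    show "integrable lborel (\<lambda>\<xi>. \<bar>?h \<xi>\<bar>)" using i by (rule integrable_abs)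
    show "integrable lborel (\<lambda>\<xi>. ((1 + norm \<xi>)\<^sup>2 * norm (g \<xi>)) * (norm (y - x))\<^sup>2)"
      by (rule integrable_mult_left[OF assms[unfolded moment_def, THEN conjunct2]])
    fix \<xi> :: 'a
    let ?a = "- (\<xi> \<bullet> (y - x))"
    have cy: "cis (- (\<xi> \<bullet> y)) = cis (- (\<xi> \<bullet> x)) * cis ?a"
      unfolding cis_mult by (simp add: inner_diff_right)
    have ring: "A * C * z - A * z - A * (- u * z) = A * (C - 1 - (- u)) * z" for A C z u :: complex
      by (simp only: left_diff_distrib right_diff_distrib mult_1_right mult.assoc)
    then have "A * C * z - A * z - A * (- \<i> * complex_of_real t * z) = A * (C - 1 - \<i> * complex_of_real (- t)) * z"
      for A C z :: complex and t
      using ring[of A C z "\<i> * complex_of_real t"] by (simp only: mult_minus_left mult_minus_right of_real_minus)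
    then have "?h \<xi> = Re (cis (- (\<xi> \<bullet> x)) * (cis ?a - 1 - \<i> * ?a) * g \<xi>)"
      unfolding cy fourier_deriv_def minus_complex.sel(1)[symmetric] by (simp only:)
    then have "\<bar>?h \<xi>\<bar> \<le> norm (cis (- (\<xi> \<bullet> x)) * (cis ?a - 1 - \<i> * ?a) * g \<xi>)"
      by (simp only: abs_Re_le_cmod)
    also have "\<dots> = norm (cis ?a - 1 - \<i> * ?a) * norm (g \<xi>)" by (simp only: norm_mult norm_cis mult_1_left)
    also have "\<dots> \<le> ?a\<^sup>2 * norm (g \<xi>)" by (intro mult_right_mono cis_approx) auto
    also have "\<dots> \<le> ((1 + norm \<xi>) * norm (y - x))\<^sup>2 * norm (g \<xi>)"
    proof (intro mult_right_mono)
      have "\<bar>?a\<bar> \<le> norm \<xi> * norm (y - x)" using Cauchy_Schwarz_ineq2 by simp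
      also have "\<dots> \<le> (1 + norm \<xi>) * norm (y - x)" by (intro mult_right_mono) auto
      finally show "?a\<^sup>2 \<le> ((1 + norm \<xi>) * norm (y - x))\<^sup>2" using power_mono[of "\<bar>?a\<bar>" _ 2] by simp
    qed auto
    finally show "\<bar>?h \<xi>\<bar> \<le> ((1 + norm \<xi>)\<^sup>2 * norm (g \<xi>)) * (norm (y - x))\<^sup>2"
      by (simp add: power_mult_distrib ac_simps)
  qed
  finally have "\<bar>\<integral>\<xi>. ?h \<xi> \<partial>lborel\<bar> \<le> (\<integral>\<xi>. ((1 + norm \<xi>)\<^sup>2 * norm (g \<xi>)) * (norm (y - x))\<^sup>2 \<partial>lborel)" .
  then show ?thesis unfolding eq by (simp only: integral_mult_left_zero)
qed

lemma fourier_re_deriv_linear: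
  assumes "moment 1 g"
  shows "bounded_linear (\<lambda>v. fourier_re (fourier_deriv v g) x)"
proof -
  have m: "moment 0 (fourier_deriv v g)" for v using assms by (intro moment_fourier_deriv) simp
  show ?thesis
  proof (rule bounded_linear_intro)
    fix v w :: 'a and r :: real
    show "fourier_re (fourier_deriv (v + w) g) x = fourier_re (fourier_deriv v g) x + fourier_re (fourier_deriv w g) x"
      unfolding fourier_re_def
      by (subst Bochner_Integration.integral_add[symmetric, OF fourier_re_integrable[OF m] fourier_re_integrable[OF m]])
         (simp add: fourier_deriv_def inner_add_right algebra_simps)
    show "fourier_re (fourier_deriv (r *\<^sub>R v) g) x = r *\<^sub>R fourier_re (fourier_deriv v g) x"
    proof -
      have "Re (cis (- (\<xi> \<bullet> x)) * fourier_deriv (r *\<^sub>R v) g \<xi>) = r * Re (cis (- (\<xi> \<bullet> x)) * fourier_deriv v g \<xi>)" for \<xi>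
        by (simp add: fourier_deriv_def algebra_simps)
      then show ?thesis unfolding fourier_re_def by simp
    qed
    have "norm (fourier_re (fourier_deriv v g) x) \<le> (\<integral>\<xi>. norm (fourier_deriv v g \<xi>) \<partial>lborel)"
      using fourier_re_bound[OF m] by simp
    also have "\<dots> \<le> (\<integral>\<xi>. norm v * ((1 + norm \<xi>) * norm (g \<xi>)) \<partial>lborel)"
      using assms by (intro integral_mono moment_0[OF m] fourier_deriv_bound) (simp add: moment_def)
    finally show "norm (fourier_re (fourier_deriv v g) x) \<le> norm v * (\<integral>\<xi>. (1 + norm \<xi>) * norm (g \<xi>) \<partial>lborel)" by simp
  qed
qed

lemma fourier_re_has_derivative:
  assumes "moment 2 g"
  shows "(fourier_re g has_derivative (\<lambda>v. fourier_re (fourier_deriv v g) x)) (at x)"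
proof -
  let ?C = "\<integral>\<xi>. (1 + norm \<xi>)\<^sup>2 * norm (g \<xi>) \<partial>lborel"
  have bl: "bounded_linear (\<lambda>v. fourier_re (fourier_deriv v g) x)"
    using assms by (intro fourier_re_deriv_linear moment_mono[OF assms]) simp
  have "((\<lambda>y. ?C * norm (y - x)) \<longlongrightarrow> ?C * norm (x - x)) (at x)" by (intro tendsto_intros)
  then have lim: "((\<lambda>y. ?C * norm (y - x)) \<longlongrightarrow> 0) (at x)" by simp
  have "((\<lambda>y. norm (fourier_re g y - fourier_re g x - fourier_re (fourier_deriv (y - x) g) x) / norm (y - x)) \<longlongrightarrow> 0) (at x)"
  proof (rule Lim_null_comparison[OF _ lim])
    show "\<forall>\<^sub>F y in at x. norm (norm (fourier_re g y - fourier_re g x - fourier_re (fourier_deriv (y - x) g) x) / norm (y - x)) \<le> ?C * norm (y - x)"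
      unfolding eventually_at_filter
    proof (intro always_eventually allI impI)
      fix y assume "y \<noteq> x"
      then show "norm (norm (fourier_re g y - fourier_re g x - fourier_re (fourier_deriv (y - x) g) x) / norm (y - x)) \<le> ?C * norm (y - x)"
        using fourier_re_taylor[OF assms, of y x] by (simp add: divide_le_eq power2_eq_square ac_simps)
    qed
  qed
  then show ?thesis using bl by (simp add: has_derivative_iff_norm)
qed

lemma moment_foldr_fourier_deriv:
  "moment (k + length vs) g \<Longrightarrow> moment k (foldr fourier_deriv vs g)"
proof (induction vs arbitrary: k)
  case (Cons v vs)
  have "moment (Suc k + length vs) g" using Cons.prems by simp
  then show ?case using moment_fourier_deriv[OF Cons.IH] by simp
qed simp

text \<open>One moment more than derivatives is assumed: each differentiation uses up one moment,
  but \<open>fourier_re_taylor\<close> needs two at hand.\<close>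

lemma iter_deriv_fourier_re:
  assumes "moment (Suc (length vs)) g"
  shows "iter_deriv (fourier_re g) vs = fourier_re (foldr fourier_deriv vs g)"
    and "moment 1 (foldr fourier_deriv vs g)"
proof -
  show "moment 1 (foldr fourier_deriv vs g)" using assms by (intro moment_foldr_fourier_deriv) simp
  show "iter_deriv (fourier_re g) vs = fourier_re (foldr fourier_deriv vs g)"
    using assms
  proof (induction vs)
    case (Cons v vs)
    have "moment 2 (foldr fourier_deriv vs g)" using Cons.prems by (intro moment_foldr_fourier_deriv) simp
    note d = frechet_derivative_at[OF fourier_re_has_derivative[OF this], symmetric]
    have "iter_deriv (fourier_re g) vs = fourier_re (foldr fourier_deriv vs g)"
      by (rule Cons.IH) (rule moment_mono[OF Cons.prems], simp)
    then show ?case by (simp add: d)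
  qed simp
qed

lemma foldr_fourier_deriv_bound:
  assumes "vs \<in> unit_dirs k"
  shows "norm (foldr fourier_deriv vs g \<xi>) \<le> (1 + norm \<xi>) ^ k * norm (g \<xi>)"
  using assms
proof (induction vs arbitrary: k)
  case (Cons v vs)
  then obtain j where k: "k = Suc j" and v: "norm v \<le> 1" and vs: "vs \<in> unit_dirs j"
    by (auto simp: unit_dirs_def)
  have "norm (foldr fourier_deriv (v # vs) g \<xi>) \<le> norm v * ((1 + norm \<xi>) * norm (foldr fourier_deriv vs g \<xi>))"
    using fourier_deriv_bound by simp
  also have "\<dots> \<le> 1 * ((1 + norm \<xi>) * ((1 + norm \<xi>) ^ j * norm (g \<xi>)))"
    using v Cons.IH[OF vs] by (intro mult_mono) auto
  finally show ?case by (simp add: k)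
qed (simp add: unit_dirs_def)

text \<open>For dist x y \<le> 1 the Lipschitz bound of \<open>cis\<close> is used together with r
  \<le> r powr \<gamma>; beyond that, the trivial bound 2 together with 1 \<le> r powr
  \<gamma>.\<close>

lemma fourier_re_holder:
  assumes "moment 1 g" "0 < \<gamma>" "\<gamma> < 1"
  shows "\<bar>fourier_re g x - fourier_re g y\<bar> \<le> 2 * (\<integral>\<xi>. (1 + norm \<xi>) * norm (g \<xi>) \<partial>lborel) * dist x y powr \<gamma>"
proof (cases "x = y")
  case False
  let ?r = "dist x y"
  have i: "integrable lborel (\<lambda>\<xi>. Re (cis (- (\<xi> \<bullet> x)) * g \<xi>) - Re (cis (- (\<xi> \<bullet> y)) * g \<xi>))"
    by (intro Bochner_Integration.integrable_diff fourier_re_integrable[OF assms(1)])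
  have "fourier_re g x - fourier_re g y = (\<integral>\<xi>. Re (cis (- (\<xi> \<bullet> x)) * g \<xi>) - Re (cis (- (\<xi> \<bullet> y)) * g \<xi>) \<partial>lborel)"
    unfolding fourier_re_def
      Bochner_Integration.integral_diff[OF fourier_re_integrable[OF assms(1)] fourier_re_integrable[OF assms(1)]]
    by (rule refl)
  also have "\<bar>\<dots>\<bar> \<le> (\<integral>\<xi>. \<bar>Re (cis (- (\<xi> \<bullet> x)) * g \<xi>) - Re (cis (- (\<xi> \<bullet> y)) * g \<xi>)\<bar> \<partial>lborel)"
    by (rule integral_abs_bound)
  also have "\<dots> \<le> (\<integral>\<xi>. (2 * ?r powr \<gamma>) * ((1 + norm \<xi>) * norm (g \<xi>)) \<partial>lborel)"
  proof (rule integral_mono)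
    show "integrable lborel (\<lambda>\<xi>. \<bar>Re (cis (- (\<xi> \<bullet> x)) * g \<xi>) - Re (cis (- (\<xi> \<bullet> y)) * g \<xi>)\<bar>)"
      using i by (rule integrable_abs)
    show "integrable lborel (\<lambda>\<xi>. (2 * ?r powr \<gamma>) * ((1 + norm \<xi>) * norm (g \<xi>)))"
      using assms(1) by (intro integrable_mult_right) (simp add: moment_def)
    fix \<xi> :: 'a
    have "\<bar>Re (cis (- (\<xi> \<bullet> x)) * g \<xi>) - Re (cis (- (\<xi> \<bullet> y)) * g \<xi>)\<bar>
        = \<bar>Re ((cis (- (\<xi> \<bullet> x)) - cis (- (\<xi> \<bullet> y))) * g \<xi>)\<bar>"
      unfolding left_diff_distrib minus_complex.sel(1) by (rule refl)
    also have "\<dots> \<le> norm (cis (- (\<xi> \<bullet> x)) - cis (- (\<xi> \<bullet> y))) * norm (g \<xi>)"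
      using abs_Re_le_cmod norm_mult by metis
    also have "\<dots> \<le> (2 * ?r powr \<gamma> * (1 + norm \<xi>)) * norm (g \<xi>)"
    proof (rule mult_right_mono)
      show "norm (cis (- (\<xi> \<bullet> x)) - cis (- (\<xi> \<bullet> y))) \<le> 2 * ?r powr \<gamma> * (1 + norm \<xi>)"
      proof (cases "?r \<le> 1")
        case True
        have "norm (cis (- (\<xi> \<bullet> x)) - cis (- (\<xi> \<bullet> y))) \<le> \<bar>- (\<xi> \<bullet> x) - - (\<xi> \<bullet> y)\<bar>" by (rule cis_diff_bound)
        also have "\<dots> = \<bar>\<xi> \<bullet> (x - y)\<bar>" by (simp add: inner_diff_right)
        also have "\<dots> \<le> norm \<xi> * ?r" unfolding dist_norm by (rule Cauchy_Schwarz_ineq2)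
        also have "\<dots> \<le> (1 + norm \<xi>) * (2 * ?r powr \<gamma>)"
        proof (intro mult_mono)
          have "?r powr 1 \<le> ?r powr \<gamma>" using True False assms by (intro powr_mono') auto
          then have "?r \<le> ?r powr \<gamma>" using False by simp
          then show "?r \<le> 2 * ?r powr \<gamma>" using powr_ge_zero[of ?r \<gamma>] by linarith
        qed auto
        finally show ?thesis by (simp add: ac_simps)
      next
        case False
        have "norm (cis (- (\<xi> \<bullet> x)) - cis (- (\<xi> \<bullet> y))) \<le> 2"
          using norm_triangle_ineq4[of "cis (- (\<xi> \<bullet> x))" "cis (- (\<xi> \<bullet> y))"] by simp
        moreover have "1 \<le> ?r powr \<gamma>" using False assms by (intro ge_one_powr_ge_zero) auto
        then have "1 * 1 \<le> ?r powr \<gamma> * (1 + norm \<xi>)" by (intro mult_mono) auto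
        ultimately show ?thesis by simp
      qed
    qed auto
    finally show "\<bar>Re (cis (- (\<xi> \<bullet> x)) * g \<xi>) - Re (cis (- (\<xi> \<bullet> y)) * g \<xi>)\<bar> \<le> (2 * ?r powr \<gamma>) * ((1 + norm \<xi>) * norm (g \<xi>))"
      by (simp add: ac_simps)
  qed
  finally show ?thesis unfolding integral_mult_right_zero by (simp only: ac_simps)
qed simp

text \<open>Two moments pay for the derivatives; the third pays for the Hoelder seminorm of the
  second derivatives and for the Taylor remainder of the first.\<close>

lemma fourier_re_in_Cb_space:
  assumes g: "moment 3 g" and \<gamma>: "0 < \<gamma>" "\<gamma> < 1"
  shows "fourier_re g \<in> Cb_space (2 + \<gamma>)"
proof -
  \<comment> \<open>The order lies strictly between 2 and 3, which selects the Hoelder branch of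
    \<open>Cb_space\<close> with exponent \<gamma>.\<close>
  have fl: "\<lfloor>2 + \<gamma>\<rfloor> = 2" using \<gamma> by linarith
  have ni: "2 + \<gamma> \<notin> \<int>"
    using frac_eq_0_iff[of "2 + \<gamma>"] \<gamma> by (simp add: frac_def fl)
  let ?I = "\<lambda>k. \<integral>\<xi>. (1 + norm \<xi>) ^ k * norm (g \<xi>) \<partial>lborel"
  have int: "integrable lborel (\<lambda>\<xi>. (1 + norm \<xi>) ^ k * norm (g \<xi>))" if "k \<le> 3" for k
    using moment_mono[OF g that] by (simp add: moment_def)
  have mom: "moment (Suc (length vs)) g" if "length vs \<le> 2" for vs :: "'a list"
    using that by (intro moment_mono[OF g]) simp
  have "times_differentiable 2 (fourier_re g)"
    unfolding times_differentiable_def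
  proof (intro allI impI)
    fix vs :: "'a list" and x assume l: "length vs < 2"
    have "moment (2 + length vs) g" using l by (intro moment_mono[OF g]) simp
    then have "moment 2 (foldr fourier_deriv vs g)" by (rule moment_foldr_fourier_deriv)
    from fourier_re_has_derivative[OF this, of x] show "iter_deriv (fourier_re g) vs differentiable at x"
      using iter_deriv_fourier_re(1)[OF mom, of vs] l by (auto simp: differentiable_def)
  qed
  moreover have "deriv_sup_norm j (fourier_re g) < \<infinity>" if j: "j \<le> 2" for j
  proof -
    have "norm (iter_deriv (fourier_re g) vs x) \<le> ?I j" if vs: "vs \<in> unit_dirs j" for vs x
    proof -
      have l: "length vs \<le> 2" using vs j by (simp add: unit_dirs_def)
      note m = iter_deriv_fourier_re(2)[OF mom[OF l]]
      have "norm (iter_deriv (fourier_re g) vs x) \<le> (\<integral>\<xi>. norm (foldr fourier_deriv vs g \<xi>) \<partial>lborel)"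
        unfolding iter_deriv_fourier_re(1)[OF mom[OF l]] real_norm_def by (rule fourier_re_bound[OF m])
      also have "\<dots> \<le> ?I j"
        using j by (intro integral_mono moment_0[OF m] int foldr_fourier_deriv_bound[OF vs]) auto
      finally show ?thesis .
    qed
    then have "deriv_sup_norm j (fourier_re g) \<le> ennreal (?I j)"
      unfolding deriv_sup_norm_def by (intro SUP_least ennreal_leI)
    then show ?thesis by (rule order.strict_trans1) simp
  qed
  moreover have "deriv_Holder_seminorm 2 \<gamma> (fourier_re g) < \<infinity>"
  proof -
    have "norm (iter_deriv (fourier_re g) vs x - iter_deriv (fourier_re g) vs y) / dist x y powr \<gamma> \<le> 2 * ?I 3"
      if vs: "vs \<in> unit_dirs 2" and "x \<noteq> y" for vs x y
    proof -
      have l: "length vs \<le> 2" using vs by (simp add: unit_dirs_def)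
      note m = iter_deriv_fourier_re(2)[OF mom[OF l]]
      have "norm (iter_deriv (fourier_re g) vs x - iter_deriv (fourier_re g) vs y)
          \<le> 2 * (\<integral>\<xi>. (1 + norm \<xi>) * norm (foldr fourier_deriv vs g \<xi>) \<partial>lborel) * dist x y powr \<gamma>"
        unfolding iter_deriv_fourier_re(1)[OF mom[OF l]] real_norm_def by (rule fourier_re_holder[OF m \<gamma>])
      also have "\<dots> \<le> 2 * ?I 3 * dist x y powr \<gamma>"
      proof (intro mult_right_mono mult_left_mono integral_mono int)
        show "integrable lborel (\<lambda>\<xi>. (1 + norm \<xi>) * norm (foldr fourier_deriv vs g \<xi>))"
          using m by (simp add: moment_def)
        show "(1 + norm \<xi>) * norm (foldr fourier_deriv vs g \<xi>) \<le> (1 + norm \<xi>) ^ 3 * norm (g \<xi>)" for \<xi> :: 'a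
          using mult_left_mono[OF foldr_fourier_deriv_bound[OF vs, of g \<xi>], of "1 + norm \<xi>"]
          by (simp add: power3_eq_cube power2_eq_square ac_simps)
      qed auto
      finally show ?thesis using \<open>x \<noteq> y\<close> by (simp add: divide_le_eq)
    qed
    then have "deriv_Holder_seminorm 2 \<gamma> (fourier_re g) \<le> ennreal (2 * ?I 3)"
      unfolding deriv_Holder_seminorm_def by (intro SUP_least) (auto intro!: SUP_least ennreal_leI)
    then show ?thesis by (rule order.strict_trans1) simp
  qed
  ultimately show ?thesis using ni by (simp add: Cb_space_def fl)
qed

section \<open>Fourier transform of the Gaussian density\<close>

lemma cis_sum: "finite I \<Longrightarrow> cis (\<Sum>i\<in>I. f i) = (\<Prod>i\<in>I. cis (f i))"
  by (induction I rule: finite_induct) (simp_all add: cis_mult[symmetric])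

lemma normal_density_fourier:
  assumes "\<sigma> > 0"
  shows "integrable lborel (\<lambda>u. complex_of_real (normal_density 0 \<sigma> u) * cis (y * u))"
    and "(\<integral>u. complex_of_real (normal_density 0 \<sigma> u) * cis (y * u) \<partial>lborel) = exp (- (\<sigma>\<^sup>2 * y\<^sup>2) / 2)"
proof -
  have "integrable lborel (normal_density 0 \<sigma>)" using assms by simp
  then show "integrable lborel (\<lambda>u. complex_of_real (normal_density 0 \<sigma> u) * cis (y * u))"
    by (rule Bochner_Integration.integrable_bound) (auto simp: norm_mult)
  have "(\<integral>u. complex_of_real (normal_density 0 \<sigma> u) * cis (y * u) \<partial>lborel)
      = \<bar>\<sigma>\<bar> *\<^sub>R (\<integral>u. complex_of_real (normal_density 0 \<sigma> (0 + \<sigma> * u)) * cis (y * (0 + \<sigma> * u)) \<partial>lborel)"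
    using assms by (intro lborel_integral_real_affine) simp
  also have "\<dots> = (\<integral>u. \<sigma> *\<^sub>R (complex_of_real (normal_density 0 \<sigma> (\<sigma> * u)) * cis (y * (\<sigma> * u))) \<partial>lborel)"
    using assms by simp
  also have "\<dots> = (\<integral>u. std_normal_density u *\<^sub>R iexp ((y * \<sigma>) * u) \<partial>lborel)"
  proof (rule Bochner_Integration.integral_cong[OF refl])
    fix u
    have "\<sigma> * normal_density 0 \<sigma> (\<sigma> * u) = std_normal_density u"
      using assms by (simp add: normal_density_def real_sqrt_mult power_mult_distrib)
    then have "\<sigma> *\<^sub>R (complex_of_real (normal_density 0 \<sigma> (\<sigma> * u)) * cis (y * (\<sigma> * u)))
        = std_normal_density u *\<^sub>R cis (y * (\<sigma> * u))"
      unfolding scaleR_conv_of_real mult.assoc[symmetric] of_real_mult[symmetric] by simp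
    then show "\<sigma> *\<^sub>R (complex_of_real (normal_density 0 \<sigma> (\<sigma> * u)) * cis (y * (\<sigma> * u)))
        = std_normal_density u *\<^sub>R iexp ((y * \<sigma>) * u)"
      by (simp add: cis_conv_exp ac_simps)
  qed
  also have "\<dots> = char std_normal_distribution (y * \<sigma>)"
    unfolding char_def by (subst integral_density) auto
  also have "\<dots> = exp (- (\<sigma>\<^sup>2 * y\<^sup>2) / 2)"
    unfolding char_std_normal_distribution by (simp add: power_mult_distrib ac_simps exp_of_real[symmetric])
  finally show "(\<integral>u. complex_of_real (normal_density 0 \<sigma> u) * cis (y * u) \<partial>lborel) = exp (- (\<sigma>\<^sup>2 * y\<^sup>2) / 2)" .
qed

text \<open>\<open>lborel\<close> is the image of a product of one-dimensional Lebesgue measures,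
  over which the integrand factorises.\<close>

lemma gauss_fourier:
  fixes y :: "'a::euclidean_space"
  assumes "\<tau> > 0"
  shows "(\<integral>w. complex_of_real (gauss_density \<tau> w) * cis (y \<bullet> w) \<partial>lborel) = of_real (exp (- \<tau> * (y \<bullet> y) / 2))"
proof -
  interpret product_sigma_finite "\<lambda>_::'a. lborel :: real measure" ..
  let ?F = "\<lambda>b u. complex_of_real (normal_density 0 (sqrt \<tau>) u) * cis ((y \<bullet> b) * u)"
  have prod: "complex_of_real (gauss_density \<tau> w) * cis (y \<bullet> w) = (\<Prod>b\<in>Basis. ?F b (w \<bullet> b))" for w
    unfolding gauss_density_def by (subst euclidean_inner) (simp add: cis_sum prod.distrib)
  have "(\<integral>w. complex_of_real (gauss_density \<tau> w) * cis (y \<bullet> w) \<partial>lborel)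
     = (\<integral>w. (\<Prod>b\<in>Basis. ?F b (w \<bullet> b)) \<partial>distr (\<Pi>\<^sub>M b\<in>(Basis::'a set). lborel) borel (\<lambda>f. \<Sum>b\<in>Basis. f b *\<^sub>R b))"
    unfolding prod by (subst lborel_eq) (rule refl)
  also have "\<dots> = (\<integral>f. (\<Prod>b\<in>Basis. ?F b ((\<Sum>b\<in>Basis. f b *\<^sub>R b) \<bullet> b)) \<partial>(\<Pi>\<^sub>M b\<in>(Basis::'a set). lborel))"
    by (rule integral_distr) measurable
  also have "\<dots> = (\<integral>f. (\<Prod>b\<in>Basis. ?F b (f b)) \<partial>(\<Pi>\<^sub>M b\<in>(Basis::'a set). lborel))"
    by (intro Bochner_Integration.integral_cong refl prod.cong) (simp add: inner_sum_left_Basis)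
  also have "\<dots> = (\<Prod>b\<in>(Basis::'a set). \<integral>u. ?F b u \<partial>lborel)"
    using assms by (intro product_integral_prod normal_density_fourier(1)) auto
  also have "\<dots> = (\<Prod>b\<in>(Basis::'a set). of_real (exp (- (\<tau> * (y \<bullet> b)\<^sup>2) / 2)))"
    using assms by (intro prod.cong refl) (simp add: normal_density_fourier(2) exp_of_real[symmetric])
  also have "\<dots> = of_real (exp (\<Sum>b\<in>(Basis::'a set). - (\<tau> * (y \<bullet> b)\<^sup>2) / 2))"
    by (simp add: exp_sum)
  also have "(\<Sum>b\<in>(Basis::'a set). - (\<tau> * (y \<bullet> b)\<^sup>2) / 2) = - \<tau> * (y \<bullet> y) / 2"
  proof -
    have "y \<bullet> y = (\<Sum>b\<in>Basis. (y \<bullet> b)\<^sup>2)" by (subst euclidean_inner) (simp add: power2_eq_square)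
    then show ?thesis by (simp add: sum_negf sum_divide_distrib[symmetric] sum_distrib_left)
  qed
  finally show ?thesis .
qed

lemma integrable_gauss_density: "\<tau> > 0 \<Longrightarrow> integrable lborel (gauss_density \<tau>)"
proof (rule integrableI_nonneg)
  assume "\<tau> > 0"
  then interpret prob_space "gauss \<tau> :: 'a measure" by (rule prob_space_gauss)
  show "(\<integral>\<^sup>+x. ennreal (gauss_density \<tau> (x::'a)) \<partial>lborel) < \<infinity>"
    using emeasure_space_1 by (simp add: gauss_def emeasure_density)
qed auto

text \<open>Explicit inversion for the Gaussian: exp (-\<epsilon> |\<xi>|^2 / 2) is a multiple of
  the density of variance 1 / \<epsilon>, whose transform is \<open>gauss_fourier\<close>. The
  constants combine to the normalisation of the density of variance \<epsilon>.\<close>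

lemma gauss_density_fourier:
  fixes x :: "'a::euclidean_space"
  assumes "\<epsilon> > 0"
  shows "integrable lborel (\<lambda>\<xi>::'a. exp (- \<epsilon> * (\<xi> \<bullet> \<xi>) / 2))"
    and "gauss_density \<epsilon> x = (\<integral>\<xi>. (1 / (2 * pi)) ^ DIM('a) * (Re (cis (- (\<xi> \<bullet> x))) * exp (- \<epsilon> * (\<xi> \<bullet> \<xi>) / 2)) \<partial>lborel)"
proof -
  let ?k = "(1 / (2 * pi)) ^ DIM('a)" and ?c = "sqrt (2 * pi / \<epsilon>) ^ DIM('a)"
  have e: "exp (- \<epsilon> * (\<xi> \<bullet> \<xi>) / 2) = ?c * gauss_density (1 / \<epsilon>) \<xi>" for \<xi> :: 'a
  proof -
    have "?c * (1 / sqrt (2 * pi * (1 / \<epsilon>))) ^ DIM('a) = 1"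
      using assms by (simp add: power_mult_distrib[symmetric])
    then have key: "?c * ((1 / sqrt (2 * pi * (1 / \<epsilon>))) ^ DIM('a) * E) = E" for E
      unfolding mult.assoc[symmetric] by simp
    have pos: "1 / \<epsilon> > 0" using assms by simp
    show ?thesis unfolding gauss_density_eq[OF pos] key by simp
  qed
  show "integrable lborel (\<lambda>\<xi>::'a. exp (- \<epsilon> * (\<xi> \<bullet> \<xi>) / 2))"
    unfolding e using assms by (intro integrable_mult_right integrable_gauss_density) simp
  have int: "integrable lborel (\<lambda>\<xi>::'a. complex_of_real (gauss_density (1 / \<epsilon>) \<xi>) * cis ((- x) \<bullet> \<xi>))"
    by (rule Bochner_Integration.integrable_bound[OF integrable_gauss_density[of "1 / \<epsilon>"]]) (use assms in \<open>auto simp: norm_mult\<close>)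
  have "(\<integral>\<xi>. Re (complex_of_real (gauss_density (1 / \<epsilon>) \<xi>) * cis ((- x) \<bullet> \<xi>)) \<partial>lborel) = exp (- (1 / \<epsilon>) * (x \<bullet> x) / 2)"
    using gauss_fourier[of "1 / \<epsilon>" "- x"] assms int by (simp only: integral_Re) simp
  then have 1: "(\<integral>\<xi>. Re (cis (- (\<xi> \<bullet> x))) * gauss_density (1 / \<epsilon>) \<xi> \<partial>lborel) = exp (- (1 / \<epsilon>) * (x \<bullet> x) / 2)"
    by (simp add: inner_commute ac_simps)
  have kc: "?k * ?c = (1 / sqrt (2 * pi * \<epsilon>)) ^ DIM('a)"
  proof -
    have "1 / (2 * pi) * sqrt (2 * pi / \<epsilon>) = 1 / sqrt (2 * pi * \<epsilon>)"
      using assms by (simp add: real_sqrt_divide real_sqrt_mult field_simps)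
    then show ?thesis unfolding power_mult_distrib[symmetric] by simp
  qed
  have "(\<integral>\<xi>. ?k * (Re (cis (- (\<xi> \<bullet> x))) * exp (- \<epsilon> * (\<xi> \<bullet> \<xi>) / 2)) \<partial>lborel)
      = (\<integral>\<xi>. (?k * ?c) * (Re (cis (- (\<xi> \<bullet> x))) * gauss_density (1 / \<epsilon>) \<xi>) \<partial>lborel)"
    unfolding e by (simp only: ac_simps)
  also have "\<dots> = gauss_density \<epsilon> x"
    unfolding integral_mult_right_zero 1 kc using assms by (simp add: gauss_density_eq field_simps)
  finally show "gauss_density \<epsilon> x = (\<integral>\<xi>. ?k * (Re (cis (- (\<xi> \<bullet> x))) * exp (- \<epsilon> * (\<xi> \<bullet> \<xi>) / 2)) \<partial>lborel)" ..
qed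

lemma heat_approx_lipschitz:
  fixes f :: "'a::euclidean_space \<Rightarrow> real"
  assumes "\<tau> > 0" "bounded_borel B f" "\<And>x y. \<bar>f x - f y\<bar> \<le> L * dist x y" "0 \<le> L"
  shows "\<bar>heat \<tau> f z - f z\<bar> \<le> L * (real DIM('a) * (2 * exp 2) * sqrt \<tau>)"
proof -
  interpret prob_space "gauss \<tau> :: 'a measure" using assms(1) by (rule prob_space_gauss)
  note i = heat_integrable[OF assms(1,2), of z]
  have "heat \<tau> f z - f z = (\<integral>w. f (z + w) - f z \<partial>gauss \<tau>)"
    unfolding heat_def using i prob_space by simp
  also have "\<bar>\<dots>\<bar> \<le> (\<integral>w. \<bar>f (z + w) - f z\<bar> \<partial>gauss \<tau>)" by (rule integral_abs_bound)
  also have "\<dots> \<le> (\<integral>w. L * norm (w::'a) \<partial>gauss \<tau>)"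
  proof (intro integral_mono integrable_abs Bochner_Integration.integrable_diff i integrable_mult_right gauss_norm_bound(1)[OF assms(1)])
    show "\<bar>f (z + w) - f z\<bar> \<le> L * norm w" for w using assms(3)[of "z + w" z] by (simp add: dist_norm)
  qed simp
  also have "\<dots> = L * (\<integral>w. norm (w::'a) \<partial>gauss \<tau>)" by simp
  also have "\<dots> \<le> L * (real DIM('a) * (2 * exp 2) * sqrt \<tau>)"
    by (rule mult_left_mono[OF gauss_norm_bound(2)[OF assms(1)] assms(4)])
  finally show ?thesis .
qed

lemma heat_eq_lborel:
  fixes f :: "'a::euclidean_space \<Rightarrow> real"
  assumes [measurable]: "f \<in> borel_measurable borel"
  shows "heat \<tau> f z = (\<integral>x. f x * gauss_density \<tau> (x - z) \<partial>lborel)"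
proof -
  have "(\<integral>x. f x * gauss_density \<tau> (x - z) \<partial>lborel) = (\<integral>x. f x * gauss_density \<tau> (x - z) \<partial>distr lborel borel ((+) z))"
    by (subst lborel_distr_plus) simp
  also have "\<dots> = (\<integral>w. f (z + w) * gauss_density \<tau> w \<partial>lborel)"
    by (subst integral_distr) auto
  also have "\<dots> = heat \<tau> f z"
    unfolding heat_def gauss_def by (subst integral_density) (auto simp: mult.commute)
  finally show ?thesis ..
qed

section \<open>Density of a law with integrable characteristic function\<close>

locale integrable_char_function = prob_space \<mu>
  for \<mu> :: "'a::euclidean_space measure" +
  assumes sets_\<mu> [measurable_cong]: "sets \<mu> = sets borel"
    and char_int: "moment 0 (\<lambda>\<xi>. \<integral>z. cis (\<xi> \<bullet> z) \<partial>\<mu>)"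
begin

lemma space_\<mu> [simp]: "space \<mu> = UNIV"
  using sets_eq_imp_space_eq[OF sets_\<mu>] by simp

text \<open>The characteristic function together with the constant of the inversion formula, so that
  the density is just \<open>fourier_re \<phi>\<close>.\<close>

definition \<phi> :: "'a \<Rightarrow> complex" where
  "\<phi> \<xi> = of_real ((1 / (2 * pi)) ^ DIM('a)) * (\<integral>z. cis (\<xi> \<bullet> z) \<partial>\<mu>)"

lemma moment_\<phi>:
  assumes "moment k (\<lambda>\<xi>. \<integral>z. cis (\<xi> \<bullet> z) \<partial>\<mu>)"
  shows "moment k \<phi>"
proof -
  let ?g = "\<lambda>\<xi>. \<integral>z. cis (\<xi> \<bullet> z) \<partial>\<mu>"
  have [measurable]: "?g \<in> borel_measurable borel" using assms by (simp add: moment_def)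
  have "integrable lborel (\<lambda>\<xi>. ((1 / (2 * pi)) ^ DIM('a)) * ((1 + norm \<xi>) ^ k * norm (?g \<xi>)))"
    using assms by (intro integrable_mult_right) (simp add: moment_def)
  moreover have "((1 / (2 * pi)) ^ DIM('a)) * ((1 + norm \<xi>) ^ k * norm (?g \<xi>)) = (1 + norm \<xi>) ^ k * norm (\<phi> \<xi>)" for \<xi>
    by (simp add: \<phi>_def norm_mult norm_power norm_divide)
  moreover have "\<phi> \<in> borel_measurable borel" unfolding \<phi>_def by measurable
  ultimately show ?thesis by (simp only: moment_def)
qed

lemmas moment_0_\<phi> = moment_\<phi>[OF char_int]

lemma \<phi>_measurable [measurable]: "\<phi> \<in> borel_measurable borel"
  using moment_0_\<phi> by (simp add: moment_def)

definition p :: "'a \<Rightarrow> real" where "p = fourier_re \<phi>"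

text \<open>The density of \<mu> convolved with \<open>gauss \<epsilon>\<close>; it is visibly
  nonnegative and tends to \<open>p\<close>.\<close>

definition p_eps :: "real \<Rightarrow> 'a \<Rightarrow> real" where
  "p_eps \<epsilon> x = (\<integral>z. gauss_density \<epsilon> (x - z) \<partial>\<mu>)"

text \<open>\<mu> has mass 1, so a majorant that depends on the Lebesgue variable alone
  suffices.\<close>

lemma integrable_dominated_fst:
  fixes f :: "'a \<times> 'a \<Rightarrow> real"
  assumes f [measurable]: "f \<in> borel_measurable (lborel \<Otimes>\<^sub>M \<mu>)"
    and g: "integrable lborel g" and b: "\<And>x z. \<bar>f (x, z)\<bar> \<le> g x"
  shows "integrable (lborel \<Otimes>\<^sub>M \<mu>) f"
proof -
  interpret L: pair_sigma_finite lborel \<mu> ..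
  have i: "integrable \<mu> (\<lambda>z. f (x, z))" for x
    by (rule integrable_const_bound[of _ "g x"]) (use b in auto)
  have "(\<integral>z. norm (f (x, z)) \<partial>\<mu>) \<le> g x" for x
  proof -
    have "(\<integral>z. norm (f (x, z)) \<partial>\<mu>) \<le> (\<integral>z. g x \<partial>\<mu>)"
      using i[of x] b by (intro integral_mono) auto
    then show ?thesis using prob_space by simp
  qed
  then have "integrable lborel (\<lambda>x. \<integral>z. norm (f (x, z)) \<partial>\<mu>)"
    by (intro Bochner_Integration.integrable_bound[OF g]) (auto intro: order_trans[OF _ abs_ge_self])
  then show ?thesis using i by (intro L.Fubini_integrable) auto
qed

text \<open>Insert the Fourier representation of the Gaussian and exchange the integrals. Smoothing
  \<mu> damps \<phi> by a Gaussian factor, and this factor makes the double integral absolutely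
  convergent.\<close>

lemma p_eps_eq:
  assumes "\<epsilon> > 0"
  shows "p_eps \<epsilon> x = (\<integral>\<xi>. Re (cis (- (\<xi> \<bullet> x)) * \<phi> \<xi>) * exp (- \<epsilon> * (\<xi> \<bullet> \<xi>) / 2) \<partial>lborel)"
proof -
  interpret L: pair_sigma_finite lborel \<mu> ..
  let ?k = "(1 / (2 * pi)) ^ DIM('a)" and ?e = "\<lambda>\<xi>::'a. exp (- \<epsilon> * (\<xi> \<bullet> \<xi>) / 2)"
  let ?H = "\<lambda>\<xi> z. ?k * (Re (cis (- (\<xi> \<bullet> (x - z)))) * ?e \<xi>)"
  have int: "integrable (lborel \<Otimes>\<^sub>M \<mu>) (\<lambda>(\<xi>, z). ?H \<xi> z)"
  proof (rule integrable_dominated_fst)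
    show "integrable lborel (\<lambda>\<xi>. ?k * ?e \<xi>)"
      by (intro integrable_mult_right gauss_density_fourier(1)[OF assms])
    show "\<bar>case (\<xi>, z) of (\<xi>, z) \<Rightarrow> ?H \<xi> z\<bar> \<le> ?k * ?e \<xi>" for \<xi> z
      using abs_Re_cis_mult[of "- (\<xi> \<bullet> (x - z))" 1]
      by (simp add: abs_mult mult_left_mono mult_left_le_one_le)
  qed measurable
  have "p_eps \<epsilon> x = (\<integral>z. \<integral>\<xi>. ?H \<xi> z \<partial>lborel \<partial>\<mu>)"
    unfolding p_eps_def gauss_density_fourier(2)[OF assms] by (rule refl)
  also have "\<dots> = (\<integral>\<xi>. \<integral>z. ?H \<xi> z \<partial>\<mu> \<partial>lborel)"
    by (rule L.Fubini_integral[OF int])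
  also have "\<dots> = (\<integral>\<xi>. Re (cis (- (\<xi> \<bullet> x)) * \<phi> \<xi>) * ?e \<xi> \<partial>lborel)"
  proof (rule Bochner_Integration.integral_cong[OF refl])
    fix \<xi> :: 'a
    have i: "integrable \<mu> (\<lambda>z. cis (\<xi> \<bullet> z))" by (rule integrable_const_bound[of _ 1]) auto
    have "(\<integral>z. Re (cis (- (\<xi> \<bullet> x)) * cis (\<xi> \<bullet> z)) \<partial>\<mu>) = Re (cis (- (\<xi> \<bullet> x)) * (\<integral>z. cis (\<xi> \<bullet> z) \<partial>\<mu>))"
      by (subst integral_Re) (use i in \<open>auto intro: integrable_mult_right simp only: integral_mult_right_zero\<close>)
    moreover have "cis (- (\<xi> \<bullet> (x - z))) = cis (- (\<xi> \<bullet> x)) * cis (\<xi> \<bullet> z)" for z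
      unfolding cis_mult by (simp add: inner_diff_right)
    ultimately have "(\<integral>z. Re (cis (- (\<xi> \<bullet> (x - z)))) \<partial>\<mu>) = Re (cis (- (\<xi> \<bullet> x)) * (\<integral>z. cis (\<xi> \<bullet> z) \<partial>\<mu>))"
      by (simp only:)
    moreover have "Re (cis (- (\<xi> \<bullet> x)) * \<phi> \<xi>) = ?k * Re (cis (- (\<xi> \<bullet> x)) * (\<integral>z. cis (\<xi> \<bullet> z) \<partial>\<mu>))"
    proof -
      have "Re (A * (complex_of_real k * C)) = k * Re (A * C)" for A C k by (simp add: algebra_simps)
      then show ?thesis unfolding \<phi>_def .
    qed
    ultimately show "(\<integral>z. ?H \<xi> z \<partial>\<mu>) = Re (cis (- (\<xi> \<bullet> x)) * \<phi> \<xi>) * ?e \<xi>"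
      by (simp only: integral_mult_right_zero integral_mult_left_zero mult.assoc)
  qed
  finally show ?thesis .
qed

lemma p_eps_nonneg: "0 \<le> p_eps \<epsilon> x"
  unfolding p_eps_def by (rule integral_nonneg_AE) simp

lemma p_eps_integrand_bound:
  assumes "\<epsilon> > 0"
  shows "\<bar>Re (cis (- (\<xi> \<bullet> x)) * \<phi> \<xi>) * exp (- \<epsilon> * (\<xi> \<bullet> \<xi>) / 2)\<bar> \<le> norm (\<phi> \<xi>)"
proof -
  have "exp (- \<epsilon> * (\<xi> \<bullet> \<xi>) / 2) \<le> 1" using assms by simp
  then have "\<bar>Re (cis (- (\<xi> \<bullet> x)) * \<phi> \<xi>)\<bar> * exp (- \<epsilon> * (\<xi> \<bullet> \<xi>) / 2) \<le> norm (\<phi> \<xi>) * 1"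
    by (intro mult_mono abs_Re_cis_mult) auto
  then show ?thesis by (simp only: abs_mult abs_exp_cancel mult_1_right)
qed

lemma p_eps_bound:
  assumes "\<epsilon> > 0"
  shows "\<bar>p_eps \<epsilon> x\<bar> \<le> (\<integral>\<xi>. norm (\<phi> \<xi>) \<partial>lborel)"
  unfolding p_eps_eq[OF assms]
proof (rule order_trans[OF integral_abs_bound])
  let ?h = "\<lambda>\<xi>. Re (cis (- (\<xi> \<bullet> x)) * \<phi> \<xi>) * exp (- \<epsilon> * (\<xi> \<bullet> \<xi>) / 2)"
  have m: "?h \<in> borel_measurable lborel" by measurable
  have "integrable lborel ?h"
    by (rule Bochner_Integration.integrable_bound[OF moment_0[OF moment_0_\<phi>] m], rule AE_I2)
       (simp only: real_norm_def abs_norm_cancel p_eps_integrand_bound[OF assms])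
  then show "(\<integral>\<xi>. \<bar>?h \<xi>\<bar> \<partial>lborel) \<le> (\<integral>\<xi>. norm (\<phi> \<xi>) \<partial>lborel)"
    by (intro integral_mono integrable_abs moment_0[OF moment_0_\<phi>] p_eps_integrand_bound[OF assms])
qed

lemma p_eps_tendsto: "(\<lambda>n. p_eps (inverse (real (Suc n))) x) \<longlonglongrightarrow> p x"
proof -
  let ?\<epsilon> = "\<lambda>n. inverse (real (Suc n))"
  let ?h = "\<lambda>n \<xi>. Re (cis (- (\<xi> \<bullet> x)) * \<phi> \<xi>) * exp (- ?\<epsilon> n * (\<xi> \<bullet> \<xi>) / 2)"
  have pos: "0 < ?\<epsilon> n" for n by simp
  have "(\<lambda>n. \<integral>\<xi>. ?h n \<xi> \<partial>lborel) \<longlonglongrightarrow> (\<integral>\<xi>. Re (cis (- (\<xi> \<bullet> x)) * \<phi> \<xi>) \<partial>lborel)"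
  proof (rule integral_dominated_convergence[OF _ _ moment_0[OF moment_0_\<phi>]])
    show "(\<lambda>\<xi>. Re (cis (- (\<xi> \<bullet> x)) * \<phi> \<xi>)) \<in> borel_measurable lborel" by measurable
    show "?h n \<in> borel_measurable lborel" for n by measurable
    show "AE \<xi> in lborel. norm (?h n \<xi>) \<le> norm (\<phi> \<xi>)" for n
      unfolding real_norm_def by (intro AE_I2 p_eps_integrand_bound pos)
    show "AE \<xi> in lborel. (\<lambda>n. ?h n \<xi>) \<longlonglongrightarrow> Re (cis (- (\<xi> \<bullet> x)) * \<phi> \<xi>)"
    proof (rule AE_I2)
      fix \<xi> :: 'a
      have "(\<lambda>n. A * exp (- ?\<epsilon> n * (\<xi> \<bullet> \<xi>) / 2)) \<longlonglongrightarrow> A * exp (- 0 * (\<xi> \<bullet> \<xi>) / 2)" for A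
        by (intro tendsto_intros LIMSEQ_inverse_real_of_nat) simp
      then show "(\<lambda>n. ?h n \<xi>) \<longlonglongrightarrow> Re (cis (- (\<xi> \<bullet> x)) * \<phi> \<xi>)" by (simp only: mult_zero_left minus_zero div_0 exp_zero mult_1_right)
    qed
  qed
  then show ?thesis unfolding p_def fourier_re_def p_eps_eq[OF pos] .
qed

text \<open>Not visible from the oscillatory integral; inherited from the approximations
  \<open>p_eps\<close>.\<close>

lemma p_nonneg: "0 \<le> p x"
  by (rule LIMSEQ_le_const[OF p_eps_tendsto]) (auto simp: p_eps_nonneg)

lemma p_bound: "p x \<le> (\<integral>\<xi>. norm (\<phi> \<xi>) \<partial>lborel)"
  using fourier_re_bound[OF moment_0_\<phi>, of x] unfolding p_def by linarith

lemma p_measurable [measurable]: "p \<in> borel_measurable borel"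
  unfolding p_def fourier_re_def by measurable

lemma p_eps_measurable [measurable]: "p_eps \<epsilon> \<in> borel_measurable borel"
  unfolding p_eps_def by measurable

text \<open>The smoothed law is tested with f in two ways. By Fubini the result is the \<mu>-mean of
  \<open>heat \<epsilon> f\<close>, which tends to the mean of f because f is Lipschitz; by
  dominated convergence, with majorant a multiple of |f|, it tends to the integral of f times
  p.\<close>

lemma integral_lipschitz_eq:
  fixes f :: "'a \<Rightarrow> real"
  assumes f: "bounded_borel B f" and L: "\<And>x y. \<bar>f x - f y\<bar> \<le> L * dist x y" "0 \<le> L"
    and fi: "integrable lborel f"
  shows "(\<integral>z. f z \<partial>\<mu>) = (\<integral>x. f x * p x \<partial>lborel)"
proof -
  interpret L: pair_sigma_finite lborel \<mu> ..
  note [measurable] = bounded_borelD(1)[OF f]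
  let ?\<epsilon> = "\<lambda>n. inverse (real (Suc n))" and ?C = "\<integral>\<xi>. norm (\<phi> \<xi>) \<partial>lborel"
  have pos: "0 < ?\<epsilon> n" for n by simp
  have eq: "(\<integral>x. f x * p_eps \<epsilon> x \<partial>lborel) = (\<integral>z. heat \<epsilon> f z \<partial>\<mu>)" if \<epsilon>: "\<epsilon> > 0" for \<epsilon>
  proof -
    have "integrable (lborel \<Otimes>\<^sub>M \<mu>) (\<lambda>(x, z). f x * gauss_density \<epsilon> (x - z))"
    proof (rule integrable_dominated_fst)
      show "integrable lborel (\<lambda>x. \<bar>f x\<bar> * (1 / sqrt (2 * pi * \<epsilon>)) ^ DIM('a))"
        by (intro integrable_mult_left integrable_abs fi)
      have "gauss_density \<epsilon> w \<le> (1 / sqrt (2 * pi * \<epsilon>)) ^ DIM('a)" for w :: 'a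
        unfolding gauss_density_eq[OF \<epsilon>] using \<epsilon> by (intro mult_left_le) auto
      then show "\<bar>case (x, z) of (x, z) \<Rightarrow> f x * gauss_density \<epsilon> (x - z)\<bar> \<le> \<bar>f x\<bar> * (1 / sqrt (2 * pi * \<epsilon>)) ^ DIM('a)" for x z
        by (simp add: abs_mult mult_left_mono)
    qed measurable
    from L.Fubini_integral[OF this]
    have "(\<integral>z. heat \<epsilon> f z \<partial>\<mu>) = (\<integral>x. \<integral>z. f x * gauss_density \<epsilon> (x - z) \<partial>\<mu> \<partial>lborel)"
      unfolding heat_eq_lborel[OF bounded_borelD(1)[OF f]] .
    then show ?thesis unfolding p_eps_def by simp
  qed
  have "(\<lambda>n. \<integral>x. f x * p_eps (?\<epsilon> n) x \<partial>lborel) \<longlonglongrightarrow> (\<integral>x. f x * p x \<partial>lborel)"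
  proof (rule integral_dominated_convergence[where w="\<lambda>x. \<bar>f x\<bar> * ?C"])
    show "integrable lborel (\<lambda>x. \<bar>f x\<bar> * ?C)" by (intro integrable_mult_left integrable_abs fi)
    show "AE x in lborel. (\<lambda>n. f x * p_eps (?\<epsilon> n) x) \<longlonglongrightarrow> f x * p x"
      by (intro AE_I2 tendsto_mult tendsto_const p_eps_tendsto)
    show "AE x in lborel. norm (f x * p_eps (?\<epsilon> n) x) \<le> \<bar>f x\<bar> * ?C" for n
      unfolding real_norm_def abs_mult by (intro AE_I2 mult_left_mono p_eps_bound pos) simp
  qed measurable
  moreover have "(\<lambda>n. \<integral>x. f x * p_eps (?\<epsilon> n) x \<partial>lborel) \<longlonglongrightarrow> (\<integral>z. f z \<partial>\<mu>)"
    unfolding eq[OF pos]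
  proof (rule integral_dominated_convergence[where w="\<lambda>_. B"])
    show "AE z in \<mu>. (\<lambda>n. heat (?\<epsilon> n) f z) \<longlonglongrightarrow> f z"
    proof (rule AE_I2, rule LIM_zero_cancel, rule Lim_null_comparison)
      fix z
      let ?m = "real DIM('a) * (2 * exp 2)"
      show "\<forall>\<^sub>F n in sequentially. norm (heat (?\<epsilon> n) f z - f z) \<le> L * (?m * sqrt (?\<epsilon> n))"
        unfolding real_norm_def by (intro always_eventually allI heat_approx_lipschitz[OF pos f L])
      have "(\<lambda>n. L * (?m * sqrt (?\<epsilon> n))) \<longlonglongrightarrow> L * (?m * sqrt 0)"
        by (intro tendsto_intros LIMSEQ_inverse_real_of_nat)
      then show "(\<lambda>n. L * (?m * sqrt (?\<epsilon> n))) \<longlonglongrightarrow> 0" by (simp only: real_sqrt_zero mult_zero_right)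
    qed
    show "AE z in \<mu>. norm (heat (?\<epsilon> n) f z) \<le> B" for n
      unfolding real_norm_def by (intro AE_I2 bounded_borelD(2)[OF heat_bounded[OF pos f]])
    show "heat (?\<epsilon> n) f \<in> borel_measurable \<mu>" for n
      using bounded_borelD(1)[OF heat_bounded[OF pos f]] by measurable
  qed auto
  ultimately show ?thesis by (rule LIMSEQ_unique[symmetric])
qed

text \<open>The indicator of a box is an increasing limit of Lipschitz functions to which
  \<open>integral_lipschitz_eq\<close> applies. Boundedness of the box supplies the integrable
  majorant.\<close>

lemma measure_box_eq: "emeasure \<mu> (box a b) = emeasure (density lborel (\<lambda>x. ennreal (p x))) (box a b)"
proof -
  let ?U = "box a b" and ?C = "\<integral>\<xi>. norm (\<phi> \<xi>) \<partial>lborel"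
  \<comment> \<open>The distance to the empty set is 0 by convention, so the cut-off below needs a
    nonempty complement.\<close>
  have ne: "- ?U \<noteq> {}"
  proof
    assume "- ?U = {}"
    then have "?U = UNIV" by blast
    then show False using bounded_box[of a b] not_bounded_UNIV by metis
  qed
  have cl: "closed (- ?U)" by (rule closed_Compl[OF open_box])
  \<comment> \<open>Vanishes outside the box and equals 1 once n times the distance to the
    complement reaches 1, which happens at every point because the box is open.\<close>
  define f where "f n x = min 1 (real n * infdist x (- ?U))" for n x
  have fb: "0 \<le> f n x" "f n x \<le> indicator ?U x" for n x
    by (auto simp: f_def indicator_def infdist_nonneg)
  have fL: "\<bar>f n x - f n y\<bar> \<le> real n * dist x y" for n x y
  proof -
    have "\<bar>f n x - f n y\<bar> \<le> \<bar>real n * infdist x (- ?U) - real n * infdist y (- ?U)\<bar>"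
      unfolding f_def by linarith
    also have "\<dots> = real n * \<bar>infdist x (- ?U) - infdist y (- ?U)\<bar>"
      by (simp add: right_diff_distrib[symmetric] abs_mult)
    also have "\<dots> \<le> real n * dist x y" by (intro mult_left_mono infdist_triangle_abs) simp
    finally show ?thesis .
  qed
  have fm [measurable]: "f n \<in> borel_measurable borel" for n
    unfolding f_def by (intro borel_measurable_continuous_onI continuous_intros)
  have fbb: "bounded_borel 1 (f n)" for n
  proof -
    have "\<bar>f n x\<bar> \<le> 1" for x using fb(1)[of n x] order_trans[OF fb(2)[of n x] indicator_le_1] by simp
    then show ?thesis using fm by (simp add: bounded_borel_def)
  qed
  have iU: "integrable lborel (indicat_real ?U)"
    by (intro integrable_real_indicator) (use emeasure_bounded_finite[OF bounded_box[of a b]] in auto)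
  have fi: "integrable lborel (f n)" for n
    by (rule Bochner_Integration.integrable_bound[OF iU]) (use fb in auto)
  have lim: "(\<lambda>n. f n x) \<longlonglongrightarrow> indicator ?U x" for x
  proof (cases "x \<in> ?U")
    case True
    then have pos: "0 < infdist x (- ?U)" using infdist_pos_not_in_closed[OF cl ne] by simp
    obtain N where N: "1 < real N * infdist x (- ?U)" using reals_Archimedean3[OF pos] by blast
    have "\<forall>\<^sub>F n in sequentially. f n x = 1"
    proof (rule eventually_sequentiallyI[of N])
      fix n assume "N \<le> n"
      then have "real N * infdist x (- ?U) \<le> real n * infdist x (- ?U)" using pos by simp
      then show "f n x = 1" using N by (simp add: f_def)
    qed
    then show ?thesis using True by (simp add: tendsto_eventually)
  next
    case False
    then have "f n x = 0" for n using fb[of n x] by simp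
    then show ?thesis using False by simp
  qed
  have "(\<lambda>n. \<integral>z. f n z \<partial>\<mu>) \<longlonglongrightarrow> (\<integral>z. indicat_real ?U z \<partial>\<mu>)"
    by (rule integral_dominated_convergence[where w="\<lambda>_. 1"]) (use lim fbb bounded_borelD(2)[OF fbb] in auto)
  moreover have "(\<lambda>n. \<integral>x. f n x * p x \<partial>lborel) \<longlonglongrightarrow> (\<integral>x. indicat_real ?U x * p x \<partial>lborel)"
  proof (rule integral_dominated_convergence[where w="\<lambda>x. indicat_real ?U x * ?C"])
    show "integrable lborel (\<lambda>x. indicat_real ?U x * ?C)" by (intro integrable_mult_left iU)
    show "AE x in lborel. (\<lambda>n. f n x * p x) \<longlonglongrightarrow> indicat_real ?U x * p x"
      by (intro AE_I2 tendsto_mult lim tendsto_const)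
    show "AE x in lborel. norm (f n x * p x) \<le> indicat_real ?U x * ?C" for n
      using fb p_nonneg p_bound by (auto simp: abs_mult intro!: mult_mono)
  qed auto
  ultimately have eq: "(\<integral>z. indicat_real ?U z \<partial>\<mu>) = (\<integral>x. indicat_real ?U x * p x \<partial>lborel)"
    unfolding integral_lipschitz_eq[OF fbb fL of_nat_0_le_iff fi] by (rule LIMSEQ_unique)
  have "integrable lborel (\<lambda>x. indicat_real ?U x * p x)"
    by (rule Bochner_Integration.integrable_bound[OF integrable_mult_left[OF iU, of ?C]])
       (use p_nonneg p_bound in \<open>auto simp: indicator_def intro: order_trans\<close>)
  then have "emeasure (density lborel (\<lambda>x. ennreal (p x))) ?U = ennreal (\<integral>x. indicat_real ?U x * p x \<partial>lborel)"
    by (subst nn_integral_eq_integral[symmetric])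
       (auto simp: emeasure_density p_nonneg ennreal_mult' ennreal_indicator mult.commute)
  then show ?thesis using eq by (simp add: emeasure_eq_measure)
qed

text \<open>Uniqueness of measures on the intersection-stable generator of open boxes, exhausted by
  cubes.\<close>

theorem density_p: "\<mu> = density lborel (\<lambda>x. ennreal (p x))"
proof (rule measure_eqI_generator_eq[where E="range (\<lambda>(a, b). box a b)" and \<Omega>=UNIV
      and A="\<lambda>n. box (- real n *\<^sub>R One) (real n *\<^sub>R One)"])
  have sb: "sets (borel :: 'a measure) = sigma_sets UNIV (range (\<lambda>(a, b). box a b))"
    by (subst borel_eq_box) simp
  show "sets \<mu> = sigma_sets UNIV (range (\<lambda>(a, b). box a b))" using sets_\<mu> sb by simp
  show "sets (density lborel (\<lambda>x. ennreal (p x))) = sigma_sets UNIV (range (\<lambda>(a, b). box a b))" using sb by simp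
  show "Int_stable (range (\<lambda>(a, b). box a b :: 'a set))"
    by (auto simp: Int_stable_def box_Int_box)
  show "(\<Union>n. box (- real n *\<^sub>R One) (real n *\<^sub>R One) :: 'a set) = UNIV"
    using UN_box_eq_UNIV by auto
  show "emeasure \<mu> X = emeasure (density lborel (\<lambda>x. ennreal (p x))) X" if "X \<in> range (\<lambda>(a, b). box a b)" for X
    using that measure_box_eq by auto
qed auto

end

text \<open>Of the assumed decay, k powers compensate the weight. The other 2 d make the function
  integrable: they are compared with the product of the factors 1 / (1 + (\<xi> \<bullet> b)^2),
  whose integral splits into one-dimensional ones.\<close>

lemma moment_of_decay:
  fixes g :: "'a::euclidean_space \<Rightarrow> complex"
  assumes [measurable]: "g \<in> borel_measurable borel" and b1: "\<And>\<xi>. norm (g \<xi>) \<le> 1"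
    and b2: "\<And>\<xi>. norm (g \<xi>) * norm \<xi> ^ (2 * DIM('a) + k) \<le> C"
  shows "moment k g"
proof -
  let ?q = "\<lambda>u::real. inverse (1 + u\<^sup>2)"
  \<comment> \<open>With t = max 1 |\<xi>|: 2^k comes from 1 + |\<xi>| \<le> 2 t, 2^d from 1 +
    (\<xi> \<bullet> b)^2 \<le> 2 t^2, and max 1 C from the two ranges of |\<xi>|.\<close>
  let ?D = "2 ^ k * 2 ^ DIM('a) * max 1 C"
  have "integrable lborel ?q"
    using integrable_inverse_1_plus_square by (simp add: set_integrable_def einterval_def)
  then have fin: "(\<integral>\<^sup>+u. ennreal (?q u) \<partial>lborel) < \<infinity>"
    by (simp add: integrable_iff_bounded)
  have "(\<integral>\<^sup>+\<xi>. ennreal (\<Prod>b\<in>Basis. ?q ((\<xi>::'a) \<bullet> b)) \<partial>lborel) = (\<integral>\<^sup>+\<xi>. (\<Prod>b\<in>Basis. ennreal (?q ((\<xi>::'a) \<bullet> b))) \<partial>lborel)"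
    by (simp add: prod_ennreal)
  also have "\<dots> = (\<Prod>b\<in>(Basis::'a set). \<integral>\<^sup>+u. ennreal (?q u) \<partial>lborel)"
    by (rule nn_integral_lborel_prod) auto
  also have "\<dots> < \<infinity>" using fin by (simp add: power_less_top_ennreal)
  finally have "integrable lborel (\<lambda>\<xi>::'a. \<Prod>b\<in>Basis. ?q (\<xi> \<bullet> b))"
    by (intro integrableI_nonneg) (auto intro!: prod_nonneg)
  then have "integrable lborel (\<lambda>\<xi>::'a. ?D * (\<Prod>b\<in>Basis. ?q (\<xi> \<bullet> b)))" by (rule integrable_mult_right)
  then have "integrable lborel (\<lambda>\<xi>. (1 + norm \<xi>) ^ k * norm (g \<xi>))"
  proof (rule Bochner_Integration.integrable_bound)
    show "AE \<xi> in lborel. norm ((1 + norm \<xi>) ^ k * norm (g \<xi>)) \<le> norm (?D * (\<Prod>b\<in>Basis. ?q (\<xi> \<bullet> b)))"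
    proof (rule AE_I2)
      fix \<xi> :: 'a
      define t where "t = max 1 (norm \<xi>)"
      have t: "1 \<le> t" "norm \<xi> \<le> t" by (auto simp: t_def)
      let ?P = "\<Prod>b\<in>(Basis::'a set). 1 + (\<xi> \<bullet> b)\<^sup>2"
      have P0: "0 < ?P" by (intro prod_pos) (auto intro: add_pos_nonneg)
      have "?P \<le> (\<Prod>b\<in>(Basis::'a set). 2 * t\<^sup>2)"
      proof (rule prod_mono, safe)
        fix b :: 'a assume "b \<in> Basis"
        then have "\<bar>\<xi> \<bullet> b\<bar> \<le> t" using Basis_le_norm[of b \<xi>] t by linarith
        then have "(\<xi> \<bullet> b)\<^sup>2 \<le> t\<^sup>2" using power_mono[of "\<bar>\<xi> \<bullet> b\<bar>" t 2] by simp
        moreover have "1 \<le> t\<^sup>2" using t(1) by (rule one_le_power)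
        ultimately show "1 + (\<xi> \<bullet> b)\<^sup>2 \<le> 2 * t\<^sup>2" by linarith
      qed auto
      also have "\<dots> = 2 ^ DIM('a) * t ^ (2 * DIM('a))" by (simp add: power_mult_distrib power_mult)
      finally have P: "?P \<le> 2 ^ DIM('a) * t ^ (2 * DIM('a))" .
      have gt: "norm (g \<xi>) * t ^ (2 * DIM('a) + k) \<le> max 1 C"
      proof (cases "norm \<xi> \<le> 1")
        case True
        then show ?thesis using b1[of \<xi>] by (simp add: t_def max_def)
      next
        case False
        then show ?thesis using b2[of \<xi>] by (simp add: t_def max_def)
      qed
      have "(1 + norm \<xi>) ^ k * norm (g \<xi>) * ?P \<le> (2 * t) ^ k * norm (g \<xi>) * (2 ^ DIM('a) * t ^ (2 * DIM('a)))"
        using t P P0 by (intro mult_mono power_mono P) auto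
      also have "\<dots> = (2 ^ k * 2 ^ DIM('a)) * (norm (g \<xi>) * t ^ (2 * DIM('a) + k))"
        by (simp add: power_add power_mult_distrib)
      also have "\<dots> \<le> ?D" using gt by (intro mult_left_mono) auto
      finally have "(1 + norm \<xi>) ^ k * norm (g \<xi>) \<le> ?D / ?P" using P0 by (simp add: pos_le_divide_eq)
      also have "\<dots> = ?D * (\<Prod>b\<in>Basis. ?q (\<xi> \<bullet> b))"
        by (simp add: prod_inversef[unfolded comp_def] divide_inverse)
      finally show "norm ((1 + norm \<xi>) ^ k * norm (g \<xi>)) \<le> norm (?D * (\<Prod>b\<in>Basis. ?q (\<xi> \<bullet> b)))"
        using prod_nonneg[of Basis "\<lambda>b. ?q (\<xi> \<bullet> b)"] by (simp add: abs_mult)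
    qed
  qed measurable
  then show ?thesis by (simp add: moment_def)
qed

section \<open>From the equation to the regularity of its law\<close>

text \<open>The sup norm is the term of order 0, with the empty list of directions.\<close>

lemma norm_le_Cb_norm: "ennreal (norm (f x)) \<le> Cb_norm \<alpha> f"
proof -
  have "ennreal (norm (iter_deriv f [] x)) \<le> deriv_sup_norm 0 f"
    unfolding deriv_sup_norm_def by (intro SUP_upper2[of x] SUP_upper) (auto simp: unit_dirs_def)
  also have "\<dots> \<le> (\<Sum>j\<le>nat \<lfloor>\<alpha>\<rfloor>. deriv_sup_norm j f)"
    by (rule member_le_sum) auto
  also have "\<dots> \<le> Cb_norm \<alpha> f" by (simp add: Cb_norm_def Let_def)
  finally show ?thesis by simp
qed

text \<open>For \<alpha> < 1 the Hoelder seminorm gives continuity; otherwise the floor of \<alpha>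
  is at least 1 and the function is differentiable.\<close>

lemma Cb_space_continuous:
  fixes f :: "'a::euclidean_space \<Rightarrow> 'b::real_normed_vector"
  assumes "\<alpha> > 0" and f: "f \<in> Cb_space \<alpha>"
  shows "continuous_on UNIV f"
proof (cases "nat \<lfloor>\<alpha>\<rfloor> = 0")
  case True
  then have \<alpha>1: "\<alpha> < 1" using assms(1) by linarith
  then have "\<alpha> \<notin> \<int>" using assms(1) by (auto elim!: Ints_cases)
  then have fin: "deriv_Holder_seminorm 0 \<alpha> f < \<infinity>" using f True by (simp add: Cb_space_def Let_def)
  define C where "C = enn2real (deriv_Holder_seminorm 0 \<alpha> f)"
  have C: "deriv_Holder_seminorm 0 \<alpha> f = ennreal C" using fin by (simp add: C_def)
  have le: "norm (f x - f y) \<le> C * dist x y powr \<alpha>" for x y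
  proof (cases "x = y")
    case False
    have "ennreal (norm (iter_deriv f [] x - iter_deriv f [] y) / dist x y powr \<alpha>) \<le> deriv_Holder_seminorm 0 \<alpha> f"
      unfolding deriv_Holder_seminorm_def using False
      by (intro SUP_upper2[of "(x, y)"]) (auto intro!: SUP_upper2[of "[]"] simp: unit_dirs_def)
    then have "norm (f x - f y) / dist x y powr \<alpha> \<le> C" unfolding C by (subst (asm) ennreal_le_iff) (simp_all add: C_def)
    then show ?thesis using False by (simp add: divide_le_eq)
  qed simp
  show ?thesis
    unfolding continuous_on_def
  proof
    fix x :: 'a
    have "((\<lambda>y. C * dist y x powr \<alpha>) \<longlongrightarrow> C * dist x x powr \<alpha>) (at x)"
      using assms(1) by (intro tendsto_intros) auto
    then have "((\<lambda>y. C * dist y x powr \<alpha>) \<longlongrightarrow> 0) (at x)" by simp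
    then have "((\<lambda>y. f y - f x) \<longlongrightarrow> 0) (at x)"
      by (rule Lim_null_comparison[rotated]) (simp add: le)
    then show "(f \<longlongrightarrow> f x) (at x within UNIV)" by (simp add: LIM_zero_iff)
  qed
next
  case False
  then have "f differentiable (at x)" for x
    using f unfolding Cb_space_def Let_def times_differentiable_def
    by (metis (mono_tags, lifting) iter_deriv.simps(1) list.size(3) mem_Collect_eq neq0_conv)
  then show ?thesis by (simp add: continuous_on_eq_continuous_within differentiable_imp_continuous_within)
qed

text \<open>Sampling at grid points of mesh 1 / (n + 1) gives jointly measurable processes that
  converge pointwise by continuity of the paths.\<close>

lemma measurable_of_continuous_paths:
  fixes Y :: "real \<Rightarrow> 'w \<Rightarrow> 'a::euclidean_space"
  assumes Y [measurable]: "\<And>s. Y s \<in> borel_measurable M"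
    and cont: "\<And>\<omega>. \<omega> \<in> space M \<Longrightarrow> continuous_on UNIV (\<lambda>s. Y s \<omega>)"
  shows "(\<lambda>(s, \<omega>). Y s \<omega>) \<in> borel_measurable (borel \<Otimes>\<^sub>M M)"
proof (rule borel_measurable_LIMSEQ_metric)
  let ?r = "\<lambda>n (i::int). real_of_int i / real (Suc n)"
  let ?F = "\<lambda>n p. Y (?r n \<lfloor>real (Suc n) * fst p\<rfloor>) (snd p)"
  show "?F n \<in> borel_measurable (borel \<Otimes>\<^sub>M M)" for n
    by (rule measurable_compose_countable[where f="\<lambda>i p. Y (?r n i) (snd p)" and g="\<lambda>p. \<lfloor>real (Suc n) * fst p\<rfloor>"])
       measurable
  fix p :: "real \<times> 'w" assume "p \<in> space (borel \<Otimes>\<^sub>M M)"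
  then obtain s \<omega> where p: "p = (s, \<omega>)" "\<omega> \<in> space M" by (auto simp: space_pair_measure)
  have "(\<lambda>n. ?r n \<lfloor>real (Suc n) * s\<rfloor>) \<longlonglongrightarrow> s"
  proof (rule LIM_zero_cancel, rule Lim_null_comparison)
    show "\<forall>\<^sub>F n in sequentially. norm (?r n \<lfloor>real (Suc n) * s\<rfloor> - s) \<le> inverse (real (Suc n))"
    proof (intro always_eventually allI)
      fix n
      have "\<bar>real_of_int \<lfloor>real (Suc n) * s\<rfloor> - real (Suc n) * s\<bar> \<le> 1" by linarith
      then have "\<bar>real_of_int \<lfloor>real (Suc n) * s\<rfloor> - real (Suc n) * s\<bar> / real (Suc n) \<le> 1 / real (Suc n)"
        by (intro divide_right_mono) auto
      moreover have "?r n \<lfloor>real (Suc n) * s\<rfloor> - s = (real_of_int \<lfloor>real (Suc n) * s\<rfloor> - real (Suc n) * s) / real (Suc n)"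
        by (simp add: diff_divide_distrib del: of_nat_Suc)
      ultimately show "norm (?r n \<lfloor>real (Suc n) * s\<rfloor> - s) \<le> inverse (real (Suc n))"
        by (simp add: abs_divide inverse_eq_divide del: of_nat_Suc)
    qed
  qed (rule LIMSEQ_inverse_real_of_nat)
  then have "(\<lambda>n. Y (?r n \<lfloor>real (Suc n) * s\<rfloor>) \<omega>) \<longlonglongrightarrow> Y s \<omega>"
    by (rule continuous_on_tendsto_compose[OF cont[OF p(2)]]) auto
  then show "(\<lambda>n. ?F n p) \<longlonglongrightarrow> (case p of (s, \<omega>) \<Rightarrow> Y s \<omega>)" by (simp add: p del: of_nat_Suc)
qed

text \<open>The locale wants everywhere what a solution provides almost surely and for t \<ge> 0. So
  Y is X modified on a null set and frozen at its initial value for negative times, and b' is b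
  extended by 0. For t \<ge> 0 neither change affects the laws or the almost sure equation.\<close>

lemma mv_process_of_solution:
  fixes b :: "real \<Rightarrow> 'a::euclidean_space \<Rightarrow> 'a"
  assumes b_meas: "(\<lambda>(t, x). b t x) \<in> borel_measurable (restrict_space borel ({0..} \<times> UNIV))"
    and b_cont: "\<And>t. t \<ge> 0 \<Longrightarrow> continuous_on UNIV (b t)"
    and b_bound: "\<And>t x. t \<ge> 0 \<Longrightarrow> norm (b t x) \<le> K"
    and sol: "mckean_vlasov_solution M F W b \<mu>0 X"
  obtains Y \<beta> b' where "mv_process M Y W \<beta> K b'" "\<And>t. 0 \<le> t \<Longrightarrow> AE \<omega> in M. X t \<omega> = Y t \<omega>"
proof -
  note sol' = sol[unfolded mckean_vlasov_solution_def]
  have filt: "time_filtration M F" and bm: "brownian_motion M F W"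
    and Xad: "\<And>t. 0 \<le> t \<Longrightarrow> X t \<in> borel_measurable (F t)"
    and Xcont: "AE \<omega> in M. continuous_on {0..} (\<lambda>t. X t \<omega>)"
    and Xeq: "AE \<omega> in M. \<forall>t\<ge>0.
        set_integrable lborel {0..t} (\<lambda>s. conv_drift b s (X s \<omega>) (distr M borel (X s))) \<and>
        X t \<omega> = X 0 \<omega> + (LBINT s:{0..t}. conv_drift b s (X s \<omega>) (distr M borel (X s))) + W t \<omega>"
    using sol' by auto
  interpret prob_space M using sol' by blast
  have sub: "subalgebra M (F t)" if "0 \<le> t" for t using filt that by (simp add: time_filtration_def)
  have X_meas: "X t \<in> borel_measurable M" if "0 \<le> t" for t
    by (rule measurable_from_subalg[OF sub[OF that] Xad[OF that]])
  have W_meas: "W t \<in> borel_measurable M" if "0 \<le> t" for t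
    using bm that by (intro measurable_from_subalg[OF sub[OF that]]) (simp add: brownian_motion_def)
  \<comment> \<open>The set of discontinuous paths need not be measurable; N is a measurable null
    set that contains it.\<close>
  from Xcont obtain N where N: "N \<in> null_sets M" "{\<omega> \<in> space M. \<not> continuous_on {0..} (\<lambda>t. X t \<omega>)} \<subseteq> N"
    by (auto elim!: AE_E simp: null_sets_def)
  have [measurable]: "N \<in> sets M" using N(1) by auto
  define Y where "Y s \<omega> = (if \<omega> \<in> N then 0 else X (max 0 s) \<omega>)" for s \<omega>
  define b' where "b' s x = (if s \<ge> 0 then b s x else 0)" for s x
  define \<beta> where "\<beta> s \<omega> = (\<integral>\<omega>'. b' s (Y s \<omega> - Y s \<omega>') \<partial>M)" for s \<omega>
  have aeN: "AE \<omega> in M. \<omega> \<notin> N" using N(1) by (rule AE_not_in)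
  have XY: "AE \<omega> in M. X t \<omega> = Y t \<omega>" if "0 \<le> t" for t
    using aeN by eventually_elim (simp add: Y_def that)
  have K: "0 \<le> K" using order_trans[OF norm_ge_zero b_bound[of 0]] by simp
  have Y_meas [measurable]: "Y s \<in> borel_measurable M" for s
    using X_meas[of "max 0 s"] unfolding Y_def by measurable
  have "(\<lambda>(s, \<omega>). Y s \<omega>) \<in> borel_measurable (borel \<Otimes>\<^sub>M M)"
  proof (rule measurable_of_continuous_paths[OF Y_meas])
    fix \<omega> assume \<omega>: "\<omega> \<in> space M"
    show "continuous_on UNIV (\<lambda>s. Y s \<omega>)"
    proof (cases "\<omega> \<in> N")
      case False
      then have "continuous_on {0..} (\<lambda>t. X t \<omega>)" using N(2) \<omega> by blast
      then have "continuous_on UNIV (\<lambda>s. X (max 0 s) \<omega>)"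
        by (rule continuous_on_compose2) (auto intro!: continuous_intros)
      then show ?thesis using False by (simp add: Y_def)
    qed (simp add: Y_def)
  qed
  note Yj [measurable] = this
  have b'j: "(\<lambda>(s, x). b' s x) \<in> borel_measurable (borel \<Otimes>\<^sub>M borel)"
  proof -
    have "(\<lambda>p. if p \<in> {0..} \<times> UNIV then (\<lambda>(t, x). b t x) p else 0) \<in> borel_measurable (borel :: (real \<times> 'a) measure)"
      using b_meas by (subst (asm) measurable_restrict_space_iff[where c=0]) (auto intro!: borel_closed closed_Times)
    moreover have "(\<lambda>p. if p \<in> {0..} \<times> UNIV then (\<lambda>(t, x). b t x) p else 0) = (\<lambda>(s, x). b' s x)"
      by (auto simp: fun_eq_iff b'_def)
    ultimately show ?thesis by (simp add: borel_prod)
  qed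
  have b'c: "continuous_on UNIV (b' s)" for s
    using b_cont[of s] by (cases "0 \<le> s") (auto simp: b'_def[abs_def])
  have b'b: "norm (b' s x) \<le> K" for s x using b_bound[of s x] K by (simp add: b'_def)
  have \<beta>j: "(\<lambda>(s, \<omega>). \<beta> s \<omega>) \<in> borel_measurable (borel \<Otimes>\<^sub>M M)"
  proof -
    note [measurable] = b'j
    have Y1: "(\<lambda>p. Y (fst (fst p)) (snd (fst p))) \<in> borel_measurable ((borel \<Otimes>\<^sub>M M) \<Otimes>\<^sub>M M)"
      using measurable_compose[OF _ Yj, of "\<lambda>p. (fst (fst p), snd (fst p))" "(borel \<Otimes>\<^sub>M M) \<Otimes>\<^sub>M M"] by simp
    have Y2: "(\<lambda>p. Y (fst (fst p)) (snd p)) \<in> borel_measurable ((borel \<Otimes>\<^sub>M M) \<Otimes>\<^sub>M M)"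
      using measurable_compose[OF _ Yj, of "\<lambda>p. (fst (fst p), snd p)" "(borel \<Otimes>\<^sub>M M) \<Otimes>\<^sub>M M"] by simp
    have "(\<lambda>p. b' (fst (fst p)) (Y (fst (fst p)) (snd (fst p)) - Y (fst (fst p)) (snd p))) \<in> borel_measurable ((borel \<Otimes>\<^sub>M M) \<Otimes>\<^sub>M M)"
      using measurable_compose[OF _ b'j, of "\<lambda>p. (fst (fst p), Y (fst (fst p)) (snd (fst p)) - Y (fst (fst p)) (snd p))" "(borel \<Otimes>\<^sub>M M) \<Otimes>\<^sub>M M"] Y1 Y2
      by simp
    then have "(\<lambda>p. \<integral>\<omega>'. b' (fst p) (Y (fst p) (snd p) - Y (fst p) \<omega>') \<partial>M) \<in> borel_measurable (borel \<Otimes>\<^sub>M M)"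
      by (intro borel_measurable_lebesgue_integral) (simp add: case_prod_beta')
    then show ?thesis by (simp add: \<beta>_def case_prod_beta')
  qed
  have \<beta>b: "norm (\<beta> s \<omega>) \<le> K" for s \<omega>
  proof (cases "integrable M (\<lambda>\<omega>'. b' s (Y s \<omega> - Y s \<omega>'))")
    case True
    have "norm (\<beta> s \<omega>) \<le> (\<integral>\<omega>'. norm (b' s (Y s \<omega> - Y s \<omega>')) \<partial>M)"
      unfolding \<beta>_def by (rule integral_norm_bound)
    also have "\<dots> \<le> (\<integral>\<omega>'. K \<partial>M)"
      using True by (intro integral_mono integrable_norm b'b) auto
    finally show ?thesis using prob_space by simp
  qed (use K in \<open>simp add: \<beta>_def not_integrable_integral_eq\<close>)
  have incr: "distr M borel (\<lambda>\<omega>. W t \<omega> - W s \<omega>) = gauss (t - s)"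
    and ind: "indep_set (sets (F s)) (sets (vimage_algebra (space M) (\<lambda>\<omega>. W t \<omega> - W s \<omega>) borel))"
    if st: "0 \<le> s" "s < t" for s t
  proof -
    have "distributed M lborel (\<lambda>\<omega>. W t \<omega> - W s \<omega>)
          (\<lambda>x. ennreal (\<Prod>i\<in>Basis. normal_density 0 (sqrt (t - s)) (x \<bullet> i)))"
      using bm st by (simp add: brownian_motion_def)
    then have "distr M lborel (\<lambda>\<omega>. W t \<omega> - W s \<omega>) = gauss (t - s)"
      unfolding gauss_def gauss_density_def by (rule distributed_distr_eq_density)
    then show "distr M borel (\<lambda>\<omega>. W t \<omega> - W s \<omega>) = gauss (t - s)"
      by (metis distr_cong sets_lborel)
    show "indep_set (sets (F s)) (sets (vimage_algebra (space M) (\<lambda>\<omega>. W t \<omega> - W s \<omega>) borel))"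
      using bm st by (simp add: brownian_motion_def)
  qed
  have indep: "(\<integral>\<omega>. f (Y s \<omega> + (W t \<omega> - W s \<omega>)) \<partial>M) = (\<integral>\<omega>. heat (t - s) f (Y s \<omega>) \<partial>M)"
    if st: "0 \<le> s" "s < t" and f: "bounded_borel B f" for s t B f
  proof -
    let ?D = "\<lambda>\<omega>. W t \<omega> - W s \<omega>"
    note [measurable] = bounded_borelD(1)[OF f] bounded_borelD(1)[OF heat_bounded[OF _ f, of "t - s"]] X_meas[OF st(1)]
    have h [measurable]: "heat (t - s) f \<in> borel_measurable borel"
      using bounded_borelD(1)[OF heat_bounded[OF _ f, of "t - s"]] st by simp
    have Dm [measurable]: "?D \<in> borel_measurable M" using W_meas st by simp
    \<comment> \<open>X_s generates a sub-algebra of F_s, so the independence of the increment from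
      F_s descends to it. This is done for X and not for Y, because N need not belong to
      F_s.\<close>
    have "indep_var borel (X s) borel ?D"
      unfolding indep_var_eq
    proof (intro conjI X_meas st Dm)
      have sF: "space (F s) = space M" using sub[OF st(1)] by (simp add: subalgebra_def)
      have 1: "sigma_sets (space M) {X s -` A \<inter> space M |A. A \<in> sets borel} \<subseteq> sets (F s)"
        using Xad[OF st(1)] unfolding sF[symmetric]
        by (intro sets.sigma_sets_subset) (auto dest: measurable_sets)
      have 2: "sigma_sets (space M) {?D -` A \<inter> space M |A. A \<in> sets borel} = sets (vimage_algebra (space M) ?D borel)"
        by (simp add: sets_vimage_algebra)
      show "indep_set (sigma_sets (space M) {X s -` A \<inter> space M |A. A \<in> sets borel})
          (sigma_sets (space M) {?D -` A \<inter> space M |A. A \<in> sets borel})"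
        using ind[OF st] 1 unfolding 2 indep_sets2_eq by blast
    qed
    then have j: "distr M borel (X s) \<Otimes>\<^sub>M distr M borel ?D = distr M (borel \<Otimes>\<^sub>M borel) (\<lambda>\<omega>. (X s \<omega>, ?D \<omega>))"
      unfolding indep_var_distribution_eq by blast
    interpret PX: prob_space "distr M borel (X s)" using X_meas[OF st(1)] by (rule prob_space_distr)
    interpret PD: prob_space "distr M borel ?D" using Dm by (rule prob_space_distr)
    interpret P: pair_prob_space "distr M borel (X s)" "distr M borel ?D" ..
    have "(\<integral>\<omega>. f (Y s \<omega> + ?D \<omega>) \<partial>M) = (\<integral>\<omega>. f (X s \<omega> + ?D \<omega>) \<partial>M)"
      by (rule integral_cong_AE) (use XY[OF st(1)] in auto)
    also have "\<dots> = (\<integral>p. f (fst p + snd p) \<partial>distr M (borel \<Otimes>\<^sub>M borel) (\<lambda>\<omega>. (X s \<omega>, ?D \<omega>)))"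
      by (subst integral_distr) auto
    also have "\<dots> = (\<integral>x. \<integral>w. f (x + w) \<partial>distr M borel ?D \<partial>distr M borel (X s))"
      unfolding j[symmetric]
      by (subst P.integral_fst'[symmetric]) (auto intro!: P.P.integrable_const_bound[of _ B] bounded_borelD(2)[OF f])
    also have "\<dots> = (\<integral>x. heat (t - s) f x \<partial>distr M borel (X s))"
      unfolding incr[OF st] heat_def ..
    also have "\<dots> = (\<integral>\<omega>. heat (t - s) f (X s \<omega>) \<partial>M)"
      by (subst integral_distr) auto
    also have "\<dots> = (\<integral>\<omega>. heat (t - s) f (Y s \<omega>) \<partial>M)"
      by (rule integral_cong_AE) (use XY[OF st(1)] in auto)
    finally show ?thesis .
  qed
  \<comment> \<open>Under the mean, X_r may be replaced by Y_r almost surely; in the outer argument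
    \<omega> is fixed, which is why it must lie outside N.\<close>
  have drift: "conv_drift b r (X r \<omega>) (distr M borel (X r)) = \<beta> r \<omega>" if "0 \<le> r" "\<omega> \<notin> N" for r \<omega>
  proof -
    note [measurable] = X_meas[OF that(1)] borel_measurable_continuous_onI[OF b_cont[OF that(1)]]
    have "conv_drift b r (X r \<omega>) (distr M borel (X r)) = (\<integral>\<omega>'. b r (X r \<omega> - X r \<omega>') \<partial>M)"
      unfolding conv_drift_def by (subst integral_distr) auto
    also have "\<dots> = (\<integral>\<omega>'. b r (X r \<omega> - Y r \<omega>') \<partial>M)"
      by (rule integral_cong_AE) (use XY[OF that(1)] in auto)
    also have "\<dots> = \<beta> r \<omega>" using that by (simp add: \<beta>_def b'_def Y_def)
    finally show ?thesis .
  qed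
  \<comment> \<open>Subtract the integral equations at the times t and s.\<close>
  have eqn: "AE \<omega> in M. Y t \<omega> = Y s \<omega> + (LINT r:{s<..t}|lborel. \<beta> r \<omega>) + (W t \<omega> - W s \<omega>)"
    if st: "0 \<le> s" "s < t" for s t
    using Xeq aeN
  proof eventually_elim
    case (elim \<omega>)
    let ?c = "\<lambda>s. conv_drift b s (X s \<omega>) (distr M borel (X s))"
    have t: "set_integrable lborel {0..t} ?c" "X t \<omega> = X 0 \<omega> + (LBINT s:{0..t}. ?c s) + W t \<omega>"
      and s: "set_integrable lborel {0..s} ?c" "X s \<omega> = X 0 \<omega> + (LBINT s:{0..s}. ?c s) + W s \<omega>"
      using elim(1)[rule_format, OF order_trans[OF st(1) less_imp_le[OF st(2)]]] elim(1)[rule_format, OF st(1)] by blast+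
    have "{0..t} = {0..s} \<union> {s<..t}" using st by auto
    moreover have "set_integrable lborel {s<..t} ?c" by (rule set_integrable_subset[OF t(1)]) (use st in auto)
    ultimately have "(LBINT s:{0..t}. ?c s) = (LBINT s:{0..s}. ?c s) + (LBINT s:{s<..t}. ?c s)"
      using s(1) by (simp add: set_integral_Un disjoint_iff)
    moreover have "(LBINT r:{s<..t}. ?c r) = (LINT r:{s<..t}|lborel. \<beta> r \<omega>)"
      using st elim(2) by (intro set_lebesgue_integral_cong) (auto simp: drift)
    ultimately show ?case using t(2) s(2) st elim(2) by (simp add: Y_def)
  qed
  have "mv_process M Y W \<beta> K b'"
  proof unfold_locales
    show "(\<lambda>(s, \<omega>). Y s \<omega>) \<in> borel_measurable (borel \<Otimes>\<^sub>M M)" by (rule Yj)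
    show "(\<lambda>(s, \<omega>). \<beta> s \<omega>) \<in> borel_measurable (borel \<Otimes>\<^sub>M M)" by (rule \<beta>j)
    show "\<beta> s \<omega> = (\<integral>\<omega>'. b' s (Y s \<omega> - Y s \<omega>') \<partial>M)" for s \<omega> by (rule \<beta>_def)
  qed (fact W_meas \<beta>b incr indep eqn b'c b'b)+
  then show thesis using that XY by blast
qed

text \<open>The last window before t is used: start t - T and age T. Each difference in j multiplies
  the mean of the character by -2, so the N-th difference is at least as large as the characteristic
  function; and it is at most of order |v|^N, where |v| is a multiple of 1 / |\<xi>|.\<close>

lemma (in mv_process) char_function_decay:
  assumes t: "0 < t"
  obtains C where "\<And>\<xi>. norm (\<integral>\<omega>. cis (\<xi> \<bullet> X t \<omega>) \<partial>M) * norm \<xi> ^ N \<le> C"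
proof -
  from shift_mean_dif_bound[OF t, of N] obtain T where T: "0 < T" "T \<le> t"
    and ex: "\<exists>C\<ge>1. \<forall>s v q g B n. 0 \<le> s \<longrightarrow> 0 \<le> q \<longrightarrow> q \<le> T \<longrightarrow> bounded_borel B g \<longrightarrow> continuous_on UNIV g \<longrightarrow>
      \<bar>(dif ^^ N) (shift_mean v s q g) n\<bar> \<le> B * (C * norm v ^ N)"
    by (metis order_refl)
  from ex obtain C where C: "1 \<le> C"
    "\<And>s v q g B n. 0 \<le> s \<Longrightarrow> 0 \<le> q \<Longrightarrow> q \<le> T \<Longrightarrow> bounded_borel B g \<Longrightarrow> continuous_on UNIV g \<Longrightarrow>
      \<bar>(dif ^^ N) (shift_mean v s q g) n\<bar> \<le> B * (C * norm v ^ N)"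
    by blast
  define \<Phi> where "\<Phi> \<xi> = (\<integral>\<omega>. cis (\<xi> \<bullet> X t \<omega>) \<partial>M)" for \<xi>
  have int: "integrable M (\<lambda>\<omega>. cis (\<xi> \<bullet> X t \<omega>))" for \<xi>
    by (rule integrable_const_bound[of _ 1]) auto
  have nb: "norm (\<Phi> \<xi>) \<le> 1" for \<xi>
  proof -
    have "norm (\<Phi> \<xi>) \<le> (\<integral>\<omega>. norm (cis (\<xi> \<bullet> X t \<omega>)) \<partial>M)" unfolding \<Phi>_def by (rule integral_norm_bound)
    then show ?thesis using prob_space by simp
  qed
  \<comment> \<open>The factor 2 adds real and imaginary parts, which are bounded separately because
    test functions are real; pi / T is norm v times norm \<xi>.\<close>
  define A where "A = 2 * (C * (pi / T) ^ N)"
  have A: "0 \<le> A" using C(1) T(1) by (simp add: A_def)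
  \<comment> \<open>The summand 1 covers \<xi> = 0, where the power equals 1 if N = 0.\<close>
  have "norm (\<Phi> \<xi>) * norm \<xi> ^ N \<le> A + 1" for \<xi>
  proof (cases "\<xi> = 0")
    case True
    have "norm \<xi> ^ N \<le> 1" using True by (simp add: power_0_left)
    then have "norm (\<Phi> \<xi>) * norm \<xi> ^ N \<le> 1 * 1" using nb by (intro mult_mono) auto
    then show ?thesis using A by simp
  next
    case False
    \<comment> \<open>The vector parallel to \<xi>, hence of least norm, with T (\<xi> \<bullet> v)
      = pi.\<close>
    define v where "v = (pi / (T * (norm \<xi>)\<^sup>2)) *\<^sub>R \<xi>"
    have v: "norm v = pi / T / norm \<xi>"
      using False T(1) by (simp add: v_def power2_eq_square)
    have xv: "\<xi> \<bullet> v * T = pi"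
      using False T(1) by (simp add: v_def dot_square_norm)
    \<comment> \<open>The shift by \<open>v\<close> is chosen so that it flips the sign of the character.\<close>
    have cs: "cis (\<xi> \<bullet> (x - (real j * T) *\<^sub>R v)) = cis (\<xi> \<bullet> x) * (- 1) ^ j" for x j
    proof -
      have "\<xi> \<bullet> (x - (real j * T) *\<^sub>R v) = \<xi> \<bullet> x + real j * (- pi)"
        using xv by (simp add: inner_diff_right) (metis mult.commute mult.left_commute)
      moreover have "cis (real j * (- pi)) = (- 1) ^ j"
      proof -
        have "cis (- pi) = - 1" by (simp add: complex_eq_iff)
        then show ?thesis unfolding Complex.DeMoivre[symmetric] by (simp only:)
      qed
      ultimately show ?thesis by (simp only: cis_mult[symmetric])
    qed
    have st: "t - T + T = t" by simp
    have re: "shift_mean v (t - T) T (\<lambda>x. Re (cis (\<xi> \<bullet> x))) = (\<lambda>j. Re (\<Phi> \<xi> * (- 1) ^ j))"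
      and im: "shift_mean v (t - T) T (\<lambda>x. Im (cis (\<xi> \<bullet> x))) = (\<lambda>j. Im (\<Phi> \<xi> * (- 1) ^ j))"
      unfolding shift_mean_def st cs \<Phi>_def
      by (simp_all only: integral_mult_left_zero[symmetric] integral_Re[OF integrable_mult_left[OF int]]
          integral_Im[OF integrable_mult_left[OF int]])
    have pw: "(dif ^^ N) (\<lambda>j. \<Phi> \<xi> * (- 1) ^ j) 0 = \<Phi> \<xi> * (- 2) ^ N"
      unfolding dif_pow_mult dif_pow_power by simp
    have bR: "bounded_borel 1 (\<lambda>x. Re (cis (\<xi> \<bullet> x)))" and bI: "bounded_borel 1 (\<lambda>x. Im (cis (\<xi> \<bullet> x)))"
      by (simp_all add: bounded_borel_def)
    have cR: "continuous_on UNIV (\<lambda>x. Re (cis (\<xi> \<bullet> x)))" and cI: "continuous_on UNIV (\<lambda>x. Im (cis (\<xi> \<bullet> x)))"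
      by (simp_all add: continuous_intros)
    have "\<bar>Re (\<Phi> \<xi> * (- 2) ^ N)\<bar> \<le> 1 * (C * norm v ^ N)" "\<bar>Im (\<Phi> \<xi> * (- 2) ^ N)\<bar> \<le> 1 * (C * norm v ^ N)"
      using C(2)[OF _ _ order_refl bR cR, of "t - T" v 0] C(2)[OF _ _ order_refl bI cI, of "t - T" v 0] T
      unfolding re im dif_pow_Re dif_pow_Im pw by simp_all
    then have "norm (\<Phi> \<xi> * (- 2) ^ N) \<le> 2 * (C * norm v ^ N)"
      using cmod_le[of "\<Phi> \<xi> * (- 2) ^ N"] by linarith
    moreover have "norm (\<Phi> \<xi>) * 1 \<le> norm (\<Phi> \<xi>) * 2 ^ N" by (intro mult_left_mono) auto
    ultimately have "norm (\<Phi> \<xi>) \<le> 2 * (C * norm v ^ N)"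
      by (simp add: norm_mult norm_power)
    then have "norm (\<Phi> \<xi>) * norm \<xi> ^ N \<le> 2 * (C * norm v ^ N) * norm \<xi> ^ N" by (intro mult_right_mono) auto
    also have "\<dots> = A" unfolding v A_def using False by (simp add: power_divide power_mult_distrib)
    finally show ?thesis by simp
  qed
  then show thesis using that unfolding \<Phi>_def by blast
qed

theorem corollary1p3:
  fixes \<alpha> :: real
    and b :: "real \<Rightarrow> real ^ 'd::finite \<Rightarrow> real ^ 'd"
    and \<mu>0 :: "(real ^ 'd) measure"
    and M :: "'w measure"
    and F :: "real \<Rightarrow> 'w measure"
    and W X :: "real \<Rightarrow> 'w \<Rightarrow> real ^ 'd"
  assumes "\<alpha> > 0"
    and "(\<lambda>(t, x). b t x) \<in> borel_measurable (restrict_space borel ({0..} \<times> UNIV))"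
    and "\<And>t. t \<ge> 0 \<Longrightarrow> b t \<in> Cb_space \<alpha>"
    and "(SUP t\<in>{0..}. Cb_norm \<alpha> (b t)) < \<infinity>"
    and "prob_space \<mu>0" and "sets \<mu>0 = sets borel"
    and "mckean_vlasov_solution M F W b \<mu>0 X"
  shows "\<forall>t>0. \<exists>p :: real ^ 'd \<Rightarrow> real.
           (\<forall>x. 0 \<le> p x) \<and>
           distributed M lborel (X t) (\<lambda>x. ennreal (p x)) \<and>
           (\<forall>\<gamma>\<in>{0<..<1}. p \<in> Cb_space (2 + \<gamma>))"
proof (intro allI impI)
  fix t :: real assume t: "0 < t"
  define S where "S = (SUP t\<in>{0..}. Cb_norm \<alpha> (b t))"
  have S: "S = ennreal (enn2real S)" using assms(4) by (simp add: S_def)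
  have b_bound: "norm (b s x) \<le> enn2real S" if "0 \<le> s" for s x
  proof -
    have "ennreal (norm (b s x)) \<le> S"
      unfolding S_def using that by (intro order_trans[OF norm_le_Cb_norm[where \<alpha>=\<alpha>]] SUP_upper) auto
    then show ?thesis by (subst (asm) S) simp
  qed
  obtain Y \<beta> b' where mv: "mv_process M Y W \<beta> (enn2real S) b'" and XY: "\<And>t. 0 \<le> t \<Longrightarrow> AE \<omega> in M. X t \<omega> = Y t \<omega>"
    using mv_process_of_solution[OF assms(2) Cb_space_continuous[OF assms(1,3)] b_bound assms(7)] by blast
  interpret mv_process M Y W \<beta> "enn2real S" b' by (rule mv)
  define \<mu> where "\<mu> = distr M borel (Y t)"
  have X_meas [measurable]: "X t \<in> borel_measurable M"
    using assms(7) t measurable_from_subalg[of M "F t" "X t" borel]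
    unfolding mckean_vlasov_solution_def time_filtration_def by simp
  have char: "(\<integral>z. cis (\<xi> \<bullet> z) \<partial>\<mu>) = (\<integral>\<omega>. cis (\<xi> \<bullet> Y t \<omega>) \<partial>M)" for \<xi>
    unfolding \<mu>_def by (rule integral_distr) measurable
  \<comment> \<open>\<open>moment_of_decay\<close> spends twice the dimension on integrability, and
    \<open>fourier_re_in_Cb_space\<close> asks for three moments.\<close>
  let ?N = "2 * DIM(real ^ 'd) + 3"
  obtain C where C: "\<And>\<xi>. norm (\<integral>\<omega>. cis (\<xi> \<bullet> Y t \<omega>) \<partial>M) * norm \<xi> ^ ?N \<le> C"
    using char_function_decay[OF t] by blast
  have mom: "moment 3 (\<lambda>\<xi>. \<integral>z. cis (\<xi> \<bullet> z) \<partial>\<mu>)"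
    unfolding char
  proof (rule moment_of_decay[OF _ _ C])
    show "(\<lambda>\<xi>. \<integral>\<omega>. cis (\<xi> \<bullet> Y t \<omega>) \<partial>M) \<in> borel_measurable borel" by measurable
    show "norm (\<integral>\<omega>. cis (\<xi> \<bullet> Y t \<omega>) \<partial>M) \<le> 1" for \<xi>
      using integral_norm_bound[of M "\<lambda>\<omega>. cis (\<xi> \<bullet> Y t \<omega>)"] prob_space by simp
  qed
  interpret \<mu>: integrable_char_function \<mu>
  proof (intro integrable_char_function.intro integrable_char_function_axioms.intro)
    show "prob_space \<mu>" unfolding \<mu>_def by (rule prob_space_distr) measurable
    show "sets \<mu> = sets borel" by (simp add: \<mu>_def)
    show "moment 0 (\<lambda>\<xi>. \<integral>z. cis (\<xi> \<bullet> z) \<partial>\<mu>)" by (rule moment_mono[OF mom]) simp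
  qed
  \<comment> \<open>X_t and Y_t agree almost surely, and \<open>lborel\<close> has the same
    measurable sets as \<open>borel\<close>.\<close>
  have "distr M lborel (X t) = \<mu>"
    unfolding \<mu>_def using XY[of t] t by (intro trans[OF distr_cong_AE distr_cong]) auto
  then have "distributed M lborel (X t) (\<lambda>x. ennreal (\<mu>.p x))"
    using \<mu>.density_p by (auto simp: distributed_def)
  then show "\<exists>p. (\<forall>x. 0 \<le> p x) \<and> distributed M lborel (X t) (\<lambda>x. ennreal (p x)) \<and> (\<forall>\<gamma>\<in>{0<..<1}. p \<in> Cb_space (2 + \<gamma>))"
    using \<mu>.p_nonneg fourier_re_in_Cb_space[OF \<mu>.moment_\<phi>[OF mom]] unfolding \<mu>.p_def
    by (intro exI[of _ "fourier_re \<mu>.\<phi>"]) auto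
qed

end
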